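(* Let $M$, $A$, $I$, $\nu$, $s$, $\mathcal{B}(A,I)$ be as in the context (in particular $s$ is locally constant, and $\mathcal{B}(A,I)$ is topologically transitive and admits a spectral decomposition). For any potential $\varphi \in \mathcal{H}_{\alpha}(\mathcal{B}(A, I))$ the following hold: (1) There are $\lambda_{\varphi} > 0$ and a strictly positive function $f_{\varphi} \in \mathcal{H}_{\alpha}(\mathcal{B}(A, I))$ such that $\mathcal{L}_{\varphi}(f_{\varphi}) = \lambda_{\varphi}f_{\varphi}$. Moreover, the eigenvalue $\lambda_{\varphi}$ is simple and maximal. (2) There exists a Borel probability measure $\rho_{\varphi}$ on $\mathcal{B}(A, I)$ such that $\mathcal{L}^*_{\varphi}(\rho_{\varphi}) = \lambda_{\varphi}\rho_{\varphi}$. (3) For $\overline{\varphi} = \varphi + \log(f_{\varphi}) - \log(f_{\varphi} \circ \sigma) - \log(\lambda_{\varphi})$, there is a unique Borel probability measure $\mu_{\varphi}$ on $\mathcal{B}(A,I)$ that is a fixed point of the operator $\mathcal{L}^*_{\overline{\varphi}}$. Moreover, $\mu_\varphi$ is $\sigma$-invariant and can be expressed as $d\mu_{\varphi} = f_{\varphi}\,d\rho_{\varphi}$, with $f_{\varphi}$ satisfying (1) and $\rho_{\varphi}$ satisfying (2). (4) If, in addition, $\mathcal{B}(A,I)$ is topologically mixing, then for any $\psi \in \mathcal{H}_{\alpha}(\mathcal{B}(A, I))$ we have $$\lim_{n \to \infty}\mathcal{L}^n_{\overline{\varphi}}(\psi) = \int_{\mathcal{B}(A,I)} \psi \, d\mu_{\varphi}$$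 uniformly in the norm $\|\cdot\|_{\infty}$. Moreover, under this assumption the maximal eigenvalue $\lambda_\varphi$ is isolated as well: the remainder of the spectrum of $\mathcal{L}_\varphi$ is contained in a disk centered at zero with radius strictly smaller than $\lambda_\varphi$.
   Context: $(M,d_M)$ is a compact metric space, $\mathbb{N}=\{1,2,\dots\}$, and $X=M^{\mathbb{N}}$ has the metric $d(x,y)=\sum_{n\ge1}2^{-n}d_M(x_n,y_n)$. The shift is $\sigma((x_n)_{n})=(x_{n+1})_{n}$. $A:M\times M\to\mathbb{R}$ is continuous and $I\subset\mathbb{R}$ is compact. The set of admissible sequences is $\mathcal{B}(A,I)=\{x\in X: A(x_n,x_{n+1})\in I \text{ for all } n\in\mathbb{N}\}$, a closed $\sigma$-invariant subset of $X$ with the induced metric. For $b\in M$, $s(b)=\{a\in M: A(a,b)\in I\}$, a compact subset of $M$. Standing assumptions. (i) The map $s$ from $M$ to the collection $\mathcal{K}(M)$ of compact subsets of $M$ is locally constant: each $b\in M$ has an open neighborhood on which $s$ is constant. (ii) $\mathcal{B}(A,I)$ is topologically transitive: for any nonempty open $U,V\subset\mathcal{B}(A,I)$ there is $n\in\mathbb{N}$ with $\sigma^{-n}(U)\cap V\neq\emptyset$. (iii) $\mathcal{B}(A,I)$ admits a spectral decomposition: there are $k\in\mathbb{N}$ and a permutation $\mathbf{p}$ of $\{1,\dots,k\}$ with $\mathcal{B}(A,I)=\mathcal{B}(A,I)_1\cup\dots\cup\mathcal{B}(A,I)_k$, the sets $\mathcal{B}(A,I)_i$ being pairwise disjoint and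 closed, $\sigma(\mathcal{B}(A,I)_i)=\mathcal{B}(A,I)_{\mathbf{p}(i)}$, and each $\mathcal{B}(A,I)_i$ topologically mixing for $\sigma^{m_i}$, where $m_i$ is the least positive integer with $\mathbf{p}^{m_i}(i)=i$. (iv) $\nu$ is a fixed Borel probability measure on $M$ with full support. Topologically mixing: for any nonempty open $U,V$ there is $n\in\mathbb{N}$ with $\sigma^{-m}(U)\cap V\ne\emptyset$ for all $m\ge n$. $\mathcal{H}_\alpha(Y)$ is the Banach space of $\alpha$-Hölder continuous functions on $Y$ with norm $\|\varphi\|_\alpha=\|\varphi\|_\infty+\mathrm{Hol}_\varphi$, where $\mathrm{Hol}_\varphi=\sup_{x\ne y}|\varphi(x)-\varphi(y)|/d(x,y)^\alpha$; $\mathcal{C}(Y)$ is the space of continuous functions on $Y$. For continuous $\varphi$ the (generalized) Ruelle operator is $\mathcal{L}_\varphi(\psi)(x)=\int_{s(x_1)}e^{\varphi(ax)}\psi(ax)\,d\nu(a)$, where $ax=(a,x_1,x_2,\dots)$; it preserves $\mathcal{C}(\mathcal{B}(A,I))$ and, for $\varphi\in\mathcal{H}_\alpha(\mathcal{B}(A,I))$, also $\mathcal{H}_\alpha(\mathcal{B}(A,I))$. Its dual $\mathcal{L}_\varphi^*$ acts on Borel measures by $\int\psi\,d\mathcal{L}_\varphi^*(\mu)=\int\mathcal{L}_\varphi(\psi)\,d\mu$ for all $\psi\in\mathcal{C}(\mathcal{B}(A,I))$. Spectral statements refer to $\mathcal{L}_\varphi$ acting on $\mathcal{H}_\alpha(\mathcal{B}(A,I))$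 (complexified where needed). "Simple" means that the eigenspace is one-dimensional; "maximal" means that every eigenvalue $\lambda$ satisfies $|\lambda|\le\lambda_\varphi$.
   Formalization: Assumes also that B(A,I) is nonempty and that ν has full support on each s(x_1), x in B(A,I); full support on M alone is not enough: for M=[0,1] with Lebesgue measure, A(a,b)=a, I={0}, the Ruelle operator is zero. *)

theory Defs
  imports "HOL-Probability.Probability"
begin

section \<open>The sequence space\<close>

text \<open>
  A sequence \<open>(x\<^sub>1, x\<^sub>2, \<dots>)\<close> is a function \<open>x :: nat \<Rightarrow> 'a\<close> with \<open>x n\<close> standing for the entry of
  index \<open>n + 1\<close>; prepending a letter \<open>a\<close> is \<open>case_nat a x\<close>.
\<close>

definition shift :: "(nat \<Rightarrow> 'a) \<Rightarrow> (nat \<Rightarrow> 'a)" where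
  "shift x = (\<lambda>n. x (Suc n))"

text \<open>
  Not the metric \<^const>\<open>dist\<close> which the library installs on \<open>nat \<Rightarrow> 'a\<close>. Both induce the product
  topology when the alphabet is compact (see \<open>open_iff_seq_dist\<close> below), but Hoelder constants
  depend on the metric.
\<close>

definition seq_dist :: "(nat \<Rightarrow> 'a::metric_space) \<Rightarrow> (nat \<Rightarrow> 'a) \<Rightarrow> real" where
  "seq_dist x y = (\<Sum>n. (1/2) ^ Suc n * dist (x n) (y n))"

lemma compact_UNIV_bounded_dist:
  assumes "compact (UNIV :: 'a::metric_space set)"
  shows "\<exists>D. \<forall>a b :: 'a. dist a b \<le> D"
  using compact_imp_bounded[OF assms] by (simp add: bounded_two_points)

lemma summable_seq_dist:
  assumes "compact (UNIV :: 'a::metric_space set)"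
  shows "summable (\<lambda>n. (1/2) ^ Suc n * dist (x n) (y n :: 'a))"
proof -
  obtain D where D: "\<And>a b :: 'a. dist a b \<le> D"
    using compact_UNIV_bounded_dist[OF assms] by blast
  have "summable (\<lambda>n. (1/2::real) ^ Suc n * D)"
    by (intro summable_mult2 summable_Suc_iff[THEN iffD2] summable_geometric) simp
  then show ?thesis
    by (rule summable_comparison_test') (use D in \<open>auto intro!: mult_left_mono\<close>)
qed

lemma continuous_on_seq_dist:
  assumes "compact (UNIV :: 'a::metric_space set)"
  shows "continuous_on UNIV (\<lambda>y. seq_dist x (y :: nat \<Rightarrow> 'a))"
proof -
  obtain D where D: "\<And>a b :: 'a. dist a b \<le> D"
    using compact_UNIV_bounded_dist[OF assms] by blast
  have S: "summable (\<lambda>n. (1/2::real) ^ Suc n * D)"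
    by (intro summable_mult2 summable_Suc_iff[THEN iffD2] summable_geometric) simp
  have "uniform_limit UNIV (\<lambda>N (y :: nat \<Rightarrow> 'a). \<Sum>n<N. (1/2) ^ Suc n * dist (x n) (y n))
          (\<lambda>y. \<Sum>n. (1/2) ^ Suc n * dist (x n) (y n)) sequentially"
    by (rule Weierstrass_m_test[OF _ S]) (use D in \<open>auto intro!: mult_left_mono\<close>)
  moreover have "\<forall>\<^sub>F N in sequentially. continuous_on UNIV
      (\<lambda>y :: nat \<Rightarrow> 'a. \<Sum>n<N. (1/2) ^ Suc n * dist (x n) (y n))"
    by (intro always_eventually allI continuous_intros
        continuous_on_product_coordinates)
  ultimately show ?thesis
    unfolding seq_dist_def by (intro uniform_limit_theorem[rotated]) auto
qed

lemma open_iff_seq_dist: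
  fixes S :: "(nat \<Rightarrow> 'a::metric_space) set"
  assumes "compact (UNIV :: 'a set)"
  shows "open S \<longleftrightarrow> (\<forall>x\<in>S. \<exists>e>0. \<forall>y. seq_dist x y < e \<longrightarrow> y \<in> S)"
proof (intro iffI ballI)
  fix x assume "open S" and "x \<in> S"
  then obtain X where X: "x \<in> (\<Pi>\<^sub>E i\<in>UNIV. X i)" "\<And>i. open (X i)"
      "finite {i. X i \<noteq> UNIV}" "(\<Pi>\<^sub>E i\<in>UNIV. X i) \<subseteq> S"
    unfolding open_fun_def
    using product_topology_open_contains_basis[of "\<lambda>i. euclidean" UNIV S x] by auto
  have "\<exists>r>0. \<forall>b. dist (x i) b < r \<longrightarrow> b \<in> X i" for i
    using X(1) X(2)[of i] unfolding open_dist by (metis PiE_mem UNIV_I dist_commute)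
  then obtain r where r: "\<And>i. r i > 0" "\<And>i b. dist (x i) b < r i \<Longrightarrow> b \<in> X i"
    by metis
  define e where "e = Min (insert 1 ((\<lambda>i. (1/2) ^ Suc i * r i) ` {i. X i \<noteq> UNIV}))"
  have "e > 0" unfolding e_def using X(3) r(1) by auto
  moreover have "y \<in> S" if y: "seq_dist x y < e" for y
  proof -
    have "y i \<in> X i" for i
    proof (cases "X i = UNIV")
      case False
      have "(1/2) ^ Suc i * dist (x i) (y i) \<le> seq_dist x y"
        unfolding seq_dist_def
        using sum_le_suminf[OF summable_seq_dist[OF assms, of x y], of "{i}"] by simp
      also have "\<dots> < (1/2) ^ Suc i * r i"
        using y X(3) False unfolding e_def by auto
      finally have "dist (x i) (y i) < r i" by simp
      then show ?thesis by (rule r(2))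
    qed auto
    then show ?thesis using X(4) by auto
  qed
  ultimately show "\<exists>e>0. \<forall>y. seq_dist x y < e \<longrightarrow> y \<in> S" by blast
next
  assume *: "\<forall>x\<in>S. \<exists>e>0. \<forall>y. seq_dist x y < e \<longrightarrow> y \<in> S"
  show "open S"
  proof (subst open_subopen, intro ballI)
    fix x assume "x \<in> S"
    then obtain e where e: "e > 0" "\<And>y. seq_dist x y < e \<Longrightarrow> y \<in> S" using * by blast
    have "open {y. seq_dist x y < e}"
      by (intro open_Collect_less continuous_on_seq_dist[OF assms] continuous_on_const)
    moreover have "seq_dist x x = 0" by (simp add: seq_dist_def)
    ultimately show "\<exists>T. open T \<and> x \<in> T \<and> T \<subseteq> S"
      using e by (intro exI[of _ "{y. seq_dist x y < e}"]) auto
  qed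
qed

section \<open>Admissible sequences\<close>

definition admissible :: "('a \<times> 'a \<Rightarrow> real) \<Rightarrow> real set \<Rightarrow> (nat \<Rightarrow> 'a) set" where
  "admissible A I = {x. \<forall>n. A (x n, x (Suc n)) \<in> I}"

definition pred_set :: "('a \<times> 'a \<Rightarrow> real) \<Rightarrow> real set \<Rightarrow> 'a \<Rightarrow> 'a set" where
  "pred_set A I b = {a. A (a, b) \<in> I}"

definition locally_constant :: "('a::topological_space \<Rightarrow> 'b) \<Rightarrow> bool" where
  "locally_constant s \<longleftrightarrow> (\<forall>b. \<exists>U. open U \<and> b \<in> U \<and> (\<forall>c\<in>U. s c = s b))"

text \<open>
  Full support on \<open>UNIV\<close> does not imply full support on a closed set \<open>S\<close>, which may even be a null
  set: take Lebesgue measure on \<open>[0, 1]\<close> and \<open>S = {0}\<close>.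
\<close>

definition full_support_on :: "'a::topological_space measure \<Rightarrow> 'a set \<Rightarrow> bool" where
  "full_support_on \<nu> S \<longleftrightarrow> (\<forall>U. open U \<and> U \<inter> S \<noteq> {} \<longrightarrow> emeasure \<nu> (U \<inter> S) > 0)"

section \<open>Topological dynamics\<close>

definition top_transitive :: "('x::topological_space \<Rightarrow> 'x) \<Rightarrow> 'x set \<Rightarrow> bool" where
  "top_transitive T Y \<longleftrightarrow>
     (\<forall>U V. openin (top_of_set Y) U \<and> openin (top_of_set Y) V \<and> U \<noteq> {} \<and> V \<noteq> {} \<longrightarrow>
        (\<exists>n\<ge>1. (T ^^ n) -` U \<inter> V \<noteq> {}))"

definition top_mixing :: "('x::topological_space \<Rightarrow> 'x) \<Rightarrow> 'x set \<Rightarrow> bool" where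
  "top_mixing T Y \<longleftrightarrow>
     (\<forall>U V. openin (top_of_set Y) U \<and> openin (top_of_set Y) V \<and> U \<noteq> {} \<and> V \<noteq> {} \<longrightarrow>
        (\<exists>n\<ge>1. \<forall>m\<ge>n. (T ^^ m) -` U \<inter> V \<noteq> {}))"

definition spectral_decomposition :: "('x::topological_space \<Rightarrow> 'x) \<Rightarrow> 'x set \<Rightarrow> bool" where
  "spectral_decomposition T Y \<longleftrightarrow>
     (\<exists>(k::nat) p C. k \<ge> 1 \<and> p permutes {1..k} \<and>
        Y = (\<Union>i\<in>{1..k}. C i) \<and> disjoint_family_on C {1..k} \<and>
        (\<forall>i\<in>{1..k}. closedin (top_of_set Y) (C i) \<and> T ` C i = C (p i) \<and>
           top_mixing (T ^^ (LEAST m. m > 0 \<and> (p ^^ m) i = i)) (C i)))"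

section \<open>Function spaces\<close>

text \<open>
  Functions on \<open>Y\<close> are represented by total functions vanishing outside \<open>Y\<close>, so that equality of
  functions on \<open>Y\<close> is plain equality. The value type is \<open>real\<close>, or \<open>complex\<close> for the
  complexified spaces.
\<close>

definition cont_space :: "'x::topological_space set \<Rightarrow> ('x \<Rightarrow> 'b::real_normed_vector) set" where
  "cont_space Y = {\<psi>. (\<forall>x. x \<notin> Y \<longrightarrow> \<psi> x = 0) \<and> continuous_on Y \<psi>}"

definition holder_space ::
    "real \<Rightarrow> (nat \<Rightarrow> 'a::metric_space) set \<Rightarrow> ((nat \<Rightarrow> 'a) \<Rightarrow> 'b::real_normed_vector) set" where
  "holder_space \<alpha> Y = {\<psi>. (\<forall>x. x \<notin> Y \<longrightarrow> \<psi> x = 0) \<and>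
     (\<exists>K. \<forall>x\<in>Y. \<forall>y\<in>Y. norm (\<psi> x - \<psi> y) \<le> K * seq_dist x y powr \<alpha>)}"

text \<open>
  In the second supremum the pairs with \<open>x = y\<close> contribute \<open>0 / 0 = 0\<close>; they only keep the index
  set nonempty when \<open>Y\<close> is a single point.
\<close>

definition holder_norm ::
    "real \<Rightarrow> (nat \<Rightarrow> 'a::metric_space) set \<Rightarrow> ((nat \<Rightarrow> 'a) \<Rightarrow> 'b::real_normed_vector) \<Rightarrow> real" where
  "holder_norm \<alpha> Y \<psi> = (SUP x\<in>Y. norm (\<psi> x)) +
     (SUP (x, y)\<in>Y \<times> Y. norm (\<psi> x - \<psi> y) / seq_dist x y powr \<alpha>)"

section \<open>Spectral notions\<close>

text \<open>\<open>T\<close> is a linear operator on the space \<open>H\<close> of functions, \<open>N\<close> the norm of \<open>H\<close>.\<close>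

definition eigenspace ::
    "(('x \<Rightarrow> complex) \<Rightarrow> ('x \<Rightarrow> complex)) \<Rightarrow> ('x \<Rightarrow> complex) set \<Rightarrow> complex \<Rightarrow> ('x \<Rightarrow> complex) set" where
  "eigenspace T H z = {h \<in> H. T h = (\<lambda>x. z * h x)}"

definition eigenvalue ::
    "(('x \<Rightarrow> complex) \<Rightarrow> ('x \<Rightarrow> complex)) \<Rightarrow> ('x \<Rightarrow> complex) set \<Rightarrow> complex \<Rightarrow> bool" where
  "eigenvalue T H z \<longleftrightarrow> (\<exists>h\<in>eigenspace T H z. h \<noteq> (\<lambda>_. 0))"

definition simple_eigenvalue ::
    "(('x \<Rightarrow> complex) \<Rightarrow> ('x \<Rightarrow> complex)) \<Rightarrow> ('x \<Rightarrow> complex) set \<Rightarrow> complex \<Rightarrow> bool" where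
  "simple_eigenvalue T H z \<longleftrightarrow>
     (\<exists>g. g \<noteq> (\<lambda>_. 0) \<and> eigenspace T H z = range (\<lambda>(c::complex) x. c * g x))"

definition spectrum_on ::
    "(('x \<Rightarrow> complex) \<Rightarrow> ('x \<Rightarrow> complex)) \<Rightarrow> ('x \<Rightarrow> complex) set \<Rightarrow> (('x \<Rightarrow> complex) \<Rightarrow> real)
       \<Rightarrow> complex set" where
  "spectrum_on T H N = {z. \<not> (bij_betw (\<lambda>h x. z * h x - T h x) H H \<and>
     (\<exists>K. \<forall>h\<in>H. N h \<le> K * N (\<lambda>x. z * h x - T h x)))}"

section \<open>The Ruelle operator and its dual\<close>

definition ruelle ::
    "'a::metric_space measure \<Rightarrow> ('a \<times> 'a \<Rightarrow> real) \<Rightarrow> real set \<Rightarrow> ((nat \<Rightarrow> 'a) \<Rightarrow> real)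
       \<Rightarrow> ((nat \<Rightarrow> 'a) \<Rightarrow> 'b::{banach, second_countable_topology}) \<Rightarrow> (nat \<Rightarrow> 'a) \<Rightarrow> 'b" where
  "ruelle \<nu> A I \<phi> \<psi> = (\<lambda>x. if x \<in> admissible A I
     then (LINT a:pred_set A I (x 0)|\<nu>. exp (\<phi> (case_nat a x)) *\<^sub>R \<psi> (case_nat a x)) else 0)"

definition normalized_potential ::
    "(nat \<Rightarrow> 'a) set \<Rightarrow> ((nat \<Rightarrow> 'a) \<Rightarrow> real) \<Rightarrow> real \<Rightarrow> ((nat \<Rightarrow> 'a) \<Rightarrow> real) \<Rightarrow> (nat \<Rightarrow> 'a) \<Rightarrow> real" where
  "normalized_potential Y \<phi> l f =
     (\<lambda>x. if x \<in> Y then \<phi> x + ln (f x) - ln (f (shift x)) - ln l else 0)"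

text \<open>
  A Borel probability measure on \<open>Y\<close> is a \<^const>\<open>prob_space\<close> whose \<open>\<sigma>\<close>-algebra is that of
  \<open>borel_on Y\<close>; this forces its \<^const>\<open>space\<close> to be \<open>Y\<close>.
\<close>

abbreviation borel_on :: "'x::topological_space set \<Rightarrow> 'x measure" where
  "borel_on Y \<equiv> restrict_space borel Y"

definition prob_on :: "'x::topological_space set \<Rightarrow> 'x measure \<Rightarrow> bool" where
  "prob_on Y \<mu> \<longleftrightarrow> prob_space \<mu> \<and> sets \<mu> = sets (borel_on Y)"

text \<open>
  The graph of the dual operator: \<open>\<L>\<^sub>\<phi>\<^sup>* \<mu> = \<mu>'\<close>. The image \<open>\<mu>'\<close> is unique, a finite Borel measure on
  a compact metric space being determined by its integrals of continuous functions.
\<close>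

definition ruelle_dual ::
    "'a::metric_space measure \<Rightarrow> ('a \<times> 'a \<Rightarrow> real) \<Rightarrow> real set \<Rightarrow> ((nat \<Rightarrow> 'a) \<Rightarrow> real)
       \<Rightarrow> (nat \<Rightarrow> 'a) measure \<Rightarrow> (nat \<Rightarrow> 'a) measure \<Rightarrow> bool" where
  "ruelle_dual \<nu> A I \<phi> \<mu> \<mu>' \<longleftrightarrow>
     finite_measure \<mu>' \<and> sets \<mu>' = sets (borel_on (admissible A I)) \<and>
     (\<forall>\<psi>\<in>(cont_space (admissible A I) :: ((nat \<Rightarrow> 'a) \<Rightarrow> real) set).
        (\<integral>x. \<psi> x \<partial>\<mu>') = (\<integral>x. ruelle \<nu> A I \<phi> \<psi> x \<partial>\<mu>))"

definition invariant_measure :: "('x \<Rightarrow> 'x) \<Rightarrow> 'x measure \<Rightarrow> bool" where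
  "invariant_measure T \<mu> \<longleftrightarrow> (\<forall>E\<in>sets \<mu>. emeasure \<mu> (T -` E \<inter> space \<mu>) = emeasure \<mu> E)"

end

theory Submission
  imports Defs "HOL-Complex_Analysis.Great_Picard"
begin

text \<open>
  The Ruelle operator \<open>L\<close> averages over the points \<open>ax\<close> obtained by prepending an admissible letter
  to \<open>x\<close>. Two facts drive the whole proof. First, prepending a letter halves distances, and points
  closer than some \<open>\<delta>\<close> admit the same letters, because the sets of admissible letters are locally
  constant; hence \<open>L\<close> improves moduli of continuity. Secondly, the same fact lets the orbit of one
  point be redirected to a nearby one (\<open>shadow_preimage\<close>), so transitivity makes the preimages of every
  point dense; hence averaging spreads the positivity of a function over the whole space
  (\<open>lazy_primitive\<close>).

  The eigenfunction comes from a Collatz-Wielandt argument (\<open>eigenfunction\<close>). The functions whose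
  logarithm obeys a suitable local Hoelder bound form a cone that \<open>L\<close> preserves and that is compact
  after normalization. Maximize \<open>l\<close> subject to \<open>l * f \<le> L f\<close>. If equality failed at the maximum,
  spreading positivity would make the inequality strict everywhere, and \<open>l\<close> could be increased.

  Conjugating by \<open>f\<close> and dividing by \<open>l\<close> leads to the potential of the theorem, whose operator fixes
  the constant 1. The core of the argument is the locale \<open>primitive_markov\<close> of operators with this
  property that smooth and spread positivity. They contract oscillations (\<open>ball_contraction\<close>): a
  function that varies little on small balls stays low on a ball around its minimum, every point sees
  that ball with uniformly positive weight, and so the maximum comes down by a definite proportion.
  For continuous functions this yields convergence to a constant (\<open>iterates_converge\<close>). For Hoelder
  functions smoothing reproduces the Hoelder bound, the contraction can be repeated at regular times,
  and the convergence is exponential in the Hoelder norm (\<open>exponential_convergence\<close>). If the space is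
  mixing, the normalized operator \<open>L'\<close> itself is primitive. In the transitive case it may be periodic,
  and the argument is applied to \<open>(L' + L'\<^sup>2) / 2\<close>.

  The rest follows. Fixed functions of \<open>L'\<close> are constant, so the eigenvalue \<open>l\<close> is simple. The limit
  of the iterates is a positive functional of the initial function; by the Riesz representation theorem
  (\<open>representing_measure\<close>) it is the integral with respect to a measure \<open>\<mu>\<close>, which is the unique fixed
  probability measure, and \<open>f\<close> divides it into the eigenmeasure \<open>\<rho>\<close>. Finally, exponential decay
  makes the Neumann series of the resolvent converge outside a disk smaller than that of radius \<open>l\<close>
  (\<open>spectral_gap\<close>).
\<close>

section \<open>Measures and positive functionals on a compact metric space\<close>

lemma openin_positive_function:
  fixes Y :: "'x::metric_space set"
  assumes "compact Y" "openin (top_of_set Y) U"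
  obtains g :: "'x \<Rightarrow> real" where "continuous_on Y g" "\<And>x. x \<in> Y \<Longrightarrow> 0 \<le> g x"
    "\<And>x. x \<in> Y \<Longrightarrow> 0 < g x \<longleftrightarrow> x \<in> U"
proof (cases "Y - U = {}")
  case True
  then show ?thesis using that[of "\<lambda>_. 1"] by auto
next
  case False
  have "closed (Y - U)"
    using assms by (metis closedin_closed_trans closedin_diff closedin_topspace compact_imp_closed topspace_euclidean_subtopology)
  then have "infdist x (Y - U) = 0 \<longleftrightarrow> x \<in> Y - U" for x
    using in_closed_iff_infdist_zero False by metis
  moreover have "continuous_on Y (\<lambda>x. infdist x (Y - U))"
    by (intro continuous_intros)
  ultimately show ?thesis
    using that[of "\<lambda>x. infdist x (Y - U)"] infdist_nonneg[of _ "Y - U"]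
    by (metis DiffD2 DiffI less_eq_real_def less_irrefl)
qed

lemma sets_borel_on:
  fixes Y :: "'x::t2_space set"
  assumes "compact Y"
  shows "sets (borel_on Y) = sigma_sets Y {U. openin (top_of_set Y) U}"
proof -
  have "sets (borel_on Y) = (\<inter>) Y ` sigma_sets UNIV {S. open S}"
    by (simp add: sets_restrict_space borel_def)
  also have "\<dots> = sigma_sets Y ((\<inter>) Y ` {S. open S})"
    by (rule sigma_sets_Int) (use borel_compact[OF assms] in \<open>simp_all add: borel_def\<close>)
  also have "(\<inter>) Y ` {S. open S} = {U. openin (top_of_set Y) U}"
    by (auto simp: openin_open)
  finally show ?thesis .
qed

lemma prob_on_measurable:
  fixes h :: "'x::topological_space \<Rightarrow> 'b::topological_space"
  assumes "prob_on Y \<mu>" "continuous_on Y h"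
  shows "h \<in> borel_measurable \<mu>"
  using borel_measurable_continuous_on_restrict[OF assms(2)] assms(1)
  by (simp add: prob_on_def cong: measurable_cong_sets)

lemma prob_on_space: "prob_on Y \<mu> \<Longrightarrow> space \<mu> = Y"
  using sets_eq_imp_space_eq[of \<mu> "borel_on Y"] by (simp add: prob_on_def space_restrict_space)

lemma prob_on_integrable:
  fixes h :: "'x::metric_space \<Rightarrow> 'b::{banach, second_countable_topology}"
  assumes "prob_on Y \<mu>" "compact Y" "continuous_on Y h"
  shows "integrable \<mu> h"
proof -
  interpret prob_space \<mu> using assms(1) by (simp add: prob_on_def)
  obtain b where "\<And>x. x \<in> Y \<Longrightarrow> norm (h x) \<le> b"
    using compact_imp_bounded[OF compact_continuous_image[OF assms(3,2)]]
    by (auto simp: bounded_iff)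
  then show ?thesis
    by (intro integrable_const_bound[of _ b] prob_on_measurable[OF assms(1,3)])
       (auto simp: prob_on_space[OF assms(1)])
qed

text \<open>
  The indicator of a relatively open set is the limit of the continuous functions \<open>min 1 (n * g)\<close>,
  where \<open>g\<close> is positive exactly on that set, and the relatively open sets form a generator stable
  under intersection.
\<close>

lemma prob_on_eqI:
  fixes Y :: "'x::metric_space set"
  assumes Y: "compact Y" and M: "prob_on Y M" and N: "prob_on Y N"
    and eq: "\<And>h :: 'x \<Rightarrow> real. h \<in> cont_space Y \<Longrightarrow> (\<integral>x. h x \<partial>M) = (\<integral>x. h x \<partial>N)"
  shows "M = N"
proof (rule measure_eqI_generator_eq)
  let ?E = "{U. openin (top_of_set Y) U}"
  show "Int_stable ?E" by (auto simp: Int_stable_def)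
  show "?E \<subseteq> Pow Y" by (auto dest: openin_imp_subset)
  show "sets M = sigma_sets Y ?E" "sets N = sigma_sets Y ?E"
    using M N by (simp_all add: prob_on_def sets_borel_on[OF Y])
  show "range (\<lambda>_::nat. Y) \<subseteq> ?E" "(\<Union>i::nat. Y) = Y" by auto
  interpret M: prob_space M using M by (simp add: prob_on_def)
  interpret N: prob_space N using N by (simp add: prob_on_def)
  show "emeasure M Y \<noteq> \<infinity>" by simp
  fix U assume "U \<in> ?E"
  then have U: "openin (top_of_set Y) U" by simp
  obtain g :: "'x \<Rightarrow> real" where g: "continuous_on Y g" "\<And>x. x \<in> Y \<Longrightarrow> 0 \<le> g x"
      "\<And>x. x \<in> Y \<Longrightarrow> 0 < g x \<longleftrightarrow> x \<in> U"
    using openin_positive_function[OF Y U] by metis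
  define h where "h n x = (if x \<in> Y then min 1 (real n * g x) else 0)" for n x
  have hc: "continuous_on Y (h n)" for n
  proof -
    have "continuous_on Y (\<lambda>x. min 1 (real n * g x))" by (intro continuous_intros g)
    then show ?thesis by (rule continuous_on_eq) (simp add: h_def)
  qed
  then have h: "h n \<in> cont_space Y" for n by (simp add: cont_space_def h_def)
  have lim: "(\<lambda>n. h n x) \<longlonglongrightarrow> indicator U x" if x: "x \<in> Y" for x
  proof (cases "x \<in> U")
    case True
    then have "0 < g x" using g x by auto
    \<comment> \<open>\<open>min 1 (n * g)\<close> increases to the indicator of \<open>U\<close>: it is eventually 1 where \<open>g\<close> is positive.\<close>
    obtain m :: nat where "1 < real m * g x"
      using reals_Archimedean3[OF \<open>0 < g x\<close>] by blast
    then have "h n x = 1" if "n \<ge> m" for n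
    proof -
      have "real m * g x \<le> real n * g x"
        using that \<open>0 < g x\<close> by (intro mult_right_mono) auto
      then have "1 \<le> real n * g x" using \<open>1 < real m * g x\<close> by linarith
      then show ?thesis using x by (simp add: h_def)
    qed
    then show ?thesis using True
      by (intro tendsto_eventually) (auto simp: eventually_sequentially)
  next
    case False
    then have "g x = 0" using g(2,3)[OF x] by linarith
    then have "h n x = 0" for n by (simp add: h_def)
    then show ?thesis using False by simp
  qed
  have conv: "(\<lambda>n. \<integral>x. h n x \<partial>K) \<longlonglongrightarrow> measure K U" if K: "prob_on Y K" for K
  proof -
    interpret K: prob_space K using K by (simp add: prob_on_def)
    have US: "U \<in> sets K"
      using K U by (auto simp: prob_on_def sets_borel_on[OF Y] intro: sigma_sets.Basic)
    have "(\<lambda>n. \<integral>x. h n x \<partial>K) \<longlonglongrightarrow> (\<integral>x. indicator U x \<partial>K)"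
    proof (rule integral_dominated_convergence[of _ _ _ "\<lambda>_. 1"])
      show "AE x in K. (\<lambda>n. h n x) \<longlonglongrightarrow> indicator U x"
        using lim by (auto simp: prob_on_space[OF K])
      show "\<And>n. AE x in K. norm (h n x) \<le> 1"
        using g(2) by (auto simp: prob_on_space[OF K] h_def)
    qed (auto intro!: prob_on_measurable[OF K hc] borel_measurable_indicator US)
    then show ?thesis using US sets.sets_into_space[OF US] by (simp add: Int_absorb2)
  qed
  have "measure M U = measure N U"
    using conv[OF M] conv[OF N] eq[OF h] by (auto intro: LIMSEQ_unique)
  then show "emeasure M U = emeasure N U"
    by (simp add: M.emeasure_eq_measure N.emeasure_eq_measure)
qed

text \<open>
  The functional is defined on total functions; the assumption \<open>cong\<close> makes it one on functions on \<open>Y\<close>.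
\<close>

locale positive_functional =
  fixes Y :: "'x::metric_space set" and \<Lambda> :: "('x \<Rightarrow> real) \<Rightarrow> real"
  assumes compact_Y: "compact Y"
    and cong: "\<And>f g. (\<And>x. x \<in> Y \<Longrightarrow> f x = g x) \<Longrightarrow> \<Lambda> f = \<Lambda> g"
    and add: "\<And>f g. continuous_on Y f \<Longrightarrow> continuous_on Y g \<Longrightarrow> \<Lambda> (\<lambda>x. f x + g x) = \<Lambda> f + \<Lambda> g"
    and scale: "\<And>f c. continuous_on Y f \<Longrightarrow> \<Lambda> (\<lambda>x. c * f x) = c * \<Lambda> f"
    and nonneg: "\<And>f. continuous_on Y f \<Longrightarrow> (\<And>x. x \<in> Y \<Longrightarrow> 0 \<le> f x) \<Longrightarrow> 0 \<le> \<Lambda> f"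
    and one: "\<Lambda> (\<lambda>_. 1) = 1"
begin

lemma mono:
  assumes "continuous_on Y f" "continuous_on Y g" "\<And>x. x \<in> Y \<Longrightarrow> f x \<le> g x"
  shows "\<Lambda> f \<le> \<Lambda> g"
proof -
  have c: "continuous_on Y (\<lambda>x. g x + (-1) * f x)" "continuous_on Y (\<lambda>x. (-1) * f x)"
    by (intro continuous_intros assms)+
  have "0 \<le> \<Lambda> (\<lambda>x. g x + (-1) * f x)"
    by (rule nonneg[OF c(1)]) (use assms(3) in auto)
  also have "\<dots> = \<Lambda> g - \<Lambda> f"
    using add[OF assms(2) c(2)] scale[OF assms(1), of "-1"] by simp
  finally show ?thesis by simp
qed

lemma const: "\<Lambda> (\<lambda>_. c) = c"
  using scale[of "\<lambda>_. 1" c] one by simp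

lemma finite_sum:
  assumes "finite T" "\<And>i. i \<in> T \<Longrightarrow> continuous_on Y (G i)"
  shows "\<Lambda> (\<lambda>x. \<Sum>i\<in>T. G i x) = (\<Sum>i\<in>T. \<Lambda> (G i))"
  using assms
proof (induction T rule: finite_induct)
  case (insert a T)
  have "\<Lambda> (\<lambda>x. G a x + (\<Sum>i\<in>T. G i x)) = \<Lambda> (G a) + \<Lambda> (\<lambda>x. \<Sum>i\<in>T. G i x)"
    using insert by (intro add continuous_intros) auto
  then show ?case using insert by simp
qed (simp add: const)

definition below :: "'x set \<Rightarrow> ('x \<Rightarrow> real) set" where
  "below U = {\<psi>. continuous_on Y \<psi> \<and> (\<forall>x\<in>Y. 0 \<le> \<psi> x \<and> \<psi> x \<le> indicator U x)}"

text \<open>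
  The inner approximation of the measure of a relatively open set.
\<close>

definition content :: "'x set \<Rightarrow> ennreal" where
  "content U = (SUP \<psi>\<in>below U. ennreal (\<Lambda> \<psi>))"

lemma content_upper: "\<psi> \<in> below U \<Longrightarrow> ennreal (\<Lambda> \<psi>) \<le> content U"
  unfolding content_def by (rule SUP_upper)

lemma content_le: "(\<And>\<psi>. \<psi> \<in> below U \<Longrightarrow> ennreal (\<Lambda> \<psi>) \<le> c) \<Longrightarrow> content U \<le> c"
  unfolding content_def by (rule SUP_least)

lemma content_mono: "U \<subseteq> V \<Longrightarrow> content U \<le> content V"
proof (rule content_le)
  fix \<psi> assume "U \<subseteq> V" "\<psi> \<in> below U"
  moreover have "indicator U x \<le> (indicator V x :: real)" for x
    using \<open>U \<subseteq> V\<close> by (simp add: indicator_def subset_iff)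
  ultimately show "ennreal (\<Lambda> \<psi>) \<le> content V"
    by (intro content_upper) (auto simp: below_def intro: order_trans)
qed

lemma content_le_1: "content U \<le> 1"
proof (rule content_le)
  fix \<psi> assume "\<psi> \<in> below U"
  then have "\<Lambda> \<psi> \<le> \<Lambda> (\<lambda>_. 1)"
    by (intro mono) (force simp: below_def intro: order_trans indicator_le_1)+
  then show "ennreal (\<Lambda> \<psi>) \<le> 1" by (simp add: one)
qed

lemma content_empty: "content {} = 0"
proof -
  have "content {} \<le> 0"
  proof (rule content_le)
    fix \<psi> assume "\<psi> \<in> below {}"
    then have "\<Lambda> \<psi> = \<Lambda> (\<lambda>_. 0)" by (intro cong) (auto simp: below_def intro!: antisym)
    then show "ennreal (\<Lambda> \<psi>) \<le> 0" by (simp add: const)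
  qed
  then show ?thesis by simp
qed

lemma content_Y: "content Y = 1"
proof (rule antisym[OF content_le_1])
  have "(\<lambda>_. 1) \<in> below Y" by (auto simp: below_def)
  from content_upper[OF this] show "1 \<le> content Y" by (simp add: one)
qed

text \<open>
  Let \<open>\<psi>\<close> lie below the union. On the compact set where \<open>\<psi> \<ge> e\<close>, finitely many of the \<open>U i\<close>
  suffice, and suitable functions below these finitely many sets add up to at least 1 there. Hence
  \<open>\<psi>\<close> is at most \<open>e\<close> plus a finite sum of functions below the \<open>U i\<close>.
\<close>

lemma content_Union:
  assumes U: "\<And>i::nat. openin (top_of_set Y) (U i)"
  shows "content (\<Union>i. U i) \<le> (\<Sum>i. content (U i))"
proof (rule content_le)
  fix \<psi> assume \<psi>: "\<psi> \<in> below (\<Union>i. U i)"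
  then have cont: "continuous_on Y \<psi>" by (simp add: below_def)
  show "ennreal (\<Lambda> \<psi>) \<le> (\<Sum>i. content (U i))"
  proof (rule ennreal_le_epsilon)
    fix e :: real assume "0 < e"
    define K where "K = {x\<in>Y. e \<le> \<psi> x}"
    have "closedin (top_of_set Y) (Y \<inter> \<psi> -` {e..})"
      by (rule continuous_closedin_preimage[OF cont]) simp
    moreover have "Y \<inter> \<psi> -` {e..} = K" by (auto simp: K_def)
    ultimately have K: "compact K"
      using closedin_compact[OF compact_Y] by simp
    have sub: "K \<subseteq> (\<Union>i. U i)"
    proof
      fix x assume "x \<in> K"
      then have "x \<in> Y" "e \<le> \<psi> x" by (auto simp: K_def)
      moreover have "\<psi> x \<le> indicator (\<Union>i. U i) x" using \<psi> \<open>x \<in> Y\<close> by (auto simp: below_def)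
      ultimately show "x \<in> (\<Union>i. U i)"
        using \<open>0 < e\<close> by (cases "x \<in> (\<Union>i. U i)") auto
    qed
    obtain W where W: "\<And>i. open (W i)" "\<And>i. U i = Y \<inter> W i"
      using U unfolding openin_open by metis
    obtain T where T: "finite T" "K \<subseteq> (\<Union>i\<in>T. W i)"
      by (rule compactE_image[OF K, of UNIV W]) (use W sub in auto)
    have "\<exists>g. continuous_on Y g \<and> (\<forall>x\<in>Y. 0 \<le> g x \<and> (0 < (g x::real) \<longleftrightarrow> x \<in> U i))" for i
      using openin_positive_function[OF compact_Y U] by metis
    then obtain g where g: "\<And>i. continuous_on Y (g i)" "\<And>i x. x \<in> Y \<Longrightarrow> 0 \<le> g i x"
        "\<And>i x. x \<in> Y \<Longrightarrow> 0 < (g i x::real) \<longleftrightarrow> x \<in> U i"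
      by metis
    have "\<exists>c>0. \<forall>x\<in>K. c * (\<Sum>i\<in>T. g i x) \<ge> 1"
    proof (cases "K = {}")
      case False
      have KY: "K \<subseteq> Y" by (auto simp: K_def)
      have "continuous_on K (\<lambda>x. \<Sum>i\<in>T. g i x)"
        by (intro continuous_on_sum continuous_on_subset[OF g(1) KY])
      then obtain z where z: "z \<in> K" "\<And>x. x \<in> K \<Longrightarrow> (\<Sum>i\<in>T. g i z) \<le> (\<Sum>i\<in>T. g i x)"
        using continuous_attains_inf[OF K False, of "\<lambda>x. \<Sum>i\<in>T. g i x"] by blast
      obtain i where i: "i \<in> T" "z \<in> U i" using z(1) T W KY by blast
      have "0 < g i z" using g(3) i z KY by blast
      also have "g i z \<le> (\<Sum>i\<in>T. g i z)"
        by (rule member_le_sum) (use T i g z KY in auto)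
      finally have *: "0 < (\<Sum>i\<in>T. g i z)" .
      then show ?thesis
        using z(2) by (intro exI[of _ "1 / (\<Sum>i\<in>T. g i z)"]) auto
    qed (auto intro: exI[of _ 1])
    then obtain c where c: "c > 0" "\<And>x. x \<in> K \<Longrightarrow> c * (\<Sum>i\<in>T. g i x) \<ge> 1" by blast
    \<comment> \<open>After scaling by \<open>c\<close> the bumps \<open>G i\<close> still lie below the \<open>U i\<close>, and on \<open>K\<close> they add up to at least 1.\<close>
    define G where "G i x = min 1 (c * g i x)" for i x
    have Gc: "continuous_on Y (G i)" for i
      unfolding G_def by (intro continuous_intros g)
    have G0: "0 \<le> G i x" if "x \<in> Y" for i x using g(2)[OF that] c by (simp add: G_def)
    have Gb: "G i \<in> below (U i)" for i
    proof -
      have "G i x \<le> indicator (U i) x" if "x \<in> Y" for x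
        using g(2,3)[OF that, of i] by (cases "x \<in> U i") (auto simp: G_def)
      then show ?thesis using Gc G0 by (auto simp: below_def)
    qed
    have le: "\<psi> x \<le> e + (\<Sum>i\<in>T. G i x)" if x: "x \<in> Y" for x
    proof (cases "x \<in> K")
      case True
      have "1 \<le> (\<Sum>i\<in>T. G i x)"
      proof (cases "\<exists>i\<in>T. c * g i x \<ge> 1")
        case True
        then obtain i where "i \<in> T" "G i x = 1" by (auto simp: G_def)
        then show ?thesis using member_le_sum[of i T "\<lambda>i. G i x"] T G0[OF x] by auto
      next
        case False
        then have "(\<Sum>i\<in>T. G i x) = (\<Sum>i\<in>T. c * g i x)"
          by (intro sum.cong) (auto simp: G_def)
        then show ?thesis using c(2)[OF True] by (simp add: sum_distrib_left)
      qed
      moreover have "\<psi> x \<le> 1" using \<psi> x by (force simp: below_def intro: order_trans indicator_le_1)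
      ultimately show ?thesis using \<open>0 < e\<close> by linarith
    next
      case False
      then have "\<psi> x \<le> e" using x by (auto simp: K_def)
      moreover have "0 \<le> (\<Sum>i\<in>T. G i x)" by (intro sum_nonneg G0 x)
      ultimately show ?thesis by linarith
    qed
    have "\<Lambda> \<psi> \<le> \<Lambda> (\<lambda>x. e + (\<Sum>i\<in>T. G i x))"
      by (intro mono cont continuous_intros Gc le)
    also have "\<dots> = e + (\<Sum>i\<in>T. \<Lambda> (G i))"
      using add[of "\<lambda>_. e" "\<lambda>x. \<Sum>i\<in>T. G i x"] finite_sum[of T G, OF T(1) Gc] const[of e]
      by (simp add: continuous_on_sum Gc)
    finally have "ennreal (\<Lambda> \<psi>) \<le> ennreal (e + (\<Sum>i\<in>T. \<Lambda> (G i)))"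
      by (rule ennreal_leI)
    also have "\<dots> = ennreal e + (\<Sum>i\<in>T. ennreal (\<Lambda> (G i)))"
      using \<open>0 < e\<close> nonneg[OF Gc G0] by (simp add: sum_nonneg sum_ennreal)
    also have "\<dots> \<le> ennreal e + (\<Sum>i\<in>T. content (U i))"
      by (intro add_mono sum_mono content_upper Gb order_refl)
    also have "\<dots> \<le> ennreal e + (\<Sum>i. content (U i))"
      by (intro add_mono order_refl sum_le_suminf T) auto
    finally show "ennreal (\<Lambda> \<psi>) \<le> (\<Sum>i. content (U i)) + ennreal e"
      by (simp add: add.commute)
  qed
qed

definition outer :: "'x set \<Rightarrow> ennreal" where
  "outer E = (INF U\<in>{U. openin (top_of_set Y) U \<and> E \<subseteq> U}. content U)"

lemma outer_le: "openin (top_of_set Y) U \<Longrightarrow> E \<subseteq> U \<Longrightarrow> outer E \<le> content U"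
  unfolding outer_def by (rule INF_lower) simp

lemma outer_open: "openin (top_of_set Y) U \<Longrightarrow> outer U = content U"
  unfolding outer_def by (rule antisym) (auto intro!: INF_lower2[of U] INF_greatest content_mono)

lemma outer_mono: "E \<subseteq> F \<Longrightarrow> outer E \<le> outer F"
  unfolding outer_def by (rule INF_superset_mono) auto

lemma outer_approx:
  assumes "E \<subseteq> Y" "0 < e"
  obtains U where "openin (top_of_set Y) U" "E \<subseteq> U" "content U \<le> outer E + ennreal e"
proof -
  have "outer E \<le> content Y" by (rule outer_le) (use assms in auto)
  then have fin: "outer E < top" using content_le_1[of Y] order_le_less_trans[OF _ ennreal_one_less_top] order_trans by blast
  then have "outer E < outer E + ennreal e"
    using assms(2)
    by (cases "outer E") (auto simp: ennreal_plus[symmetric] ennreal_less_iff simp del: ennreal_plus)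
  then obtain U where "U \<in> {U. openin (top_of_set Y) U \<and> E \<subseteq> U}" "content U < outer E + ennreal e"
    unfolding outer_def INF_less_iff by blast
  then show ?thesis using that by auto
qed

lemma outer_measure_space: "outer_measure_space (Pow Y) outer"
  unfolding outer_measure_space_def
proof (intro conjI)
  show "positive (Pow Y) outer"
    using outer_open[of "{}"] content_empty by (auto simp: positive_def)
  show "increasing (Pow Y) outer" by (auto simp: increasing_def outer_mono)
  show "countably_subadditive (Pow Y) outer"
    unfolding countably_subadditive_def
  proof (intro allI impI)
    fix E :: "nat \<Rightarrow> 'x set" assume E: "range E \<subseteq> Pow Y"
    show "outer (\<Union>i. E i) \<le> (\<Sum>i. outer (E i))"
    proof (rule ennreal_le_epsilon)
      fix e :: real assume "0 < e"
      have "\<exists>U. openin (top_of_set Y) U \<and> E i \<subseteq> U \<and> content U \<le> outer (E i) + ennreal (e * (1/2)^Suc i)" for i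
        using outer_approx[of "E i" "e * (1/2)^Suc i"] E \<open>0 < e\<close> by fastforce
      then obtain U where U: "\<And>i. openin (top_of_set Y) (U i)" "\<And>i. E i \<subseteq> U i"
          "\<And>i. content (U i) \<le> outer (E i) + ennreal (e * (1/2)^Suc i)"
        by metis
      have "outer (\<Union>i. E i) \<le> content (\<Union>i. U i)"
        by (rule outer_le) (use U in blast)+
      also have "\<dots> \<le> (\<Sum>i. content (U i))" by (rule content_Union[OF U(1)])
      also have "\<dots> \<le> (\<Sum>i. outer (E i) + ennreal (e * (1/2)^Suc i))"
        by (intro suminf_le U) auto
      also have "\<dots> = (\<Sum>i. outer (E i)) + (\<Sum>i. ennreal (e * (1/2)^Suc i))"
        by (rule suminf_add[symmetric]) auto
      also have "(\<Sum>i. ennreal (e * (1/2)^Suc i)) = ennreal e"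
      proof -
        have s: "(\<lambda>i. e * (1/2)^Suc i) sums e"
          using sums_mult[OF power_half_series, of e] by (simp only: mult_1_right)
        have "(\<Sum>i. ennreal (e * (1/2)^Suc i)) = ennreal (\<Sum>i. e * (1/2)^Suc i)"
          by (rule suminf_ennreal2[OF _ sums_summable[OF s]]) (use \<open>0 < e\<close> in simp)
        also have "(\<Sum>i. e * (1/2)^Suc i) = e" by (rule sums_unique[OF s, symmetric])
        finally show ?thesis .
      qed
      finally show "outer (\<Union>i. E i) \<le> (\<Sum>i. outer (E i)) + ennreal e" .
    qed
  qed
qed

text \<open>
  Caratheodory's condition for \<open>U\<close>, tested on an open set \<open>V\<close>. A function below \<open>V \<inter> U\<close> that nearly
  exhausts the content of \<open>V \<inter> U\<close> is small near \<open>V - U\<close>, so it can be combined with functions below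
  a neighbourhood of \<open>V - U\<close> to a function that lies, up to a factor close to 1, below \<open>V\<close>.
\<close>

lemma outer_split_open:
  assumes U: "openin (top_of_set Y) U" and V: "openin (top_of_set Y) V"
  shows "outer (V \<inter> U) + outer (V - U) \<le> content V"
proof -
  have VY: "V \<subseteq> Y" using V by (rule openin_imp_subset)
  have *: "ennreal (\<Lambda> \<psi>) + outer (V - U) \<le> content V" if \<psi>: "\<psi> \<in> below (V \<inter> U)" for \<psi>
  proof (rule ennreal_le_epsilon)
    fix e :: real assume "0 < e"
    have cont: "continuous_on Y \<psi>" using \<psi> by (simp add: below_def)
    \<comment> \<open>\<open>\<psi>\<close> vanishes on \<open>V - U\<close>, so this open set contains \<open>V - U\<close>, and adding to \<open>\<psi>\<close> any
      function below it stays below \<open>1 + e\<close>.\<close>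
    define W where "W = V \<inter> (Y \<inter> \<psi> -` {..<e})"
    have W: "openin (top_of_set Y) W"
      unfolding W_def by (rule openin_Int[OF V continuous_openin_preimage_gen[OF cont]]) simp
    have "V - U \<subseteq> W"
    proof
      fix x assume x: "x \<in> V - U"
      then have "\<psi> x \<le> indicator (V \<inter> U) x" using \<psi> VY unfolding below_def by blast
      then have "\<psi> x \<le> 0" using x by simp
      then show "x \<in> W" using x \<open>0 < e\<close> VY by (auto simp: W_def)
    qed
    then have 1: "outer (V - U) \<le> content W" by (rule outer_le[OF W])
    have 2: "content W \<le> ennreal ((1 + e)) * content V - ennreal (\<Lambda> \<psi>)"
    proof (rule content_le)
      fix \<eta> assume \<eta>: "\<eta> \<in> below W"
      define \<theta> where "\<theta> x = 1 / (1 + e) * (\<psi> x + \<eta> x)" for x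
      have c\<eta>: "continuous_on Y \<eta>" using \<eta> by (simp add: below_def)
      have "\<theta> \<in> below V"
      proof -
        have "continuous_on Y \<theta>" unfolding \<theta>_def by (intro continuous_intros cont c\<eta>)
        moreover have "0 \<le> \<theta> x \<and> \<theta> x \<le> indicator V x" if "x \<in> Y" for x
        proof -
          have "0 \<le> \<psi> x" "0 \<le> \<eta> x" "\<psi> x \<le> indicator (V \<inter> U) x" "\<eta> x \<le> indicator W x"
            using \<psi> \<eta> that by (auto simp: below_def)
          moreover from this have "\<psi> x + \<eta> x \<le> (1 + e) * indicator V x"
            using \<open>0 < e\<close> that
            by (cases "x \<in> V"; cases "x \<in> U"; cases "x \<in> W") (auto simp: W_def)
          ultimately show ?thesis using \<open>0 < e\<close>
            by (simp add: \<theta>_def pos_divide_le_eq mult.commute)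
        qed
        ultimately show ?thesis by (simp add: below_def)
      qed
      then have "ennreal (\<Lambda> \<theta>) \<le> content V" by (rule content_upper)
      moreover have "\<Lambda> \<theta> = 1 / (1 + e) * (\<Lambda> \<psi> + \<Lambda> \<eta>)"
        unfolding \<theta>_def using scale[of "\<lambda>x. \<psi> x + \<eta> x" "1 / (1 + e)"] add[OF cont c\<eta>]
        by (simp add: continuous_on_add cont c\<eta>)
      then have "\<Lambda> \<psi> + \<Lambda> \<eta> = (1 + e) * \<Lambda> \<theta>" using \<open>0 < e\<close> by simp
      moreover have p: "0 \<le> \<Lambda> \<psi>" "0 \<le> \<Lambda> \<eta>"
        using \<psi> \<eta> by (auto intro!: nonneg simp: below_def)
      ultimately have "ennreal (\<Lambda> \<psi>) + ennreal (\<Lambda> \<eta>) \<le> ennreal (1 + e) * content V"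
        using \<open>0 < e\<close> mult_left_mono[of "ennreal (\<Lambda> \<theta>)" "content V" "ennreal (1 + e)"]
        by (simp add: ennreal_mult'[symmetric] ennreal_plus[symmetric] del: ennreal_plus)
      then show "ennreal (\<Lambda> \<eta>) \<le> ennreal (1 + e) * content V - ennreal (\<Lambda> \<psi>)"
        using ennreal_minus_mono[OF _ order_refl, of _ _ "ennreal (\<Lambda> \<psi>)"]
        by (metis ennreal_add_diff_cancel_left ennreal_neq_top infinity_ennreal_def)
    qed
    have le: "ennreal (\<Lambda> \<psi>) \<le> ennreal (1 + e) * content V"
    proof -
      have "ennreal (\<Lambda> \<psi>) \<le> content (V \<inter> U)" by (rule content_upper[OF \<psi>])
      also have "\<dots> \<le> 1 * content V" by (simp add: content_mono)
      also have "\<dots> \<le> ennreal (1 + e) * content V" using \<open>0 < e\<close> by (intro mult_right_mono) auto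
      finally show ?thesis .
    qed
    have "ennreal (\<Lambda> \<psi>) + outer (V - U) \<le> ennreal (\<Lambda> \<psi>) + (ennreal (1 + e) * content V - ennreal (\<Lambda> \<psi>))"
      using 1 2 by (intro add_mono) auto
    also have "\<dots> = ennreal (1 + e) * content V"
      using le by (simp add: add_diff_inverse_ennreal)
    also have "\<dots> = content V + ennreal e * content V"
      using \<open>0 < e\<close> by (simp add: ring_distribs)
    also have "\<dots> \<le> content V + ennreal e * 1"
      by (intro add_mono mult_left_mono content_le_1) auto
    finally show "ennreal (\<Lambda> \<psi>) + outer (V - U) \<le> content V + ennreal e" by simp
  qed
  have ne: "below (V \<inter> U) \<noteq> {}"
  proof -
    have "(\<lambda>_. 0) \<in> below (V \<inter> U)" by (auto simp: below_def)
    then show ?thesis by blast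
  qed
  have "content (V \<inter> U) + outer (V - U) = (SUP \<psi>\<in>below (V \<inter> U). ennreal (\<Lambda> \<psi>) + outer (V - U))"
    unfolding content_def using ennreal_SUP_add_left[OF ne] by simp
  also have "\<dots> \<le> content V" by (rule SUP_least) (rule *)
  finally show ?thesis using outer_open[OF openin_Int[OF V U]] by simp
qed

lemma open_in_lambda_system:
  assumes U: "openin (top_of_set Y) U"
  shows "U \<in> lambda_system Y (Pow Y) outer"
proof -
  interpret P: sigma_algebra Y "Pow Y" by (rule sigma_algebra_Pow)
  have UY: "U \<subseteq> Y" using U by (rule openin_imp_subset)
  have "outer (E \<inter> U) + outer (E - U) = outer E" if E: "E \<subseteq> Y" for E
  proof (rule antisym)
    show "outer (E \<inter> U) + outer (E - U) \<le> outer E"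
      unfolding outer_def[of E]
    proof (rule INF_greatest)
      fix V assume V: "V \<in> {V. openin (top_of_set Y) V \<and> E \<subseteq> V}"
      then have "outer (E \<inter> U) + outer (E - U) \<le> outer (V \<inter> U) + outer (V - U)"
        by (intro add_mono outer_mono) auto
      also have "\<dots> \<le> content V" using outer_split_open[OF U] V by auto
      finally show "outer (E \<inter> U) + outer (E - U) \<le> content V" .
    qed
    have "subadditive (Pow Y) outer"
      using outer_measure_space unfolding outer_measure_space_def
      by (metis P.countably_subadditive_subadditive)
    then show "outer E \<le> outer (E \<inter> U) + outer (E - U)"
      using subadditiveD[of "Pow Y" outer "E \<inter> U" "E - U"] E by (auto simp: Int_Diff_Un Int_Diff_disjoint)
  qed
  then show ?thesis using UY by (simp add: P.lambda_system_eq)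
qed

lemma exists_measure:
  obtains \<mu> where "prob_on Y \<mu>" "\<And>U. openin (top_of_set Y) U \<Longrightarrow> emeasure \<mu> U = content U"
proof -
  interpret P: sigma_algebra Y "Pow Y" by (rule sigma_algebra_Pow)
  let ?L = "lambda_system Y (Pow Y) outer"
  have ms: "measure_space Y ?L outer"
    by (rule P.caratheodory_lemma[OF outer_measure_space])
  then have sa: "sigma_algebra Y ?L" by (simp add: measure_space_def)
  let ?S = "sigma_sets Y {U. openin (top_of_set Y) U}"
  have sub: "?S \<subseteq> ?L"
    by (rule sigma_algebra.sigma_sets_subset[OF sa]) (auto intro: open_in_lambda_system)
  have gen: "{U. openin (top_of_set Y) U} \<subseteq> Pow Y" by (auto dest: openin_imp_subset)
  have ms': "measure_space Y ?S outer"
    using ms sub sigma_algebra_sigma_sets[OF gen]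
    by (auto simp: measure_space_def positive_def countably_additive_def subset_eq)
  define \<mu> where "\<mu> = measure_of Y {U. openin (top_of_set Y) U} outer"
  have sets: "sets \<mu> = ?S" and space: "space \<mu> = Y"
    unfolding \<mu>_def using gen by (simp_all add: sets_measure_of space_measure_of)
  have em: "emeasure \<mu> X = outer X" if "X \<in> ?S" for X
    unfolding \<mu>_def
    by (rule emeasure_measure_of[of _ _ _ outer]) (use ms' that gen in \<open>auto simp: measure_space_def\<close>)
  have 1: "emeasure \<mu> U = content U" if "openin (top_of_set Y) U" for U
    using em[of U] that outer_open[of U] by (auto intro: sigma_sets.Basic)
  moreover have "prob_on Y \<mu>"
    unfolding prob_on_def
  proof
    show "prob_space \<mu>" by (rule prob_spaceI) (use 1[of Y] content_Y space in auto)
    show "sets \<mu> = sets (borel_on Y)" by (simp add: sets sets_borel_on[OF compact_Y])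
  qed
  ultimately show ?thesis using that by blast
qed

text \<open>
  Cut \<open>h\<close> into \<open>N\<close> horizontal slices of height \<open>1 / N\<close>. Each slice, multiplied by \<open>N\<close>, lies below the
  superlevel set at the bottom of the slice, so the functional gives it at most \<open>1 / N\<close> times the
  measure of that set. The indicator of the superlevel set, divided by \<open>N\<close>, is in turn at most a slice
  of \<open>h + 1 / N\<close>, so the integral gains no more than \<open>1 / N\<close>.
\<close>

lemma le_integral:
  assumes \<mu>: "prob_on Y \<mu>" "\<And>U. openin (top_of_set Y) U \<Longrightarrow> emeasure \<mu> U = content U"
    and h: "continuous_on Y h" "\<And>x. x \<in> Y \<Longrightarrow> 0 \<le> h x \<and> h x \<le> 1"
  shows "\<Lambda> h \<le> (\<integral>x. h x \<partial>\<mu>)"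
proof -
  interpret prob_space \<mu> using \<mu>(1) by (simp add: prob_on_def)
  have *: "\<Lambda> h \<le> (\<integral>x. h x \<partial>\<mu>) + 1 / real N" if "N > 0" for N :: nat
  proof -
    \<comment> \<open>The slice of \<open>t\<close> between the heights \<open>k / N\<close> and \<open>(k + 1) / N\<close>.\<close>
    define step where "step k t = min t (real (Suc k) / real N) - min t (real k / real N)" for k t
    have tele: "(\<Sum>k<N. step k t) = min t 1 - min t 0" for t
    proof -
      have "(\<Sum>k<N. step k t) = min t (real N / real N) - min t (real 0 / real N)"
        unfolding step_def by (rule sum_lessThan_telescope)
      then show ?thesis using \<open>N > 0\<close> by simp
    qed
    define U where "U k = {x\<in>Y. real k / real N < h x}" for k
    have U: "openin (top_of_set Y) (U k)" for k
    proof -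
      have "openin (top_of_set Y) (Y \<inter> h -` {real k / real N<..})"
        by (rule continuous_openin_preimage_gen[OF h(1)]) simp
      also have "Y \<inter> h -` {real k / real N<..} = U k" by (auto simp: U_def)
      finally show ?thesis .
    qed
    have US: "U k \<in> sets \<mu>" for k
      using \<mu>(1) U by (auto simp: prob_on_def sets_borel_on[OF compact_Y] intro: sigma_sets.Basic)
    have sc: "continuous_on Y (\<lambda>x. step k (h x))" for k
      unfolding step_def by (intro continuous_intros h)
    have kN: "real (Suc k) / real N = real k / real N + 1 / real N" for k
      by (simp add: add_divide_distrib)
    have N: "0 < 1 / real N" using \<open>N > 0\<close> by simp
    have b: "\<Lambda> (\<lambda>x. step k (h x)) \<le> 1 / real N * measure \<mu> (U k)" for k
    proof -
      have "(\<lambda>x. real N * step k (h x)) \<in> below (U k)"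
      proof -
        have "0 \<le> step k (h x)" "step k (h x) \<le> 1 / real N" for x
          using N unfolding step_def kN by linarith+
        moreover have "step k (h x) \<le> 0" if "x \<in> Y" "x \<notin> U k" for x
        proof -
          have "h x \<le> real k / real N" using that by (auto simp: U_def)
          then show ?thesis using N unfolding step_def kN by linarith
        qed
        ultimately have "0 \<le> real N * step k (h x) \<and> real N * step k (h x) \<le> indicator (U k) x"
          if "x \<in> Y" for x
          using that \<open>N > 0\<close> by (cases "x \<in> U k") (auto simp: field_simps mult_nonneg_nonpos)
        moreover have "continuous_on Y (\<lambda>x. real N * step k (h x))"
          by (intro continuous_intros sc)
        ultimately show ?thesis by (auto simp: below_def)
      qed
      from content_upper[OF this] have "ennreal (real N * \<Lambda> (\<lambda>x. step k (h x))) \<le> emeasure \<mu> (U k)"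
        using \<mu>(2)[OF U] scale[OF sc] by simp
      then have "real N * \<Lambda> (\<lambda>x. step k (h x)) \<le> measure \<mu> (U k)"
        by (simp add: emeasure_eq_measure)
      then show ?thesis using \<open>N > 0\<close> by (simp add: field_simps)
    qed
    have "\<Lambda> h = \<Lambda> (\<lambda>x. \<Sum>k<N. step k (h x))"
      using h(2) by (intro cong) (auto simp: tele)
    also have "\<dots> = (\<Sum>k<N. \<Lambda> (\<lambda>x. step k (h x)))"
      by (rule finite_sum) (auto intro: sc)
    also have "\<dots> \<le> (\<Sum>k<N. 1 / real N * measure \<mu> (U k))"
      by (intro sum_mono b)
    also have "\<dots> = (\<integral>x. (\<Sum>k<N. 1 / real N * indicator (U k) x) \<partial>\<mu>)"
      using US sets.sets_into_space[OF US] by (subst Bochner_Integration.integral_sum) (auto simp: Int_absorb2 emeasure_eq_measure)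
    also have "\<dots> \<le> (\<integral>x. h x + 1 / real N \<partial>\<mu>)"
    proof (rule integral_mono)
      show "integrable \<mu> (\<lambda>x. \<Sum>k<N. 1 / real N * indicator (U k) x)"
        using US by (intro Bochner_Integration.integrable_sum integrable_mult_right) (auto simp: emeasure_eq_measure)
      show "integrable \<mu> (\<lambda>x. h x + 1 / real N)"
        by (intro Bochner_Integration.integrable_add prob_on_integrable[OF \<mu>(1) compact_Y h(1)]) simp
      fix x assume "x \<in> space \<mu>"
      then have x: "x \<in> Y" by (simp add: prob_on_space[OF \<mu>(1)])
      have "(\<Sum>k<N. 1 / real N * indicator (U k) x) \<le> (\<Sum>k<N. step k (h x + 1 / real N))"
      proof (rule sum_mono)
        fix k
        show "1 / real N * indicator (U k) x \<le> step k (h x + 1 / real N)"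
        proof (cases "real k / real N < h x")
          case True
          then show ?thesis using x N unfolding step_def kN U_def by simp
        next
          case False
          then show ?thesis using N unfolding step_def kN U_def by simp
        qed
      qed
      also have "\<dots> \<le> h x + 1 / real N"
        unfolding tele using h(2)[OF x] by (simp add: min_def)
      finally show "(\<Sum>k<N. 1 / real N * indicator (U k) x) \<le> h x + 1 / real N" .
    qed
    also have "\<dots> = (\<integral>x. h x \<partial>\<mu>) + 1 / real N"
      using prob_on_integrable[OF \<mu>(1) compact_Y h(1)] by (simp add: prob_space)
    finally show ?thesis .
  qed
  show ?thesis
  proof (rule field_le_epsilon)
    fix e :: real assume "0 < e"
    then obtain N where "N > 0" "1 / real N < e"
      by (metis nat_approx_posE zero_less_Suc)
    with *[OF \<open>N > 0\<close>] show "\<Lambda> h \<le> (\<integral>x. h x \<partial>\<mu>) + e" by linarith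
  qed
qed

text \<open>
  The Riesz representation theorem. The inequality above, applied to \<open>h\<close> and to \<open>1 - h\<close>, is an
  equality for functions with values in the unit interval, and the general case is an affine image
  of this one.
\<close>

theorem representing_measure:
  obtains \<mu> where "prob_on Y \<mu>" "\<And>h. continuous_on Y h \<Longrightarrow> (\<integral>x. h x \<partial>\<mu>) = \<Lambda> h"
proof -
  obtain \<mu> where \<mu>: "prob_on Y \<mu>" "\<And>U. openin (top_of_set Y) U \<Longrightarrow> emeasure \<mu> U = content U"
    by (rule exists_measure) blast
  interpret prob_space \<mu> using \<mu>(1) by (simp add: prob_on_def)
  have unit: "(\<integral>x. h x \<partial>\<mu>) = \<Lambda> h"
    if h: "continuous_on Y h" "\<And>x. x \<in> Y \<Longrightarrow> 0 \<le> h x \<and> h x \<le> 1" for h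
  proof (rule antisym)
    show "\<Lambda> h \<le> (\<integral>x. h x \<partial>\<mu>)" by (rule le_integral[OF \<mu> h])
    have "\<Lambda> (\<lambda>x. 1 + (-1) * h x) \<le> (\<integral>x. 1 + (-1) * h x \<partial>\<mu>)"
      by (rule le_integral[OF \<mu>]) (use h in \<open>auto intro!: continuous_intros\<close>)
    moreover have "\<Lambda> (\<lambda>x. 1 + (-1) * h x) = 1 - \<Lambda> h"
      using add[of "\<lambda>_. 1" "\<lambda>x. (-1) * h x"] scale[OF h(1), of "-1"] h(1)
      by (simp add: one continuous_on_minus)
    moreover have "(\<integral>x. 1 + (-1) * h x \<partial>\<mu>) = 1 - (\<integral>x. h x \<partial>\<mu>)"
      using prob_on_integrable[OF \<mu>(1) compact_Y h(1)] by (simp add: prob_space)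
    ultimately show "(\<integral>x. h x \<partial>\<mu>) \<le> \<Lambda> h" by linarith
  qed
  have "(\<integral>x. h x \<partial>\<mu>) = \<Lambda> h" if h: "continuous_on Y h" for h
  proof -
    obtain b where b: "b > 0" "\<And>x. x \<in> Y \<Longrightarrow> \<bar>h x\<bar> \<le> b"
      using compact_imp_bounded[OF compact_continuous_image[OF h compact_Y]]
      by (auto simp: bounded_pos)
    \<comment> \<open>The affine image of \<open>h\<close> with values in the unit interval.\<close>
    define k where "k x = 1/2 + 1 / (2 * b) * h x" for x
    have kc: "continuous_on Y k" unfolding k_def by (intro continuous_intros h)
    have "0 \<le> k x \<and> k x \<le> 1" if "x \<in> Y" for x
      using b(1) b(2)[OF that] by (simp add: k_def field_simps abs_le_iff)
    from unit[OF kc this] have "(\<integral>x. k x \<partial>\<mu>) = \<Lambda> k" .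
    moreover have "\<Lambda> k = 1/2 + 1 / (2 * b) * \<Lambda> h"
      unfolding k_def using add[of "\<lambda>_. 1/2" "\<lambda>x. 1 / (2 * b) * h x"] scale[OF h, of "1 / (2 * b)"]
        const[of "1/2"] continuous_on_mult_left[OF h, of "1 / (2 * b)"]
      by simp
    moreover have "(\<integral>x. k x \<partial>\<mu>) = 1/2 + 1 / (2 * b) * (\<integral>x. h x \<partial>\<mu>)"
      unfolding k_def using prob_on_integrable[OF \<mu>(1) compact_Y h] by (simp add: prob_space)
    ultimately show ?thesis using b(1) by simp
  qed
  with \<mu>(1) that show ?thesis by blast
qed

end

section \<open>The metric of the sequence space\<close>

lemma seq_dist_nonneg: "compact (UNIV :: 'a::metric_space set) \<Longrightarrow> 0 \<le> seq_dist x (y :: nat \<Rightarrow> 'a)"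
  unfolding seq_dist_def by (intro suminf_nonneg summable_seq_dist) auto

lemma seq_dist_refl [simp]: "seq_dist x x = 0"
  by (simp add: seq_dist_def)

lemma seq_dist_commute: "seq_dist x y = seq_dist y x"
  by (simp add: seq_dist_def dist_commute)

lemma seq_dist_triangle:
  assumes "compact (UNIV :: 'a::metric_space set)"
  shows "seq_dist x z \<le> seq_dist x y + seq_dist y (z :: nat \<Rightarrow> 'a)"
proof -
  have "seq_dist x z \<le> (\<Sum>n. (1/2) ^ Suc n * dist (x n) (y n) + (1/2) ^ Suc n * dist (y n) (z n))"
    unfolding seq_dist_def
    by (intro suminf_le summable_add summable_seq_dist[OF assms])
       (simp add: distrib_left[symmetric] dist_triangle)
  also have "\<dots> = seq_dist x y + seq_dist y z"
    unfolding seq_dist_def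
    by (rule suminf_add[OF summable_seq_dist[OF assms] summable_seq_dist[OF assms], symmetric])
  finally show ?thesis .
qed

lemma seq_dist_pos:
  assumes "compact (UNIV :: 'a::metric_space set)" "x \<noteq> (y :: nat \<Rightarrow> 'a)"
  shows "0 < seq_dist x y"
proof -
  obtain n where "x n \<noteq> y n" using assms(2) by auto
  then have "0 < (1/2) ^ Suc n * dist (x n) (y n)" by simp
  also have "\<dots> \<le> seq_dist x y"
    unfolding seq_dist_def
    using sum_le_suminf[OF summable_seq_dist[OF assms(1), of x y], of "{n}"] by simp
  finally show ?thesis .
qed

lemma seq_dist_shift:
  assumes "compact (UNIV :: 'a::metric_space set)"
  shows "seq_dist (x :: nat \<Rightarrow> 'a) y = dist (x 0) (y 0) / 2 + seq_dist (shift x) (shift y) / 2"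
proof -
  let ?f = "\<lambda>n. (1/2) ^ Suc n * dist (x n) (y n)"
  have "seq_dist x y = (\<Sum>n. ?f (Suc n)) + ?f 0"
    unfolding seq_dist_def using suminf_split_head[OF summable_seq_dist[OF assms, of x y]] by simp
  also have "(\<Sum>n. ?f (Suc n)) = (\<Sum>n. 1/2 * ((1/2) ^ Suc n * dist (shift x n) (shift y n)))"
    by (simp add: shift_def mult.assoc)
  also have "\<dots> = 1/2 * seq_dist (shift x) (shift y)"
    unfolding seq_dist_def by (rule suminf_mult[OF summable_seq_dist[OF assms]])
  finally show ?thesis by simp
qed

lemma shift_cons [simp]: "shift (case_nat a x) = x"
  by (simp add: shift_def)

lemma cons_shift [simp]: "case_nat (x 0) (shift x) = x"
  by (rule ext) (simp add: shift_def split: nat.split)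

lemma seq_dist_cons:
  assumes "compact (UNIV :: 'a::metric_space set)"
  shows "seq_dist (case_nat a x) (case_nat a (y :: nat \<Rightarrow> 'a)) = seq_dist x y / 2"
  by (subst seq_dist_shift[OF assms]) simp

lemma seq_dist_shift_le:
  assumes "compact (UNIV :: 'a::metric_space set)"
  shows "seq_dist (shift x) (shift y) \<le> 2 * seq_dist x (y :: nat \<Rightarrow> 'a)"
  using seq_dist_shift[OF assms, of x y] by simp

lemma dist_hd_le:
  assumes "compact (UNIV :: 'a::metric_space set)"
  shows "dist (x 0) (y 0) \<le> 2 * seq_dist x (y :: nat \<Rightarrow> 'a)"
  using seq_dist_shift[OF assms, of x y] seq_dist_nonneg[OF assms, of "shift x" "shift y"] by simp

lemma compact_UNIV_seq:
  assumes "compact (UNIV :: 'a::topological_space set)"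
  shows "compact (UNIV :: (nat \<Rightarrow> 'a) set)"
proof -
  have "compact_space (euclidean :: 'a topology)" using assms by (simp add: compact_space_def)
  then have "compact_space (product_topology (\<lambda>_::nat. euclidean :: 'a topology) UNIV)"
    by (simp add: compact_space_product_topology)
  then show ?thesis by (simp add: euclidean_product_topology compact_space_def)
qed

lemma open_seq_ball:
  assumes "compact (UNIV :: 'a::metric_space set)"
  shows "open {y :: nat \<Rightarrow> 'a. seq_dist x y < r}"
  by (intro open_Collect_less continuous_on_seq_dist[OF assms] continuous_on_const)

text \<open>
  Lebesgue's number lemma for the balls of \<open>seq_dist\<close>, which is not the distance of the type
  \<open>nat \<Rightarrow> 'a\<close>. Reading \<open>Q c r\<close> as "the ball of radius \<open>r\<close> about \<open>c\<close> is good", every ball of radius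
  \<open>\<delta>\<close> is contained in a good one.
\<close>

lemma seq_lebesgue_number:
  fixes Q :: "(nat \<Rightarrow> 'a::metric_space) \<Rightarrow> real \<Rightarrow> bool"
  assumes M: "compact (UNIV :: 'a set)" and K: "compact K"
    and Q: "\<And>x. x \<in> K \<Longrightarrow> \<exists>r>0. Q x r"
  obtains \<delta> where "\<delta> > 0"
    "\<forall>x\<in>K. \<exists>c\<in>K. \<exists>r. Q c r \<and> (\<forall>y. seq_dist x y < \<delta> \<longrightarrow> seq_dist c y < r)"
proof -
  obtain r' where r': "\<And>x. x \<in> K \<Longrightarrow> r' x > 0" "\<And>x. x \<in> K \<Longrightarrow> Q x (r' x)" using Q by metis
  define r where "r x = r' x / 2" for x
  have r: "\<And>x. x \<in> K \<Longrightarrow> r x > 0" "\<And>x. x \<in> K \<Longrightarrow> Q x (2 * r x)"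
    using r' by (simp_all add: r_def)
  obtain T where T: "T \<subseteq> K" "finite T" "K \<subseteq> (\<Union>c\<in>T. {y. seq_dist c y < r c})"
    by (rule compactE_image[OF K, of K "\<lambda>c. {y. seq_dist c y < r c}"])
       (auto simp: open_seq_ball[OF M] r(1))
  define \<delta> where "\<delta> = Min (insert 1 ((\<lambda>c. r c) ` T))"
  have \<delta>: "\<delta> > 0" unfolding \<delta>_def using T r(1) by (auto simp: subset_iff)
  moreover have "\<exists>c\<in>K. \<exists>r. Q c r \<and> (\<forall>y. seq_dist x y < \<delta> \<longrightarrow> seq_dist c y < r)" if x: "x \<in> K" for x
  proof -
    obtain c where c: "c \<in> T" "seq_dist c x < r c" using T x by auto
    have "seq_dist c y < 2 * r c" if "seq_dist x y < \<delta>" for y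
    proof -
      have "\<delta> \<le> r c" unfolding \<delta>_def using T c by (intro Min_le) auto
      then show ?thesis using seq_dist_triangle[OF M, of c y x] that c by linarith
    qed
    then show ?thesis using c T r(2) by blast
  qed
  ultimately show ?thesis using that by blast
qed

lemma seq_continuous_onI:
  fixes h :: "(nat \<Rightarrow> 'a::metric_space) \<Rightarrow> 'b::metric_space"
  assumes M: "compact (UNIV :: 'a set)"
    and h: "\<And>x e. x \<in> K \<Longrightarrow> e > 0 \<Longrightarrow> \<exists>r>0. \<forall>y\<in>K. seq_dist x y < r \<longrightarrow> dist (h x) (h y) < e"
  shows "continuous_on K h"
  unfolding continuous_on_topological
proof (intro ballI allI impI)
  fix x V assume x: "x \<in> K" and "open V" "h x \<in> V"
  then obtain e where e: "e > 0" "\<And>z. dist (h x) z < e \<Longrightarrow> z \<in> V"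
    unfolding open_dist by (metis dist_commute)
  obtain r where r: "r > 0" "\<forall>y\<in>K. seq_dist x y < r \<longrightarrow> dist (h x) (h y) < e" using h[OF x e(1)] by blast
  then show "\<exists>U. open U \<and> x \<in> U \<and> (\<forall>y\<in>K. y \<in> U \<longrightarrow> h y \<in> V)"
    using e by (intro exI[of _ "{y. seq_dist x y < r}"]) (auto simp: open_seq_ball[OF M])
qed

lemma seq_uniformly_continuous:
  fixes h :: "(nat \<Rightarrow> 'a::metric_space) \<Rightarrow> 'b::metric_space"
  assumes M: "compact (UNIV :: 'a set)" and K: "compact K" and h: "continuous_on K h" and e: "e > 0"
  obtains \<delta> where "\<delta> > 0" "\<And>x y. x \<in> K \<Longrightarrow> y \<in> K \<Longrightarrow> seq_dist x y < \<delta> \<Longrightarrow> dist (h x) (h y) < e"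
proof -
  have *: "\<exists>r>0. \<forall>y\<in>K. seq_dist x y < r \<longrightarrow> dist (h x) (h y) < e / 2" if x: "x \<in> K" for x
  proof -
    obtain U where U: "open U" "x \<in> U" "\<forall>y\<in>K. y \<in> U \<longrightarrow> h y \<in> ball (h x) (e / 2)"
      using h x e unfolding continuous_on_topological by (metis centre_in_ball half_gt_zero open_ball)
    then obtain r where "r > 0" "\<forall>y. seq_dist x y < r \<longrightarrow> y \<in> U"
      using open_iff_seq_dist[OF M] by blast
    then show ?thesis using U by (intro exI[of _ r]) auto
  qed
  obtain \<delta> where \<delta>: "\<delta> > 0"
    "\<forall>x\<in>K. \<exists>c\<in>K. \<exists>r. (\<forall>y\<in>K. seq_dist c y < r \<longrightarrow> dist (h c) (h y) < e / 2) \<and>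
        (\<forall>y. seq_dist x y < \<delta> \<longrightarrow> seq_dist c y < r)"
    by (rule seq_lebesgue_number[OF M K, of "\<lambda>x r. \<forall>y\<in>K. seq_dist x y < r \<longrightarrow> dist (h x) (h y) < e / 2", OF *]) (assumption, rule that)
  have "dist (h x) (h y) < e" if xy: "x \<in> K" "y \<in> K" "seq_dist x y < \<delta>" for x y
  proof -
    obtain c r where c: "\<forall>y\<in>K. seq_dist c y < r \<longrightarrow> dist (h c) (h y) < e / 2"
        "\<forall>y. seq_dist x y < \<delta> \<longrightarrow> seq_dist c y < r"
      using bspec[OF \<delta>(2) xy(1)] by (elim bexE exE conjE)
    have "dist (h c) (h x) < e / 2" "dist (h c) (h y) < e / 2" using c xy \<delta>(1) by auto
    then show ?thesis using dist_triangle3[of "h x" "h y" "h c"] by linarith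
  qed
  with \<delta>(1) that show ?thesis by blast
qed

lemma seq_finite_net:
  fixes K :: "(nat \<Rightarrow> 'a::metric_space) set"
  assumes M: "compact (UNIV :: 'a set)" and K: "compact K" and r: "r > 0"
  obtains T where "finite T" "T \<subseteq> K" "\<And>x. x \<in> K \<Longrightarrow> \<exists>c\<in>T. seq_dist c x < r"
proof -
  define V where "V c = {y. seq_dist c y < r}" for c :: "nat \<Rightarrow> 'a"
  have "open (V c)" for c unfolding V_def by (rule open_seq_ball[OF M])
  moreover have "K \<subseteq> (\<Union>c\<in>K. V c)" using r by (auto simp: V_def)
  ultimately obtain T where T: "T \<subseteq> K" "finite T" "K \<subseteq> (\<Union>c\<in>T. V c)"
    using compactE_image[OF K, of K V] by metis
  show ?thesis using that[OF T(2,1)] T(3) by (auto simp: V_def subset_iff)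
qed

lemma seq_countable_dense:
  fixes K :: "(nat \<Rightarrow> 'a::metric_space) set"
  assumes M: "compact (UNIV :: 'a set)" and K: "compact K"
  obtains T where "countable T" "T \<subseteq> K" "\<And>x e. x \<in> K \<Longrightarrow> e > 0 \<Longrightarrow> \<exists>c\<in>T. seq_dist c x < e"
proof -
  have "\<exists>T. finite T \<and> T \<subseteq> K \<and> (\<forall>x\<in>K. \<exists>c\<in>T. seq_dist c x < 1 / real (Suc n))" for n
    by (rule seq_finite_net[OF M K, of "1 / real (Suc n)"]) auto
  then obtain T where T: "\<And>n. finite (T n)" "\<And>n. T n \<subseteq> K"
      "\<And>n x. x \<in> K \<Longrightarrow> \<exists>c\<in>T n. seq_dist c x < 1 / real (Suc n)"
    by metis
  show ?thesis
  proof (rule that[of "\<Union>n. T n"])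
    show "countable (\<Union>n. T n)" using T(1) by (simp add: countable_finite)
    show "(\<Union>n. T n) \<subseteq> K" using T(2) by blast
    fix x and e :: real assume "x \<in> K" "e > 0"
    obtain n where "1 / real (Suc n) < e" using nat_approx_posE[OF \<open>e > 0\<close>] by blast
    moreover obtain c where "c \<in> T n" "seq_dist c x < 1 / real (Suc n)" using T(3)[OF \<open>x \<in> K\<close>] by blast
    ultimately show "\<exists>c\<in>\<Union>n. T n. seq_dist c x < e" by (intro bexI[of _ c]) auto
  qed
qed

lemma powr_half_less: "0 < \<alpha> \<Longrightarrow> (1/2) powr \<alpha> < (1::real)"
  using powr_less_mono'[of "1/2" 0 \<alpha>] by simp

lemma holder_continuous_on:
  fixes h :: "(nat \<Rightarrow> 'a::metric_space) \<Rightarrow> 'b::real_normed_vector"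
  assumes M: "compact (UNIV :: 'a set)" and \<alpha>: "\<alpha> > 0" and \<delta>: "\<delta> > 0"
    and h: "\<And>x y. x \<in> K \<Longrightarrow> y \<in> K \<Longrightarrow> seq_dist x y < \<delta> \<Longrightarrow> norm (h x - h y) \<le> C * seq_dist x y powr \<alpha>"
  shows "continuous_on K h"
proof (rule seq_continuous_onI[OF M])
  fix x and e :: real assume x: "x \<in> K" and e: "e > 0"
  define C' where "C' = \<bar>C\<bar> + 1"
  \<comment> \<open>This radius is the solution of \<open>C' * r powr \<alpha> = e\<close>.\<close>
  define r where "r = min \<delta> ((e / C') powr (1 / \<alpha>))"
  have C': "C' > 0" "C \<le> C'" by (auto simp: C'_def)
  have "r > 0" using \<delta> e C' by (simp add: r_def)
  moreover have "dist (h x) (h y) < e" if y: "y \<in> K" "seq_dist x y < r" for y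
  proof -
    have "norm (h x - h y) \<le> C * seq_dist x y powr \<alpha>" using h x y by (simp add: r_def)
    also have "\<dots> \<le> C' * seq_dist x y powr \<alpha>" using C' by (intro mult_right_mono) auto
    also have "seq_dist x y powr \<alpha> < ((e / C') powr (1 / \<alpha>)) powr \<alpha>"
      using y \<alpha> seq_dist_nonneg[OF M] by (intro powr_less_mono2) (auto simp: r_def)
    also have "((e / C') powr (1 / \<alpha>)) powr \<alpha> = e / C'"
      using \<alpha> e C' by (simp add: powr_powr)
    finally show ?thesis using C' by (simp add: dist_norm)
  qed
  ultimately show "\<exists>r>0. \<forall>y\<in>K. seq_dist x y < r \<longrightarrow> dist (h x) (h y) < e" by blast
qed

text \<open>
  Pairs at distance at least \<open>\<delta>\<close> are taken care of by the bound \<open>b\<close> on the oscillation.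
\<close>

lemma holder_global:
  fixes h :: "(nat \<Rightarrow> 'a::metric_space) \<Rightarrow> 'b::real_normed_vector"
  assumes \<alpha>: "\<alpha> > 0" and \<delta>: "\<delta> > 0"
    and h: "\<And>x y. x \<in> K \<Longrightarrow> y \<in> K \<Longrightarrow> seq_dist x y < \<delta> \<Longrightarrow> norm (h x - h y) \<le> C * seq_dist x y powr \<alpha>"
    and b: "\<And>x y. x \<in> K \<Longrightarrow> y \<in> K \<Longrightarrow> norm (h x - h y) \<le> b"
    and xy: "x \<in> K" "y \<in> K"
  shows "norm (h x - h y) \<le> max C (b / \<delta> powr \<alpha>) * seq_dist x y powr \<alpha>"
proof (cases "seq_dist x y < \<delta>")
  case True
  show ?thesis
    by (rule order_trans[OF h[OF xy True]], rule mult_right_mono) auto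
next
  case False
  have "b \<ge> 0" using b[OF xy] norm_ge_zero order_trans by blast
  have "\<delta> powr \<alpha> \<le> seq_dist x y powr \<alpha>" using False \<delta> \<alpha> by (intro powr_mono2) auto
  then have "b / \<delta> powr \<alpha> * \<delta> powr \<alpha> \<le> b / \<delta> powr \<alpha> * seq_dist x y powr \<alpha>"
    using \<open>b \<ge> 0\<close> by (intro mult_left_mono) auto
  then have "b \<le> b / \<delta> powr \<alpha> * seq_dist x y powr \<alpha>" using \<delta> by simp
  also have "\<dots> \<le> max C (b / \<delta> powr \<alpha>) * seq_dist x y powr \<alpha>" by (intro mult_right_mono) auto
  finally show ?thesis using b[OF xy] by linarith
qed

section \<open>Admissible sequences and integration over preimages\<close>

text \<open>
  Surjectivity of the shift says that every admissible sequence can be extended to the left. Full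
  support of \<open>\<nu>\<close> on the sets of admissible letters ensures that integration over preimages notices
  every branch on which a continuous nonnegative function is positive.
\<close>

locale symbolic_system =
  fixes A :: "'a::metric_space \<times> 'a \<Rightarrow> real" and I :: "real set" and \<nu> :: "'a measure"
  assumes compact_alphabet: "compact (UNIV :: 'a set)"
    and continuous_A: "continuous_on UNIV A" and compact_I: "compact I"
    and nonempty: "admissible A I \<noteq> {}"
    and locally_constant_pred: "locally_constant (pred_set A I)"
    and prob_nu: "prob_space \<nu>" and sets_nu: "sets \<nu> = sets borel"
    and full_support: "\<And>x. x \<in> admissible A I \<Longrightarrow> full_support_on \<nu> (pred_set A I (x 0))"
    and shift_onto: "shift ` admissible A I = admissible A I"
    and transitive: "top_transitive shift (admissible A I)"
begin

sublocale nu: prob_space \<nu> by (rule prob_nu)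

abbreviation B :: "(nat \<Rightarrow> 'a) set" where "B \<equiv> admissible A I"

abbreviation preds :: "(nat \<Rightarrow> 'a) \<Rightarrow> 'a set" where "preds x \<equiv> pred_set A I (x 0)"

lemmas d_nonneg = seq_dist_nonneg[OF compact_alphabet]
lemmas d_triangle = seq_dist_triangle[OF compact_alphabet]
lemmas d_cons = seq_dist_cons[OF compact_alphabet]

lemma cons_in: "x \<in> B \<Longrightarrow> a \<in> preds x \<Longrightarrow> case_nat a x \<in> B"
  by (auto simp: admissible_def pred_set_def split: nat.split)

lemma shift_in: "x \<in> B \<Longrightarrow> shift x \<in> B"
  by (simp add: admissible_def shift_def)

lemma hd_in_preds: "x \<in> B \<Longrightarrow> x 0 \<in> preds (shift x)"
  by (simp add: admissible_def shift_def pred_set_def)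

lemma continuous_shift: "continuous_on B (shift :: (nat \<Rightarrow> 'a) \<Rightarrow> nat \<Rightarrow> 'a)"
  unfolding shift_def
  by (intro continuous_on_coordinatewise_then_product continuous_on_subset[OF continuous_on_product_coordinates]) auto

lemma compact_B: "compact B"
proof -
  have "closed (\<Inter>n. (\<lambda>x :: nat \<Rightarrow> 'a. A (x n, x (Suc n))) -` I)"
  proof (intro closed_INT ballI)
    fix n
    have "continuous_on UNIV (\<lambda>x :: nat \<Rightarrow> 'a. A (x n, x (Suc n)))"
      by (rule continuous_on_compose2[OF continuous_A])
         (auto intro!: continuous_intros continuous_on_product_coordinates)
    then show "closed ((\<lambda>x :: nat \<Rightarrow> 'a. A (x n, x (Suc n))) -` I)"
      using compact_imp_closed[OF compact_I] by (simp add: closed_vimage)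
  qed
  moreover have "(\<Inter>n. (\<lambda>x :: nat \<Rightarrow> 'a. A (x n, x (Suc n))) -` I) = B"
    by (auto simp: admissible_def)
  ultimately show ?thesis
    using closed_Int_compact[OF _ compact_UNIV_seq[OF compact_alphabet]] by fastforce
qed

lemma closed_preds: "closed (preds x)"
proof -
  have "continuous_on UNIV (\<lambda>a. A (a, x 0))"
    by (rule continuous_on_compose2[OF continuous_A]) (auto intro!: continuous_intros)
  from closed_vimage[OF compact_imp_closed[OF compact_I] this]
  show ?thesis by (simp add: pred_set_def vimage_def)
qed

lemma preds_sets: "preds x \<in> sets \<nu>"
  using closed_preds by (simp add: sets_nu)

text \<open>
  A Lebesgue number for the local constancy of the sets of admissible letters: points closer than
  \<open>\<delta>\<close> have the same branches.
\<close>

definition \<delta> :: real where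
  "\<delta> = (SOME \<delta>. \<delta> > 0 \<and> (\<forall>x\<in>B. \<forall>y\<in>B. seq_dist x y < \<delta> \<longrightarrow> preds x = preds y))"

lemma \<delta>: "\<delta> > 0" "\<And>x y. x \<in> B \<Longrightarrow> y \<in> B \<Longrightarrow> seq_dist x y < \<delta> \<Longrightarrow> preds x = preds y"
proof -
  have *: "\<exists>r>0. \<forall>y. seq_dist x y < r \<longrightarrow> preds y = preds x" for x
  proof -
    obtain U where U: "open U" "x 0 \<in> U" "\<forall>c\<in>U. pred_set A I c = preds x"
      using locally_constant_pred unfolding locally_constant_def by blast
    then obtain e where e: "e > 0" "\<forall>c. dist c (x 0) < e \<longrightarrow> c \<in> U" unfolding open_dist by blast
    have "preds y = preds x" if "seq_dist x y < e / 2" for y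
    proof -
      have "dist (y 0) (x 0) < e" using dist_hd_le[OF compact_alphabet, of x y] that by (simp add: dist_commute)
      then show ?thesis using U e by blast
    qed
    then show ?thesis using half_gt_zero[OF e(1)] by blast
  qed
  obtain \<delta>' where \<delta>': "\<delta>' > 0"
    "\<forall>x\<in>B. \<exists>c\<in>B. \<exists>r. (\<forall>y. seq_dist c y < r \<longrightarrow> preds y = preds c) \<and>
        (\<forall>y. seq_dist x y < \<delta>' \<longrightarrow> seq_dist c y < r)"
    by (rule seq_lebesgue_number[OF compact_alphabet compact_B, of "\<lambda>x r. \<forall>y. seq_dist x y < r \<longrightarrow> preds y = preds x", OF *]) (rule that)
  have "preds x = preds y" if xy: "x \<in> B" "y \<in> B" "seq_dist x y < \<delta>'" for x y
  proof -
    obtain c r where "\<forall>y. seq_dist c y < r \<longrightarrow> preds y = preds c" "\<forall>y. seq_dist x y < \<delta>' \<longrightarrow> seq_dist c y < r"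
      using bspec[OF \<delta>'(2) xy(1)] by (elim bexE exE conjE)
    then show ?thesis using xy(3) \<delta>'(1) by (metis seq_dist_refl)
  qed
  with \<delta>'(1) have "\<exists>\<delta>. \<delta> > 0 \<and> (\<forall>x\<in>B. \<forall>y\<in>B. seq_dist x y < \<delta> \<longrightarrow> preds x = preds y)" by blast
  from someI_ex[OF this]
  show "\<delta> > 0" "\<And>x y. x \<in> B \<Longrightarrow> y \<in> B \<Longrightarrow> seq_dist x y < \<delta> \<Longrightarrow> preds x = preds y"
    unfolding \<delta>_def[symmetric] by blast+
qed

lemma uniformly_continuous_B:
  fixes h :: "(nat \<Rightarrow> 'a) \<Rightarrow> 'b::metric_space"
  assumes "continuous_on B h" "e > 0"
  obtains r where "r > 0" "\<And>x y. x \<in> B \<Longrightarrow> y \<in> B \<Longrightarrow> seq_dist x y < r \<Longrightarrow> dist (h x) (h y) < e"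
  using seq_uniformly_continuous[OF compact_alphabet compact_B assms] by metis

lemma bounded_B:
  fixes h :: "(nat \<Rightarrow> 'a) \<Rightarrow> 'b::real_normed_vector"
  assumes "continuous_on B h"
  obtains b where "b > 0" "\<And>x. x \<in> B \<Longrightarrow> norm (h x) \<le> b"
proof -
  obtain b where "b > 0" "\<forall>z\<in>h ` B. norm z \<le> b"
    using compact_imp_bounded[OF compact_continuous_image[OF assms compact_B]] unfolding bounded_pos by blast
  then show ?thesis using that by blast
qed

lemma continuous_cons: "continuous_on UNIV (\<lambda>a. case_nat a x :: nat \<Rightarrow> 'a)"
proof (rule continuous_on_coordinatewise_then_product)
  fix i show "continuous_on UNIV (\<lambda>a. (case_nat a x :: nat \<Rightarrow> 'a) i)"
    by (cases i) (auto intro: continuous_intros)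
qed

lemma branch_integrable:
  fixes F :: "(nat \<Rightarrow> 'a) \<Rightarrow> 'b::{banach, second_countable_topology}"
  assumes F: "continuous_on B F" and x: "x \<in> B"
  shows "set_integrable \<nu> (preds x) (\<lambda>a. F (case_nat a x))"
proof -
  obtain b where b: "b > 0" "\<And>x. x \<in> B \<Longrightarrow> norm (F x) \<le> b" using bounded_B[OF F] by metis
  have "continuous_on (preds x) (\<lambda>a. F (case_nat a x))"
    by (rule continuous_on_compose2[OF F continuous_on_subset[OF continuous_cons]])
       (use cons_in[OF x] in auto)
  then have "(\<lambda>a. indicator (preds x) a *\<^sub>R F (case_nat a x)) \<in> borel_measurable borel"
    using closed_preds by (intro borel_measurable_continuous_on_indicator) auto
  then have "(\<lambda>a. indicator (preds x) a *\<^sub>R F (case_nat a x)) \<in> borel_measurable \<nu>"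
    using measurable_cong_sets[OF sets_nu refl] by blast
  moreover have "norm (indicator (preds x) a *\<^sub>R F (case_nat a x)) \<le> b" for a
    using b cons_in[OF x] by (cases "a \<in> preds x") auto
  ultimately show ?thesis
    unfolding set_integrable_def by (intro nu.integrable_const_bound[of _ b]) auto
qed

lemma branch_integral_norm_le:
  fixes F :: "(nat \<Rightarrow> 'a) \<Rightarrow> 'b::{banach, second_countable_topology}"
  assumes x: "x \<in> B" and e: "e \<ge> 0"
    and G: "set_integrable \<nu> (preds x) G" "\<And>a. a \<in> preds x \<Longrightarrow> norm (G a :: 'b) \<le> e"
  shows "norm (LINT a:preds x|\<nu>. G a) \<le> e"
proof -
  have "norm (LINT a:preds x|\<nu>. G a) \<le> (LINT a|\<nu>. norm (indicator (preds x) a *\<^sub>R G a))"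
    unfolding set_lebesgue_integral_def by (rule integral_norm_bound)
  also have "\<dots> \<le> (LINT a|\<nu>. e)"
  proof (rule integral_mono)
    show "integrable \<nu> (\<lambda>a. norm (indicator (preds x) a *\<^sub>R G a))"
      using G(1) unfolding set_integrable_def by (rule integrable_norm)
    fix a show "norm (indicator (preds x) a *\<^sub>R G a) \<le> e"
      using G(2) e by (cases "a \<in> preds x") auto
  qed simp
  finally show ?thesis by (simp add: nu.prob_space)
qed

text \<open>
  By continuity the integrand stays above a positive constant on a relatively open set of
  admissible letters, which has positive measure since \<open>\<nu>\<close> has full support on the admissible letters.
\<close>

lemma branch_integral_pos:
  fixes F :: "(nat \<Rightarrow> 'a) \<Rightarrow> real"
  assumes F: "continuous_on B F" "\<And>y. y \<in> B \<Longrightarrow> 0 \<le> F y" and x: "x \<in> B"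
    and a: "a \<in> preds x" "F (case_nat a x) > 0"
  shows "(LINT a:preds x|\<nu>. F (case_nat a x)) > 0"
proof -
  define c where "c = F (case_nat a x) / 2"
  have c: "c > 0" "c < F (case_nat a x)" using a by (auto simp: c_def)
  have "continuous_on (preds x) (\<lambda>a. F (case_nat a x))"
    by (rule continuous_on_compose2[OF F(1) continuous_on_subset[OF continuous_cons]])
       (use cons_in[OF x] in auto)
  then have "openin (top_of_set (preds x)) (preds x \<inter> (\<lambda>a. F (case_nat a x)) -` {c<..})"
    by (rule continuous_openin_preimage_gen) simp
  then obtain U where U: "open U" "U \<inter> preds x = preds x \<inter> (\<lambda>a. F (case_nat a x)) -` {c<..}"
    unfolding openin_open by (metis inf_commute)
  have US: "U \<inter> preds x \<in> sets \<nu>" using U(1) preds_sets sets_nu by auto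
  have "U \<inter> preds x \<noteq> {}" unfolding U(2) using a c by blast
  then have "emeasure \<nu> (U \<inter> preds x) > 0"
    using full_support[OF x] U(1) unfolding full_support_on_def by blast
  then have "0 < c * measure \<nu> (U \<inter> preds x)" using c by (simp add: nu.emeasure_eq_measure)
  also have "\<dots> = (LINT a|\<nu>. c * indicator (U \<inter> preds x) a)"
    using US by (simp add: Int_absorb2 sets.sets_into_space nu.emeasure_eq_measure)
  also have "\<dots> \<le> (LINT a:preds x|\<nu>. F (case_nat a x))"
    unfolding set_lebesgue_integral_def
  proof (rule integral_mono)
    show "integrable \<nu> (\<lambda>a. c * indicator (U \<inter> preds x) a)" using US
      by (intro integrable_mult_right) (auto simp: nu.emeasure_eq_measure)
    show "integrable \<nu> (\<lambda>a. indicator (preds x) a *\<^sub>R F (case_nat a x))"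
      using branch_integrable[OF F(1) x] by (simp add: set_integrable_def)
    fix a
    show "c * indicator (U \<inter> preds x) a \<le> indicator (preds x) a *\<^sub>R F (case_nat a x)"
    proof (cases "a \<in> preds x")
      case True
      show ?thesis
      proof (cases "a \<in> U")
        case True
        then have "a \<in> preds x \<inter> (\<lambda>a. F (case_nat a x)) -` {c<..}" using \<open>a \<in> preds x\<close> U(2) by blast
        then show ?thesis using True by auto
      qed (use True F(2) cons_in[OF x] in auto)
    qed auto
  qed
  finally show ?thesis .
qed

section \<open>The Ruelle operator\<close>

abbreviation L :: "((nat \<Rightarrow> 'a) \<Rightarrow> real) \<Rightarrow> ((nat \<Rightarrow> 'a) \<Rightarrow> 'b::{banach, second_countable_topology}) \<Rightarrow> (nat \<Rightarrow> 'a) \<Rightarrow> 'b"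
  where "L \<phi> \<equiv> ruelle \<nu> A I \<phi>"

lemma L_eq: "x \<in> B \<Longrightarrow> L \<phi> f x = (LINT a:preds x|\<nu>. exp (\<phi> (case_nat a x)) *\<^sub>R f (case_nat a x))"
  by (simp add: ruelle_def)

lemma L_outside: "x \<notin> B \<Longrightarrow> L \<phi> f x = 0"
  by (simp add: ruelle_def)

lemma L_cong_weight:
  assumes "\<And>y. y \<in> B \<Longrightarrow> exp (\<phi> y) *\<^sub>R f y = exp (\<phi>' y) *\<^sub>R g y"
  shows "L \<phi> f = L \<phi>' g"
proof
  fix x show "L \<phi> f x = L \<phi>' g x"
  proof (cases "x \<in> B")
    case True
    then show ?thesis unfolding L_eq[OF True]
      by (intro set_lebesgue_integral_cong preds_sets) (auto intro: assms cons_in)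
  qed (simp add: L_outside)
qed

lemma L_cong: "(\<And>y. y \<in> B \<Longrightarrow> f y = g y) \<Longrightarrow> L \<phi> f = L \<phi> g"
  by (rule L_cong_weight) simp

lemma L_integrable:
  fixes f :: "(nat \<Rightarrow> 'a) \<Rightarrow> 'b::{banach, second_countable_topology}"
  assumes "continuous_on B \<phi>" "continuous_on B f" "x \<in> B"
  shows "set_integrable \<nu> (preds x) (\<lambda>a. exp (\<phi> (case_nat a x)) *\<^sub>R f (case_nat a x))"
  by (rule branch_integrable[OF _ assms(3), of "\<lambda>y. exp (\<phi> y) *\<^sub>R f y"])
     (intro continuous_intros assms)

lemma L_add:
  fixes f g :: "(nat \<Rightarrow> 'a) \<Rightarrow> 'b::{banach, second_countable_topology}"
  assumes "continuous_on B \<phi>" "continuous_on B f" "continuous_on B g" "x \<in> B"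
  shows "L \<phi> (\<lambda>y. f y + g y) x = L \<phi> f x + L \<phi> g x"
  unfolding L_eq[OF assms(4)] scaleR_add_right
  by (rule set_integral_add(2)[OF L_integrable[OF assms(1,2,4)] L_integrable[OF assms(1,3,4)]])

lemma L_diff:
  fixes f g :: "(nat \<Rightarrow> 'a) \<Rightarrow> 'b::{banach, second_countable_topology}"
  assumes "continuous_on B \<phi>" "continuous_on B f" "continuous_on B g" "x \<in> B"
  shows "L \<phi> (\<lambda>y. f y - g y) x = L \<phi> f x - L \<phi> g x"
  unfolding L_eq[OF assms(4)] scaleR_diff_right
  by (rule set_integral_diff(2)[OF L_integrable[OF assms(1,2,4)] L_integrable[OF assms(1,3,4)]])

lemma L_mult:
  fixes f :: "(nat \<Rightarrow> 'a) \<Rightarrow> 'b::{real_normed_field, banach, second_countable_topology}"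
  shows "L \<phi> (\<lambda>y. c * f y) x = c * L \<phi> f x"
proof (cases "x \<in> B")
  case True
  have "L \<phi> (\<lambda>y. c * f y) x = (LINT a:preds x|\<nu>. c * (exp (\<phi> (case_nat a x)) *\<^sub>R f (case_nat a x)))"
    unfolding L_eq[OF True] by (simp only: mult_scaleR_right)
  also have "\<dots> = c * L \<phi> f x" unfolding L_eq[OF True] by (rule set_integral_mult_right)
  finally show ?thesis .
qed (simp add: L_outside)

lemma L_mono:
  assumes "continuous_on B \<phi>" "continuous_on B f" "continuous_on B g" "x \<in> B"
    "\<And>y. y \<in> B \<Longrightarrow> f y \<le> (g y :: real)"
  shows "L \<phi> f x \<le> L \<phi> g x"
  unfolding L_eq[OF assms(4)]
  by (rule set_integral_mono[OF L_integrable[OF assms(1,2,4)] L_integrable[OF assms(1,3,4)]])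
     (simp add: assms(5) cons_in[OF assms(4)])

lemma L_nonneg:
  assumes "continuous_on B \<phi>" "continuous_on B f" "x \<in> B" "\<And>y. y \<in> B \<Longrightarrow> 0 \<le> (f y :: real)"
  shows "0 \<le> L \<phi> f x"
  using L_mono[OF assms(1) _ assms(2,3), of "\<lambda>_. 0"] assms(4) L_mult[of \<phi> 0 "\<lambda>_. 0 :: real" x] by simp

lemma L_norm_le:
  fixes f :: "(nat \<Rightarrow> 'a) \<Rightarrow> 'b::{banach, second_countable_topology}"
  assumes "continuous_on B \<phi>" "continuous_on B f" "x \<in> B"
  shows "norm (L \<phi> f x) \<le> L \<phi> (\<lambda>y. norm (f y)) x"
  using set_integral_norm_bound[OF L_integrable[OF assms]] by (simp add: L_eq[OF assms(3)])

lemma L_pos: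
  assumes "continuous_on B \<phi>" "continuous_on B f" "\<And>y. y \<in> B \<Longrightarrow> 0 \<le> (f y :: real)"
    and "y \<in> B" "0 < f y"
  shows "0 < L \<phi> f (shift y)"
  unfolding L_eq[OF shift_in[OF assms(4)]]
  by (rule branch_integral_pos[of "\<lambda>y. exp (\<phi> y) *\<^sub>R f y" _ "y 0"])
     (use assms in \<open>auto intro!: continuous_intros shift_in hd_in_preds\<close>)

text \<open>
  Points closer than \<open>\<delta>\<close> have the same branches, so the two integrals can be compared branch by
  branch, and prepending the same letter halves the distance.
\<close>

lemma L_difference_le:
  fixes f g :: "(nat \<Rightarrow> 'a) \<Rightarrow> 'b::{banach, second_countable_topology}"
  assumes "continuous_on B \<phi>" "continuous_on B f" and xy: "x \<in> B" "y \<in> B" "seq_dist x y < \<delta>"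
    and e: "e \<ge> 0"
    and le: "\<And>u v. u \<in> B \<Longrightarrow> v \<in> B \<Longrightarrow> seq_dist u v = seq_dist x y / 2 \<Longrightarrow>
      norm (exp (\<phi> u) *\<^sub>R f u - exp (\<phi> v) *\<^sub>R f v) \<le> e"
  shows "norm (L \<phi> f x - L \<phi> f y) \<le> e"
proof -
  let ?F = "\<lambda>x a. exp (\<phi> (case_nat a x)) *\<^sub>R f (case_nat a x)"
  have p: "preds x = preds y" using \<delta>(2)[OF xy] .
  have i: "set_integrable \<nu> (preds x) (?F x)" "set_integrable \<nu> (preds x) (?F y)"
    using L_integrable[OF assms(1,2) xy(1)] L_integrable[OF assms(1,2) xy(2)] p by simp_all
  have "L \<phi> f x - L \<phi> f y = (LINT a:preds x|\<nu>. ?F x a - ?F y a)"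
    using set_integral_diff(2)[OF i] by (simp add: L_eq xy p)
  also have "norm \<dots> \<le> e"
  proof (rule branch_integral_norm_le[OF xy(1) e])
    show "set_integrable \<nu> (preds x) (\<lambda>a. ?F x a - ?F y a)" by (rule set_integral_diff(1)[OF i])
    fix a assume a: "a \<in> preds x"
    show "norm (?F x a - ?F y a) \<le> e"
      by (rule le) (use a p xy cons_in d_cons in auto)
  qed
  finally show ?thesis .
qed

lemma L_continuous:
  fixes f :: "(nat \<Rightarrow> 'a) \<Rightarrow> 'b::{banach, second_countable_topology}"
  assumes "continuous_on B \<phi>" "continuous_on B f"
  shows "continuous_on B (L \<phi> f)"
proof (rule seq_continuous_onI[OF compact_alphabet])
  fix x and e :: real assume x: "x \<in> B" and e: "e > 0"
  have "continuous_on B (\<lambda>y. exp (\<phi> y) *\<^sub>R f y)" by (intro continuous_intros assms)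
  from uniformly_continuous_B[OF this half_gt_zero[OF e]]
  obtain r where r: "r > 0" "\<And>x y. x \<in> B \<Longrightarrow> y \<in> B \<Longrightarrow> seq_dist x y < r \<Longrightarrow>
      dist (exp (\<phi> x) *\<^sub>R f x) (exp (\<phi> y) *\<^sub>R f y) < e / 2"
    by blast
  have "dist (L \<phi> f x) (L \<phi> f y) < e" if y: "y \<in> B" "seq_dist x y < min \<delta> r" for y
  proof -
    have "norm (L \<phi> f x - L \<phi> f y) \<le> e / 2"
    proof (rule L_difference_le[OF assms x y(1)])
      fix u v assume "u \<in> B" "v \<in> B" "seq_dist u v = seq_dist x y / 2"
      moreover have "seq_dist x y / 2 < r" using y d_nonneg[of x y] by simp
      ultimately show "norm (exp (\<phi> u) *\<^sub>R f u - exp (\<phi> v) *\<^sub>R f v) \<le> e / 2"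
        using r(2)[of u v] by (simp add: dist_norm)
    qed (use y e in auto)
    then show ?thesis using e by (simp add: dist_norm)
  qed
  then show "\<exists>r>0. \<forall>y\<in>B. seq_dist x y < r \<longrightarrow> dist (L \<phi> f x) (L \<phi> f y) < e"
    using \<delta>(1) r(1) by (intro exI[of _ "min \<delta> r"]) auto
qed

section \<open>Dense preimages and primitivity\<close>

lemma iterate_shift_in: "v \<in> B \<Longrightarrow> (shift ^^ n) v \<in> B"
  by (induction n) (auto intro: shift_in)

text \<open>
  Keep the first \<open>n\<close> entries of \<open>v\<close> and replace the tail by \<open>x\<close>. Going backwards from the tail, the
  next letter of \<open>v\<close> remains admissible because the old and the new tail are closer than \<open>\<delta>\<close>.
\<close>

lemma shadow_preimage:
  assumes "v \<in> B" "x \<in> B" "seq_dist ((shift ^^ n) v) x < \<delta>"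
  shows "\<exists>v'\<in>B. (shift ^^ n) v' = x \<and> seq_dist v v' \<le> seq_dist ((shift ^^ n) v) x"
  using assms
proof (induction n arbitrary: v)
  case (Suc n)
  have eq: "(shift ^^ Suc n) v = (shift ^^ n) (shift v)" by (simp only: funpow_Suc_right o_apply)
  \<comment> \<open>Shadow the tail first; its first entry decides whether the letter \<open>v 0\<close> may precede it.\<close>
  obtain w where w: "w \<in> B" "(shift ^^ n) w = x" "seq_dist (shift v) w \<le> seq_dist ((shift ^^ n) (shift v)) x"
    using Suc.IH[OF shift_in[OF Suc.prems(1)] Suc.prems(2)] Suc.prems(3) unfolding eq by blast
  have "seq_dist (shift v) w < \<delta>" using w(3) Suc.prems(3) unfolding eq by linarith
  then have "preds (shift v) = preds w" using \<delta>(2) shift_in[OF Suc.prems(1)] w(1) by blast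
  then have v': "case_nat (v 0) w \<in> B" using hd_in_preds[OF Suc.prems(1)] cons_in[OF w(1)] by blast
  have "seq_dist v (case_nat (v 0) w) = seq_dist (shift v) w / 2"
    using d_cons[of "v 0" "shift v" w] by simp
  also have "\<dots> \<le> seq_dist ((shift ^^ Suc n) v) x"
    using w(3) d_nonneg[of "shift v" w] unfolding eq by linarith
  finally show ?case
    using v' w(2) by (intro bexI[of _ "case_nat (v 0) w"]) (auto simp del: funpow.simps simp: funpow_Suc_right)
qed auto

lemma openin_seq_ball: "openin (top_of_set B) (B \<inter> {y. seq_dist x y < r})"
  by (rule openin_open_Int[OF open_seq_ball[OF compact_alphabet]])

text \<open>
  Transitivity provides \<open>v\<close> near \<open>z\<close> whose \<open>n\<close>-th image is near \<open>x\<close>, and shadowing moves that image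
  to \<open>x\<close> itself.
\<close>

lemma preimages_dense:
  assumes x: "x \<in> B" and z: "z \<in> B" and r: "r > 0"
  obtains n v where "v \<in> B" "(shift ^^ n) v = x" "seq_dist z v < r"
proof -
  define \<rho> where "\<rho> = min \<delta> (r / 2)"
  have \<rho>: "\<rho> > 0" "\<rho> \<le> \<delta>" "\<rho> \<le> r / 2" using \<delta>(1) r by (auto simp: \<rho>_def)
  have "x \<in> B \<inter> {y. seq_dist x y < \<rho>}" "z \<in> B \<inter> {y. seq_dist z y < r / 2}" using x z \<rho> r by auto
  then obtain n where "(shift ^^ n) -` (B \<inter> {y. seq_dist x y < \<rho>}) \<inter> (B \<inter> {y. seq_dist z y < r / 2}) \<noteq> {}"
    using transitive[unfolded top_transitive_def, rule_format,
        of "B \<inter> {y. seq_dist x y < \<rho>}" "B \<inter> {y. seq_dist z y < r / 2}"]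
      openin_seq_ball[of x \<rho>] openin_seq_ball[of z "r / 2"] by blast
  then obtain v where v: "v \<in> B" "seq_dist z v < r / 2" "seq_dist x ((shift ^^ n) v) < \<rho>" by auto
  then have "seq_dist ((shift ^^ n) v) x < \<delta>" using \<rho> by (simp add: seq_dist_commute)
  then obtain v' where "v' \<in> B" "(shift ^^ n) v' = x" "seq_dist v v' \<le> seq_dist ((shift ^^ n) v) x"
    using shadow_preimage[OF v(1) x] by blast
  moreover from this have "seq_dist z v' < r"
    using d_triangle[of z v' v] v \<rho> seq_dist_commute[of x "(shift ^^ n) v"] by simp
  ultimately show ?thesis using that by blast
qed

text \<open>
  The number \<open>n\<close> does not depend on \<open>x\<close>: mixing is applied to finitely many balls that cover the space.
\<close>

lemma mixing_preimages_dense: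
  assumes mix: "top_mixing shift B" and z: "z \<in> B" and r: "r > 0"
  obtains n where "\<And>x. x \<in> B \<Longrightarrow> \<exists>v\<in>B. (shift ^^ n) v = x \<and> seq_dist z v < r"
proof -
  \<comment> \<open>The net is at distance \<open>\<rho>\<close> from \<open>x\<close> and from the image of \<open>v\<close>, so the two are within \<open>2 * \<rho>\<close>.\<close>
  define \<rho> where "\<rho> = min \<delta> (r / 2) / 2"
  have \<rho>: "\<rho> > 0" "2 * \<rho> \<le> \<delta>" "2 * \<rho> \<le> r / 2" using \<delta>(1) r by (auto simp: \<rho>_def)
  obtain T where T: "finite T" "T \<subseteq> B" "\<And>x. x \<in> B \<Longrightarrow> \<exists>c\<in>T. seq_dist c x < \<rho>"
    using seq_finite_net[OF compact_alphabet compact_B \<rho>(1)] by blast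
  let ?V = "B \<inter> {y. seq_dist z y < r / 2}"
  have "\<exists>N. \<forall>m\<ge>N. (shift ^^ m) -` (B \<inter> {y. seq_dist c y < \<rho>}) \<inter> ?V \<noteq> {}" if c: "c \<in> T" for c
  proof -
    have "c \<in> B \<inter> {y. seq_dist c y < \<rho>}" "z \<in> ?V" using c T z \<rho> r by auto
    then show ?thesis
      using mix[unfolded top_mixing_def, rule_format, of "B \<inter> {y. seq_dist c y < \<rho>}" ?V]
        openin_seq_ball[of c \<rho>] openin_seq_ball[of z "r / 2"] by blast
  qed
  then obtain N where N: "\<And>c m. c \<in> T \<Longrightarrow> m \<ge> N c \<Longrightarrow> (shift ^^ m) -` (B \<inter> {y. seq_dist c y < \<rho>}) \<inter> ?V \<noteq> {}"
    by metis
  define n where "n = Max (insert 0 (N ` T))"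
  have "\<exists>v\<in>B. (shift ^^ n) v = x \<and> seq_dist z v < r" if x: "x \<in> B" for x
  proof -
    obtain c where c: "c \<in> T" "seq_dist c x < \<rho>" using T(3)[OF x] by blast
    have "N c \<le> n" unfolding n_def using T(1) c(1) by (intro Max_ge) auto
    from N[OF c(1) this] obtain v where v: "v \<in> B" "seq_dist z v < r / 2" "seq_dist c ((shift ^^ n) v) < \<rho>" by auto
    have lt: "seq_dist ((shift ^^ n) v) x < 2 * \<rho>"
      using d_triangle[of "(shift ^^ n) v" x c] c v seq_dist_commute[of c "(shift ^^ n) v"] by simp
    then obtain v' where "v' \<in> B" "(shift ^^ n) v' = x" "seq_dist v v' \<le> seq_dist ((shift ^^ n) v) x"
      using shadow_preimage[OF v(1) x, of n] \<rho>(2) by auto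
    moreover from this have "seq_dist z v' < r"
      using d_triangle[of z v' v] v \<rho> lt by simp
    ultimately show ?thesis by blast
  qed
  then show ?thesis using that by blast
qed

lemma positive_near:
  assumes "continuous_on B g" "z \<in> B" "0 < (g z :: real)"
  obtains r where "r > 0" "\<And>v. v \<in> B \<Longrightarrow> seq_dist z v < r \<Longrightarrow> 0 < g v"
proof -
  obtain r where r: "r > 0" "\<And>x y. x \<in> B \<Longrightarrow> y \<in> B \<Longrightarrow> seq_dist x y < r \<Longrightarrow> dist (g x) (g y) < g z"
    using uniformly_continuous_B[OF assms(1,3)] by blast
  have "0 < g v" if "v \<in> B" "seq_dist z v < r" for v
    using r(2)[OF assms(2) that] by (simp add: dist_real_def abs_less_iff)
  then show ?thesis by (rule that[OF r(1)])
qed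

lemma L_iterate_continuous:
  "continuous_on B \<phi> \<Longrightarrow> continuous_on B f \<Longrightarrow> continuous_on B ((L \<phi> ^^ n) f)"
  by (induction n) (simp_all add: L_continuous)

lemma L_iterate_nonneg:
  assumes "continuous_on B \<phi>" "continuous_on B f" "\<And>y. y \<in> B \<Longrightarrow> 0 \<le> (f y :: real)" "x \<in> B"
  shows "0 \<le> (L \<phi> ^^ n) f x"
  using assms(4)
proof (induction n arbitrary: x)
  case (Suc n)
  then show ?case using L_nonneg[OF assms(1) L_iterate_continuous[OF assms(1,2)]] by simp
qed (simp add: assms)

lemma mixing_primitive:
  assumes mix: "top_mixing shift B" and \<phi>: "continuous_on B \<phi>"
    and g: "continuous_on B g" "\<And>y. y \<in> B \<Longrightarrow> 0 \<le> (g y :: real)" and z: "z \<in> B" "0 < g z"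
  obtains n where "\<And>x. x \<in> B \<Longrightarrow> 0 < (L \<phi> ^^ n) g x"
proof -
  obtain r where r: "r > 0" "\<And>v. v \<in> B \<Longrightarrow> seq_dist z v < r \<Longrightarrow> 0 < g v"
    using positive_near[OF g(1) z] by blast
  obtain n where n: "\<And>x. x \<in> B \<Longrightarrow> \<exists>v\<in>B. (shift ^^ n) v = x \<and> seq_dist z v < r"
    using mixing_preimages_dense[OF mix z(1) r(1)] by blast
  have *: "0 < (L \<phi> ^^ k) g ((shift ^^ k) v)" if "v \<in> B" "0 < g v" for k v
  proof (induction k)
    case (Suc k)
    have "0 < L \<phi> ((L \<phi> ^^ k) g) (shift ((shift ^^ k) v))"
      by (rule L_pos[OF \<phi>]) (use Suc g \<phi> that iterate_shift_in L_iterate_continuous L_iterate_nonneg in auto)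
    then show ?case by simp
  qed (use that in simp)
  show ?thesis
  proof (rule that)
    fix x assume "x \<in> B"
    then obtain v where "v \<in> B" "(shift ^^ n) v = x" "seq_dist z v < r" using n by blast
    then show "0 < (L \<phi> ^^ n) g x" using *[of v n] r(2) by auto
  qed
qed

text \<open>
  Staying put with weight 1/2 makes the positivity set of the iterates of a nonnegative function
  grow with the number of steps, so that a possible periodicity of \<open>L\<close> does no harm.
\<close>

definition lazy :: "((nat \<Rightarrow> 'a) \<Rightarrow> real) \<Rightarrow> ((nat \<Rightarrow> 'a) \<Rightarrow> real) \<Rightarrow> (nat \<Rightarrow> 'a) \<Rightarrow> real" where
  "lazy \<phi> f x = (f x + L \<phi> f x) / 2"

lemma lazy_Suc: "(lazy \<phi> ^^ Suc n) f x = ((lazy \<phi> ^^ n) f x + L \<phi> ((lazy \<phi> ^^ n) f) x) / 2"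
  by (simp add: lazy_def[of _ "(lazy \<phi> ^^ n) f"])

lemma lazy_continuous:
  "continuous_on B \<phi> \<Longrightarrow> continuous_on B f \<Longrightarrow> continuous_on B (lazy \<phi> f)"
  unfolding lazy_def by (intro continuous_on_divide continuous_on_add continuous_on_const L_continuous) auto

lemma lazy_iterate_continuous:
  "continuous_on B \<phi> \<Longrightarrow> continuous_on B f \<Longrightarrow> continuous_on B ((lazy \<phi> ^^ n) f)"
  by (induction n) (simp_all add: lazy_continuous)

lemma lazy_iterate_nonneg:
  assumes "continuous_on B \<phi>" "continuous_on B f" "\<And>y. y \<in> B \<Longrightarrow> 0 \<le> f y" "x \<in> B"
  shows "0 \<le> (lazy \<phi> ^^ n) f x"
  using assms(4)
proof (induction n arbitrary: x)
  case (Suc n)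
  then show ?case
    using L_nonneg[OF assms(1) lazy_iterate_continuous[OF assms(1,2)] Suc.prems, of n] Suc.IH
    by (simp add: lazy_Suc del: funpow.simps)
qed (simp add: assms)

text \<open>
  The positivity sets of the lazy iterates are open and increasing, and they cover the space because
  the preimages of every point come arbitrarily close to \<open>z\<close>. By compactness one of them is everything.
\<close>

lemma lazy_primitive:
  assumes \<phi>: "continuous_on B \<phi>"
    and g: "continuous_on B g" "\<And>y. y \<in> B \<Longrightarrow> 0 \<le> g y" and z: "z \<in> B" "0 < g z"
  obtains n where "\<And>x. x \<in> B \<Longrightarrow> 0 < (lazy \<phi> ^^ n) g x"
proof -
  obtain r where r: "r > 0" "\<And>v. v \<in> B \<Longrightarrow> seq_dist z v < r \<Longrightarrow> 0 < g v"
    using positive_near[OF g(1) z] by blast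
  note c = lazy_iterate_continuous[OF \<phi> g(1)]
  have nn: "0 \<le> (lazy \<phi> ^^ n) g x" if "x \<in> B" for n x
    by (rule lazy_iterate_nonneg[OF \<phi> g that])
  have step: "0 < (lazy \<phi> ^^ Suc n) g x" if "x \<in> B" "0 < (lazy \<phi> ^^ n) g x" for n x
    using that L_nonneg[OF \<phi> c that(1) nn, of n] by (simp add: lazy_Suc del: funpow.simps)
  have grow: "0 < (lazy \<phi> ^^ m) g x" if "x \<in> B" "0 < (lazy \<phi> ^^ n) g x" "n \<le> m" for n m x
    using that(3) by (induction m rule: dec_induct) (use that(1,2) step in auto)
  have orbit: "0 < (lazy \<phi> ^^ k) g ((shift ^^ k) v)" if "v \<in> B" "0 < g v" for k v
  proof (induction k)
    case (Suc k)
    have "0 < L \<phi> ((lazy \<phi> ^^ k) g) (shift ((shift ^^ k) v))"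
      by (rule L_pos[OF \<phi> c nn]) (use Suc that iterate_shift_in in auto)
    moreover have "0 \<le> (lazy \<phi> ^^ k) g (shift ((shift ^^ k) v))"
      by (rule nn) (use that iterate_shift_in shift_in in auto)
    ultimately show ?case unfolding lazy_Suc by simp
  qed (use that in simp)
  have ex: "\<exists>n. 0 < (lazy \<phi> ^^ n) g x" if x: "x \<in> B" for x
  proof -
    obtain n v where "v \<in> B" "(shift ^^ n) v = x" "seq_dist z v < r"
      by (rule preimages_dense[OF x z(1) r(1)])
    then show ?thesis using orbit[of v n] r(2) by auto
  qed
  have "openin (top_of_set B) (B \<inter> (lazy \<phi> ^^ n) g -` {0<..})" for n
    by (rule continuous_openin_preimage_gen[OF c]) simp
  then obtain W where W: "\<And>n. open (W n)" "\<And>n. B \<inter> (lazy \<phi> ^^ n) g -` {0<..} = B \<inter> W n"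
    unfolding openin_open by metis
  have "B \<subseteq> (\<Union>n\<in>UNIV. W n)"
  proof
    fix x assume x: "x \<in> B"
    then obtain n where "0 < (lazy \<phi> ^^ n) g x" using ex by blast
    then have "x \<in> B \<inter> W n" using x unfolding W(2)[symmetric] by simp
    then show "x \<in> (\<Union>n\<in>UNIV. W n)" by blast
  qed
  then obtain T where T: "finite T" "B \<subseteq> (\<Union>n\<in>T. W n)"
    using compactE_image[OF compact_B, of UNIV W] W(1) by metis
  show ?thesis
  proof (rule that[of "Max (insert 0 T)"])
    fix x assume x: "x \<in> B"
    then obtain n where n: "n \<in> T" "x \<in> B \<inter> W n" using T(2) by blast
    then have "0 < (lazy \<phi> ^^ n) g x" unfolding W(2)[symmetric] by simp
    moreover have "n \<le> Max (insert 0 T)" using T(1) n by (intro Max_ge) auto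
    ultimately show "0 < (lazy \<phi> ^^ Max (insert 0 T)) g x" using grow[OF x] by blast
  qed
qed

text \<open>
  The weight is bounded, so that dominated convergence applies.
\<close>

lemma L_tendsto:
  fixes h :: "nat \<Rightarrow> (nat \<Rightarrow> 'a) \<Rightarrow> 'b::{banach, second_countable_topology}"
  assumes \<phi>: "continuous_on B \<phi>" and h: "\<And>n. continuous_on B (h n)" and f: "continuous_on B f"
    and lim: "\<And>y. y \<in> B \<Longrightarrow> (\<lambda>n. h n y) \<longlonglongrightarrow> f y"
    and b: "\<And>n y. y \<in> B \<Longrightarrow> norm (h n y) \<le> b" and x: "x \<in> B"
  shows "(\<lambda>n. L \<phi> (h n) x) \<longlonglongrightarrow> L \<phi> f x"
proof -
  obtain c where c: "c > 0" "\<And>y. y \<in> B \<Longrightarrow> norm (\<phi> y) \<le> c" using bounded_B[OF \<phi>] by blast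
  have "0 \<le> b" using b[OF x] norm_ge_zero order_trans by blast
  show ?thesis
    unfolding L_eq[OF x] set_lebesgue_integral_def
  proof (rule integral_dominated_convergence[of _ _ _ "\<lambda>_. exp c * b"])
    show "(\<lambda>a. indicat_real (preds x) a *\<^sub>R exp (\<phi> (case_nat a x)) *\<^sub>R f (case_nat a x)) \<in> borel_measurable \<nu>"
      using L_integrable[OF \<phi> f x] unfolding set_integrable_def by (rule borel_measurable_integrable)
    show "(\<lambda>a. indicat_real (preds x) a *\<^sub>R exp (\<phi> (case_nat a x)) *\<^sub>R h n (case_nat a x)) \<in> borel_measurable \<nu>" for n
      using L_integrable[OF \<phi> h x] unfolding set_integrable_def by (rule borel_measurable_integrable)
    have "(\<lambda>n. indicat_real (preds x) a *\<^sub>R exp (\<phi> (case_nat a x)) *\<^sub>R h n (case_nat a x))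
        \<longlonglongrightarrow> indicat_real (preds x) a *\<^sub>R exp (\<phi> (case_nat a x)) *\<^sub>R f (case_nat a x)" for a
    proof (cases "a \<in> preds x")
      case True
      show ?thesis by (intro tendsto_intros lim cons_in x True)
    qed simp
    then show "AE a in \<nu>. (\<lambda>n. indicat_real (preds x) a *\<^sub>R exp (\<phi> (case_nat a x)) *\<^sub>R h n (case_nat a x))
        \<longlonglongrightarrow> indicat_real (preds x) a *\<^sub>R exp (\<phi> (case_nat a x)) *\<^sub>R f (case_nat a x)" by simp
    have "norm (indicat_real (preds x) a *\<^sub>R exp (\<phi> (case_nat a x)) *\<^sub>R h n (case_nat a x)) \<le> exp c * b" for a n
    proof (cases "a \<in> preds x")
      case True
      have "norm (\<phi> (case_nat a x)) \<le> c" "norm (h n (case_nat a x)) \<le> b"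
        using c(2) b cons_in[OF x True] by auto
      then have "exp (\<phi> (case_nat a x)) * norm (h n (case_nat a x)) \<le> exp c * b"
        by (intro mult_mono) auto
      then show ?thesis using True by simp
    qed (use \<open>0 \<le> b\<close> in simp)
    then show "\<And>n. AE a in \<nu>. norm (indicat_real (preds x) a *\<^sub>R exp (\<phi> (case_nat a x)) *\<^sub>R h n (case_nat a x)) \<le> exp c * b"
      by simp
  qed simp
qed

end

section \<open>A positive eigenfunction\<close>

lemma exp_minus_one_le: "exp t - 1 \<le> t * exp (t::real)"
proof -
  have "(1 - t) * exp t \<le> exp (- t) * exp t"
    using exp_ge_add_one_self[of "- t"] by (intro mult_right_mono) auto
  then show ?thesis by (simp add: exp_minus algebra_simps)
qed

locale holder_potential = symbolic_system A I \<nu>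
  for A :: "'a::metric_space \<times> 'a \<Rightarrow> real" and I :: "real set" and \<nu> :: "'a measure" +
  fixes \<alpha> :: real and \<phi> :: "(nat \<Rightarrow> 'a) \<Rightarrow> real"
  assumes \<alpha>: "\<alpha> > 0" and \<phi>_holder: "\<phi> \<in> holder_space \<alpha> B"
begin

definition hol :: real where
  "hol = (SOME H. H \<ge> 0 \<and> (\<forall>x\<in>B. \<forall>y\<in>B. \<bar>\<phi> x - \<phi> y\<bar> \<le> H * seq_dist x y powr \<alpha>))"

lemma hol: "hol \<ge> 0" "\<And>x y. x \<in> B \<Longrightarrow> y \<in> B \<Longrightarrow> \<bar>\<phi> x - \<phi> y\<bar> \<le> hol * seq_dist x y powr \<alpha>"
proof -
  obtain H where "\<And>x y. x \<in> B \<Longrightarrow> y \<in> B \<Longrightarrow> \<bar>\<phi> x - \<phi> y\<bar> \<le> H * seq_dist x y powr \<alpha>"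
    using \<phi>_holder unfolding holder_space_def by auto
  moreover have "H * seq_dist x y powr \<alpha> \<le> \<bar>H\<bar> * seq_dist x y powr \<alpha>" for x y
    by (intro mult_right_mono) auto
  ultimately have "\<bar>\<phi> x - \<phi> y\<bar> \<le> \<bar>H\<bar> * seq_dist x y powr \<alpha>" if "x \<in> B" "y \<in> B" for x y
    using that order_trans by blast
  then have "\<exists>H\<ge>0. (\<forall>x\<in>B. \<forall>y\<in>B. \<bar>\<phi> x - \<phi> y\<bar> \<le> H * seq_dist x y powr \<alpha>)"
    by (intro exI[of _ "\<bar>H\<bar>"]) auto
  from someI_ex[OF this]
  show "hol \<ge> 0" "\<And>x y. x \<in> B \<Longrightarrow> y \<in> B \<Longrightarrow> \<bar>\<phi> x - \<phi> y\<bar> \<le> hol * seq_dist x y powr \<alpha>"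
    unfolding hol_def[symmetric] by blast+
qed

lemma \<phi>: "continuous_on B \<phi>"
  by (rule holder_continuous_on[OF compact_alphabet \<alpha> zero_less_one, of _ _ hol]) (use hol(2) in auto)

definition q :: real where "q = (1/2) powr \<alpha>"

lemma q: "0 < q" "q < 1" "\<And>t. t \<ge> 0 \<Longrightarrow> (t / 2) powr \<alpha> = q * t powr \<alpha>"
  using powr_half_less[OF \<alpha>] by (auto simp: q_def powr_mult[symmetric])

text \<open>
  If the logarithm of \<open>g\<close> has local Hoelder constant \<open>K\<close>, then that of \<open>L g\<close> has local Hoelder
  constant \<open>q * (hol + K)\<close>: the weight contributes \<open>hol\<close>, and distances are halved. This \<open>K\<close> is the
  value that reproduces itself.
\<close>

definition K :: real where "K = q * hol / (1 - q)"

lemma K: "0 \<le> K" "q * (hol + K) = K"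
  using q hol(1) by (auto simp: K_def field_simps)

text \<open>
  The functions whose logarithm has local Hoelder constant \<open>K\<close>, in a multiplicative form that also
  admits zeros, survives pointwise limits and is visibly stable under sums.
\<close>

definition cone :: "((nat \<Rightarrow> 'a) \<Rightarrow> real) \<Rightarrow> bool" where
  "cone g \<longleftrightarrow> (\<forall>x\<in>B. 0 \<le> g x) \<and>
     (\<forall>x\<in>B. \<forall>y\<in>B. seq_dist x y < \<delta> \<longrightarrow> g x \<le> exp (K * seq_dist x y powr \<alpha>) * g y)"

definition net :: "(nat \<Rightarrow> 'a) set" where
  "net = (SOME T. finite T \<and> T \<subseteq> B \<and> (\<forall>x\<in>B. \<exists>c\<in>T. seq_dist c x < \<delta>))"

lemma net: "finite net" "net \<subseteq> B" "\<And>x. x \<in> B \<Longrightarrow> \<exists>c\<in>net. seq_dist c x < \<delta>" "net \<noteq> {}"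
proof -
  obtain T where "finite T" "T \<subseteq> B" "\<And>x. x \<in> B \<Longrightarrow> \<exists>c\<in>T. seq_dist c x < \<delta>"
    using seq_finite_net[OF compact_alphabet compact_B \<delta>(1)] by blast
  then have "\<exists>T. finite T \<and> T \<subseteq> B \<and> (\<forall>x\<in>B. \<exists>c\<in>T. seq_dist c x < \<delta>)" by auto
  from someI_ex[OF this] have *: "finite net \<and> net \<subseteq> B \<and> (\<forall>x\<in>B. \<exists>c\<in>net. seq_dist c x < \<delta>)"
    unfolding net_def[symmetric] .
  then show "finite net" "net \<subseteq> B" "\<And>x. x \<in> B \<Longrightarrow> \<exists>c\<in>net. seq_dist c x < \<delta>" by blast+
  then show "net \<noteq> {}" using nonempty by blast
qed

text \<open>
  A normalization that is linear and passes to pointwise limits, but still controls the supremum of a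
  function in the cone.
\<close>

definition mass :: "((nat \<Rightarrow> 'a) \<Rightarrow> real) \<Rightarrow> real" where "mass g = (\<Sum>c\<in>net. g c)"

text \<open>
  The largest factor by which a function in the cone can vary within distance \<open>\<delta>\<close>.
\<close>

definition dil :: real where "dil = exp (K * \<delta> powr \<alpha>)"

lemma dil: "dil \<ge> 1"
  using K by (simp add: dil_def)

lemma exp_le_dil: "seq_dist x (y :: nat \<Rightarrow> 'a) < \<delta> \<Longrightarrow> exp (K * seq_dist x y powr \<alpha>) \<le> dil"
  unfolding dil_def using K(1) \<alpha> d_nonneg[of x y] by (simp add: mult_left_mono powr_mono2)

lemma cone_nonneg: "cone g \<Longrightarrow> x \<in> B \<Longrightarrow> 0 \<le> g x"
  by (simp add: cone_def)

lemma coneD: "cone g \<Longrightarrow> x \<in> B \<Longrightarrow> y \<in> B \<Longrightarrow> seq_dist x y < \<delta> \<Longrightarrow> g x \<le> exp (K * seq_dist x y powr \<alpha>) * g y"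
  by (simp add: cone_def)

lemma cone_le_mass:
  assumes g: "cone g" and x: "x \<in> B"
  shows "g x \<le> dil * mass g"
proof -
  obtain c where c: "c \<in> net" "seq_dist c x < \<delta>" using net(3)[OF x] by blast
  then have cB: "c \<in> B" using net(2) by blast
  have "g x \<le> exp (K * seq_dist x c powr \<alpha>) * g c"
    using coneD[OF g x cB] c(2) by (simp add: seq_dist_commute)
  also have "\<dots> \<le> dil * mass g"
  proof (rule mult_mono)
    show "exp (K * seq_dist x c powr \<alpha>) \<le> dil" using exp_le_dil c(2) by (simp add: seq_dist_commute)
    show "g c \<le> mass g" unfolding mass_def
      by (rule member_le_sum) (use c net cone_nonneg[OF g] in auto)
  qed (use dil cone_nonneg[OF g cB] in auto)
  finally show ?thesis .
qed

lemma mass_nonneg: "cone g \<Longrightarrow> 0 \<le> mass g"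
  unfolding mass_def by (intro sum_nonneg cone_nonneg) (use net(2) in auto)

lemma cone_holder:
  assumes g: "cone g" and xy: "x \<in> B" "y \<in> B" "seq_dist x y < \<delta>"
  shows "\<bar>g x - g y\<bar> \<le> K * dil * (dil * mass g) * seq_dist x y powr \<alpha>"
proof -
  have *: "g u - g v \<le> K * dil * (dil * mass g) * seq_dist u v powr \<alpha>"
    if uv: "u \<in> B" "v \<in> B" "seq_dist u v < \<delta>" for u v
  proof -
    let ?t = "K * seq_dist u v powr \<alpha>"
    have "g u - g v \<le> (exp ?t - 1) * g v" using coneD[OF g uv] by (simp add: algebra_simps)
    also have "\<dots> \<le> (?t * dil) * (dil * mass g)"
    proof (rule mult_mono)
      have "exp ?t - 1 \<le> ?t * exp ?t" by (rule exp_minus_one_le)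
      also have "\<dots> \<le> ?t * dil" using exp_le_dil[OF uv(3)] K(1) by (intro mult_left_mono) auto
      finally show "exp ?t - 1 \<le> ?t * dil" .
    qed (use cone_le_mass[OF g] cone_nonneg[OF g] uv K dil in auto)
    finally show ?thesis by (simp add: mult_ac)
  qed
  show ?thesis using *[OF xy] *[OF xy(2,1)] xy(3) by (simp add: seq_dist_commute abs_le_iff)
qed

lemma cone_continuous: "cone g \<Longrightarrow> continuous_on B g"
  by (rule holder_continuous_on[OF compact_alphabet \<alpha> \<delta>(1)]) (use cone_holder in auto)

lemma cone_L:
  assumes g: "cone g"
  shows "cone (L \<phi> g)"
  unfolding cone_def
proof (intro conjI ballI impI)
  note c = cone_continuous[OF g]
  fix x assume x: "x \<in> B"
  show "0 \<le> L \<phi> g x" by (rule L_nonneg[OF \<phi> c x cone_nonneg[OF g]])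
  fix y assume y: "y \<in> B" and d: "seq_dist x y < \<delta>"
  have p: "preds x = preds y" by (rule \<delta>(2)[OF x y d])
  let ?e = "exp (K * seq_dist x y powr \<alpha>)"
  let ?F = "\<lambda>x a. exp (\<phi> (case_nat a x)) *\<^sub>R g (case_nat a x)"
  have "(LINT a:preds x|\<nu>. ?F x a) \<le> (LINT a:preds x|\<nu>. ?e * ?F y a)"
  proof (rule set_integral_mono[OF L_integrable[OF \<phi> c x]])
    show "set_integrable \<nu> (preds x) (\<lambda>a. ?e * ?F y a)"
      unfolding p by (intro set_integrable_mult_right L_integrable[OF \<phi> c y])
    fix a assume a: "a \<in> preds x"
    let ?u = "case_nat a x" and ?v = "case_nat a y"
    have u: "?u \<in> B" "?v \<in> B" using cons_in a x y p by auto
    have d2: "seq_dist ?u ?v = seq_dist x y / 2" by (rule d_cons)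
    then have d3: "seq_dist ?u ?v < \<delta>" using d d_nonneg[of x y] by simp
    have dq: "seq_dist ?u ?v powr \<alpha> = q * seq_dist x y powr \<alpha>" unfolding d2 by (rule q(3)[OF d_nonneg])
    have "exp (\<phi> ?u) \<le> exp (hol * seq_dist ?u ?v powr \<alpha> + \<phi> ?v)" using hol(2)[OF u] by simp
    then have "exp (\<phi> ?u) * g ?u \<le> exp (hol * seq_dist ?u ?v powr \<alpha> + \<phi> ?v) * (exp (K * seq_dist ?u ?v powr \<alpha>) * g ?v)"
      using coneD[OF g u d3] cone_nonneg[OF g u(1)] by (intro mult_mono) auto
    also have "\<dots> = exp ((q * (hol + K)) * seq_dist x y powr \<alpha>) * (exp (\<phi> ?v) * g ?v)"
      unfolding dq by (simp add: exp_add[symmetric] algebra_simps)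
    finally show "?F x a \<le> ?e * ?F y a" unfolding K(2) by simp
  qed
  then show "L \<phi> g x \<le> ?e * L \<phi> g y"
    unfolding L_eq[OF x] L_eq[OF y] set_integral_mult_right p .
qed

lemma cone_lazy:
  assumes "cone g" shows "cone (lazy \<phi> g)"
  unfolding cone_def lazy_def
proof (intro conjI ballI impI)
  fix x assume x: "x \<in> B"
  show "0 \<le> (g x + L \<phi> g x) / 2" using cone_nonneg[OF assms x] cone_nonneg[OF cone_L[OF assms] x] by simp
  fix y assume "y \<in> B" "seq_dist x y < \<delta>"
  from coneD[OF assms x this] coneD[OF cone_L[OF assms] x this]
  show "(g x + L \<phi> g x) / 2 \<le> exp (K * seq_dist x y powr \<alpha>) * ((g y + L \<phi> g y) / 2)"
    by (simp add: algebra_simps)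
qed

lemma cone_lazy_iterate: "cone g \<Longrightarrow> cone ((lazy \<phi> ^^ n) g)"
  by (induction n) (simp_all add: cone_lazy)

lemma cone_scale: "cone g \<Longrightarrow> c \<ge> 0 \<Longrightarrow> cone (\<lambda>x. c * g x)"
  unfolding cone_def by (metis mult.left_commute mult_left_mono mult_nonneg_nonneg)

lemma mass_scale: "mass (\<lambda>x. c * g x) = c * mass g"
  by (simp add: mass_def sum_distrib_left)

text \<open>
  \<open>L\<close> commutes with its lazy version, hence so does the map that sends \<open>f\<close> to \<open>L f - l * f\<close>.
\<close>

lemma lazy_defect:
  assumes f: "continuous_on B f" and x: "x \<in> B"
  shows "(lazy \<phi> ^^ n) (\<lambda>x. L \<phi> f x - l * f x) x = L \<phi> ((lazy \<phi> ^^ n) f) x - l * (lazy \<phi> ^^ n) f x"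
  using x
proof (induction n arbitrary: x)
  case (Suc n)
  define G where "G = (lazy \<phi> ^^ n) f"
  have G: "continuous_on B G" unfolding G_def by (rule lazy_iterate_continuous[OF \<phi> f])
  note LG = L_continuous[OF \<phi> G]
  have 1: "L \<phi> ((lazy \<phi> ^^ n) (\<lambda>x. L \<phi> f x - l * f x)) = L \<phi> (\<lambda>y. L \<phi> G y - l * G y)"
    by (rule L_cong) (use Suc.IH in \<open>simp add: G_def\<close>)
  have 2: "(lazy \<phi> ^^ Suc n) f = (\<lambda>y. (1/2) * (G y + L \<phi> G y))"
    by (rule ext) (simp add: lazy_Suc G_def del: funpow.simps)
  have 3: "L \<phi> (\<lambda>y. L \<phi> G y - l * G y) x = L \<phi> (L \<phi> G) x - l * L \<phi> G x"
    by (subst L_diff[OF \<phi> LG _ Suc.prems]) (auto simp: L_mult intro!: continuous_intros G)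
  have 4: "L \<phi> (\<lambda>y. (1/2) * (G y + L \<phi> G y)) x = (1/2) * (L \<phi> G x + L \<phi> (L \<phi> G) x)"
    by (simp only: L_mult L_add[OF \<phi> G LG Suc.prems])
  show ?case
    unfolding lazy_Suc 1 2 3 4 using Suc.IH[OF Suc.prems] by (simp add: G_def field_simps)
qed simp

text \<open>
  The Collatz-Wielandt argument. Among the functions of mass 1 in the cone, the largest \<open>l\<close> with
  \<open>l * g \<le> L g\<close> is attained at some \<open>f\<close>, by compactness. Were the defect \<open>L f - l * f\<close> not zero, it
  would become strictly positive under a lazy iterate, and the corresponding iterate of \<open>f\<close> would
  allow a larger constant.
\<close>

theorem eigenfunction:
  obtains l f where "l > 0" "cone f" "\<And>x. x \<in> B \<Longrightarrow> 0 < f x" "\<And>x. x \<in> B \<Longrightarrow> L \<phi> f x = l * f x"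
proof -
  \<comment> \<open>The eigenvalue will be the largest \<open>c\<close> for which some normalized \<open>g\<close> in the cone has \<open>c * g \<le> L g\<close>.\<close>
  define P where "P c g \<longleftrightarrow> cone g \<and> mass g = 1 \<and> (\<forall>x\<in>B. c * g x \<le> L \<phi> g x)" for c g
  define S where "S = {c. \<exists>g. P c g}"
  have c1: "continuous_on B (\<lambda>_. 1 :: real)" by simp
  note L1c = L_continuous[OF \<phi> c1]
  have "0 < L \<phi> (\<lambda>_. 1 :: real) x" if x: "x \<in> B" for x
  proof -
    obtain y where "y \<in> B" "x = shift y" using x shift_onto by blast
    then show ?thesis using L_pos[OF \<phi> c1, of y] by simp
  qed
  moreover obtain z where z: "z \<in> B" "\<And>x. x \<in> B \<Longrightarrow> L \<phi> (\<lambda>_. 1 :: real) z \<le> L \<phi> (\<lambda>_. 1) x"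
    using continuous_attains_inf[OF compact_B nonempty L1c] by blast
  ultimately obtain m where m: "m > 0" "\<And>x. x \<in> B \<Longrightarrow> m \<le> L \<phi> (\<lambda>_. 1 :: real) x" by blast
  obtain b where b: "b > 0" "\<And>x. x \<in> B \<Longrightarrow> norm (L \<phi> (\<lambda>_. 1 :: real) x) \<le> b"
    using bounded_B[OF L1c] by blast
  have cardnet: "card net > 0" using net(1,4) by (simp add: card_gt_0_iff)
  have "P m (\<lambda>_. 1 / card net)"
    unfolding P_def
  proof (intro conjI ballI)
    show "cone (\<lambda>_. 1 / card net)"
      unfolding cone_def using K(1) cardnet by (simp add: divide_right_mono)
    show "mass (\<lambda>_. 1 / card net) = 1" unfolding mass_def using cardnet by simp
    fix x assume "x \<in> B"
    then show "m * (1 / card net) \<le> L \<phi> (\<lambda>_. 1 / card net) x"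
      using m(2) cardnet L_mult[of \<phi> "1 / card net" "\<lambda>_. 1" x] by (simp add: divide_right_mono)
  qed
  then have mS: "m \<in> S" unfolding S_def by blast
  have bdd: "c \<le> card net * (b * dil)" if "c \<in> S" for c
  proof -
    obtain g where g: "cone g" "mass g = 1" "\<And>x. x \<in> B \<Longrightarrow> c * g x \<le> L \<phi> g x"
      using \<open>c \<in> S\<close> unfolding S_def P_def by blast
    have "L \<phi> g x \<le> b * dil" if x: "x \<in> B" for x
    proof -
      have "L \<phi> g x \<le> L \<phi> (\<lambda>_. dil * 1) x"
        by (rule L_mono[OF \<phi> cone_continuous[OF g(1)] _ x]) (use cone_le_mass[OF g(1)] g(2) in auto)
      also have "\<dots> = dil * L \<phi> (\<lambda>_. 1) x" by (rule L_mult)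
      also have "\<dots> \<le> dil * b" using b(2)[OF x] dil by (intro mult_left_mono) auto
      finally show ?thesis by (simp add: mult.commute)
    qed
    then have "(\<Sum>t\<in>net. c * g t) \<le> (\<Sum>t\<in>net. b * dil)"
      using g(3) net(2) by (intro sum_mono) (meson order_trans subsetD)
    then show ?thesis using g(2) by (simp add: mass_def sum_distrib_left[symmetric])
  qed
  define l where "l = Sup S"
  have bS: "bdd_above S" using bdd by (meson bdd_above.I)
  have l: "c \<le> l" if "c \<in> S" for c unfolding l_def by (rule cSup_upper[OF that bS])
  have "l > 0" using l[OF mS] m(1) by linarith
  have "\<exists>c g. l - 1 / real (Suc n) < c \<and> P c g" for n
  proof -
    have "l - 1 / real (Suc n) < l" by simp
    then obtain c where "c \<in> S" "l - 1 / real (Suc n) < c"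
      unfolding l_def using less_cSup_iff[of S] mS bS by blast
    then show ?thesis unfolding S_def by blast
  qed
  then obtain c g where cg: "\<And>n. l - 1 / real (Suc n) < c n" "\<And>n. P (c n) (g n)" by metis
  have g: "cone (g n)" "mass (g n) = 1" "\<And>x. x \<in> B \<Longrightarrow> c n * g n x \<le> L \<phi> (g n) x" for n
    using cg(2) unfolding P_def by auto
  have gb: "norm (g n x) \<le> dil" if "x \<in> B" for n x
    using cone_le_mass[OF g(1) that, of n] cone_nonneg[OF g(1) that, of n] g(2) by simp
  have c_lim: "c \<longlonglongrightarrow> l"
  proof (rule tendsto_sandwich)
    show "\<forall>\<^sub>F n in sequentially. l - 1 / real (Suc n) \<le> c n" using cg(1) by (simp add: less_imp_le)
    have "c n \<le> l" for n using l cg(2) unfolding S_def by blast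
    then show "\<forall>\<^sub>F n in sequentially. c n \<le> l" by simp
    have "(\<lambda>n. l - 1 / real (Suc n)) \<longlonglongrightarrow> l - 0"
      using LIMSEQ_inverse_real_of_nat by (intro tendsto_intros) (simp add: inverse_eq_divide)
    then show "(\<lambda>n. l - 1 / real (Suc n)) \<longlonglongrightarrow> l" by simp
  qed simp
  \<comment> \<open>A subsequence converges on a countable dense set; equicontinuity in the cone extends the
    convergence to all points, and pointwise limits stay in the cone and keep mass 1.\<close>
  obtain D where D: "countable D" "D \<subseteq> B" "\<And>x e. x \<in> B \<Longrightarrow> e > 0 \<Longrightarrow> \<exists>c\<in>D. seq_dist c x < e"
    using seq_countable_dense[OF compact_alphabet compact_B] by blast
  obtain k :: "nat \<Rightarrow> nat" where k: "strict_mono k" "\<And>x. x \<in> D \<Longrightarrow> \<exists>l. (\<lambda>n. g (k n) x) \<longlonglongrightarrow> l"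
    using function_convergent_subsequence[OF D(1), of g dil] gb D(2) by blast
  define C where "C = K * dil * (dil * 1) + 1"
  have C: "C > 0" using K(1) dil by (simp add: C_def add_nonneg_pos)
  have equi: "\<bar>g n x - g n y\<bar> \<le> C * seq_dist x y powr \<alpha>" if "x \<in> B" "y \<in> B" "seq_dist x y < \<delta>" for n x y
  proof -
    have "\<bar>g n x - g n y\<bar> \<le> K * dil * (dil * 1) * seq_dist x y powr \<alpha>"
      using cone_holder[OF g(1) that, of n] g(2) by simp
    also have "\<dots> \<le> C * seq_dist x y powr \<alpha>" by (intro mult_right_mono) (auto simp: C_def)
    finally show ?thesis .
  qed
  have "convergent (\<lambda>n. g (k n) x)" if x: "x \<in> B" for x
    unfolding Cauchy_convergent_iff[symmetric]
  proof (rule CauchyI)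
    fix e :: real assume e: "e > 0"
    define r where "r = min \<delta> ((e / (3 * C)) powr (1 / \<alpha>))"
    have "r > 0" using \<delta>(1) e C by (simp add: r_def)
    then obtain y where y: "y \<in> D" "seq_dist y x < r" using D(3)[OF x] by blast
    have yB: "y \<in> B" using y D(2) by blast
    have "seq_dist y x powr \<alpha> \<le> ((e / (3 * C)) powr (1 / \<alpha>)) powr \<alpha>"
      using y \<alpha> d_nonneg by (intro powr_mono2) (auto simp: r_def)
    also have "\<dots> = e / (3 * C)" using \<alpha> e C by (simp add: powr_powr)
    finally have "C * seq_dist y x powr \<alpha> \<le> e / 3" using C by (simp add: field_simps)
    then have near: "\<bar>g n y - g n x\<bar> \<le> e / 3" for n
      using equi[OF yB x, of n] y(2) by (simp add: r_def)
    have "Cauchy (\<lambda>n. g (k n) y)" using k(2)[OF y(1)] by (auto intro: LIMSEQ_imp_Cauchy)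
    then obtain N where N: "\<And>m n. m \<ge> N \<Longrightarrow> n \<ge> N \<Longrightarrow> norm (g (k m) y - g (k n) y) < e / 3"
      using e by (metis CauchyD divide_pos_pos zero_less_numeral)
    have "norm (g (k m) x - g (k n) x) < e" if "m \<ge> N" "n \<ge> N" for m n
      using N[OF that] near[of "k m"] near[of "k n"] unfolding real_norm_def by linarith
    then show "\<exists>N. \<forall>m\<ge>N. \<forall>n\<ge>N. norm (g (k m) x - g (k n) x) < e" by blast
  qed
  then obtain f where f: "\<And>x. x \<in> B \<Longrightarrow> (\<lambda>n. g (k n) x) \<longlonglongrightarrow> f x"
    unfolding convergent_def by metis
  have fcone: "cone f"
    unfolding cone_def
  proof (intro conjI ballI impI)
    fix x assume x: "x \<in> B"
    show "0 \<le> f x" by (rule LIMSEQ_le_const[OF f[OF x]]) (use cone_nonneg[OF g(1) x] in auto)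
    fix y assume y: "y \<in> B" and d: "seq_dist x y < \<delta>"
    show "f x \<le> exp (K * seq_dist x y powr \<alpha>) * f y"
      by (rule LIMSEQ_le[OF f[OF x] tendsto_mult_left[OF f[OF y]]])
         (use coneD[OF g(1) x y d] in auto)
  qed
  note fc = cone_continuous[OF fcone]
  have fmass: "mass f = 1"
  proof -
    have "(\<lambda>n. mass (g (k n))) \<longlonglongrightarrow> mass f"
      unfolding mass_def by (intro tendsto_sum f) (use net(2) in auto)
    then show ?thesis using g(2) by (simp add: LIMSEQ_const_iff)
  qed
  have ge: "l * f x \<le> L \<phi> f x" if x: "x \<in> B" for x
  proof (rule LIMSEQ_le)
    show "(\<lambda>n. c (k n) * g (k n) x) \<longlonglongrightarrow> l * f x"
      using LIMSEQ_subseq_LIMSEQ[OF c_lim k(1)] by (intro tendsto_mult f x) (simp add: o_def)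
    show "(\<lambda>n. L \<phi> (g (k n)) x) \<longlonglongrightarrow> L \<phi> f x"
      by (rule L_tendsto[OF \<phi> cone_continuous[OF g(1)] fc f gb x])
    show "\<exists>N. \<forall>n\<ge>N. c (k n) * g (k n) x \<le> L \<phi> (g (k n)) x" using g(3)[OF x] by blast
  qed
  have eq: "L \<phi> f x = l * f x" if x: "x \<in> B" for x
  proof (rule ccontr)
    \<comment> \<open>If the defect \<open>L f - l * f\<close> is positive somewhere, then a lazy iterate of \<open>f\<close> has a defect that is
      positive everywhere, so that it admits a constant larger than \<open>l\<close>.\<close>
    assume "L \<phi> f x \<noteq> l * f x"
    then have pos: "0 < L \<phi> f x - l * f x" using ge[OF x] by simp
    have wc: "continuous_on B (\<lambda>x. L \<phi> f x - l * f x)"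
      by (intro continuous_intros L_continuous \<phi> fc)
    obtain n where n: "\<And>y. y \<in> B \<Longrightarrow> 0 < (lazy \<phi> ^^ n) (\<lambda>x. L \<phi> f x - l * f x) y"
      using lazy_primitive[OF \<phi> wc _ x pos] ge by force
    define G where "G = (lazy \<phi> ^^ n) f"
    have G: "cone G" unfolding G_def by (rule cone_lazy_iterate[OF fcone])
    have Gpos: "0 < L \<phi> G y - l * G y" if "y \<in> B" for y
      using n[OF that] lazy_defect[OF fc that] by (simp add: G_def)
    note Gc = cone_continuous[OF G]
    have "continuous_on B (\<lambda>y. L \<phi> G y - l * G y)" by (intro continuous_intros L_continuous \<phi> Gc)
    then obtain w where w: "w \<in> B" "\<And>y. y \<in> B \<Longrightarrow> L \<phi> G w - l * G w \<le> L \<phi> G y - l * G y"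
      using continuous_attains_inf[OF compact_B nonempty] by blast
    define e where "e = L \<phi> G w - l * G w"
    have e: "e > 0" "\<And>y. y \<in> B \<Longrightarrow> l * G y + e \<le> L \<phi> G y"
      using Gpos[OF w(1)] w(2) by (auto simp: e_def algebra_simps)
    have "mass G \<noteq> 0"
    proof
      assume "mass G = 0"
      then have "G y = 0" if "y \<in> B" for y
        using cone_le_mass[OF G that] cone_nonneg[OF G that] by simp
      then have "L \<phi> G = L \<phi> (\<lambda>y. 0 * 1)" by (intro L_cong) simp
      then have "L \<phi> G w = 0" using L_mult[of \<phi> 0 "\<lambda>_. 1 :: real" w] by simp
      then show False using Gpos[OF w(1)] \<open>\<And>y. y \<in> B \<Longrightarrow> G y = 0\<close>[OF w(1)] by simp
    qed
    then have M: "mass G > 0" using mass_nonneg[OF G] by simp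
    have "P (l + e / (dil * mass G)) (\<lambda>y. 1 / mass G * G y)"
      unfolding P_def
    proof (intro conjI ballI)
      show "cone (\<lambda>y. 1 / mass G * G y)" by (rule cone_scale[OF G]) (use M in simp)
      show "mass (\<lambda>y. 1 / mass G * G y) = 1" unfolding mass_scale using M by simp
      fix y assume y: "y \<in> B"
      have dm: "dil * mass G > 0" using M dil by simp
      have "e / (dil * mass G) * G y \<le> e / (dil * mass G) * (dil * mass G)"
        using cone_le_mass[OF G y] e(1) dm by (intro mult_left_mono) auto
      also have "\<dots> = e" using M dil by simp
      finally have "(l + e / (dil * mass G)) * G y \<le> L \<phi> G y" using e(2)[OF y] by (simp add: distrib_right)
      then have "1 / mass G * ((l + e / (dil * mass G)) * G y) \<le> 1 / mass G * L \<phi> G y"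
        using M by (intro mult_left_mono) auto
      then show "(l + e / (dil * mass G)) * (1 / mass G * G y) \<le> L \<phi> (\<lambda>y. 1 / mass G * G y) y"
        unfolding L_mult by (simp only: mult_ac)
    qed
    then have "l + e / (dil * mass G) \<le> l" using l unfolding S_def by blast
    moreover have "e / (dil * mass G) > 0" using e(1) M dil by simp
    ultimately show False by linarith
  qed
  have pos: "0 < f x" if x: "x \<in> B" for x
  proof -
    \<comment> \<open>The lazy iterates multiply \<open>f\<close> by a positive constant and also make it positive everywhere.\<close>
    have "\<exists>z\<in>B. 0 < f z"
    proof (rule ccontr)
      assume "\<not> (\<exists>z\<in>B. 0 < f z)"
      then have "mass f \<le> 0" unfolding mass_def by (intro sum_nonpos) (use net(2) in force)
      then show False using fmass by simp
    qed
    then obtain z where z: "z \<in> B" "0 < f z" by blast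
    obtain n where n: "\<And>x. x \<in> B \<Longrightarrow> 0 < (lazy \<phi> ^^ n) f x"
      using lazy_primitive[OF \<phi> fc cone_nonneg[OF fcone] z] by blast
    have "(lazy \<phi> ^^ n) f y = ((1 + l) / 2) ^ n * f y" if "y \<in> B" for n y
      using that
    proof (induction n arbitrary: y)
      case (Suc n)
      have "L \<phi> ((lazy \<phi> ^^ n) f) y = L \<phi> (\<lambda>y. ((1 + l) / 2) ^ n * f y) y"
        by (rule fun_cong[OF L_cong]) (rule Suc.IH)
      then show ?case
        unfolding lazy_Suc L_mult eq[OF Suc.prems] Suc.IH[OF Suc.prems] by (simp add: field_simps)
    qed simp
    then show ?thesis using n[OF x] x \<open>l > 0\<close> by (simp add: zero_less_mult_iff)
  qed
  show ?thesis by (rule that[OF \<open>l > 0\<close> fcone pos eq])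
qed

end

section \<open>Primitive Markov operators that smooth\<close>

text \<open>
  A Markov operator with two properties. Smoothing is an inequality of Lasota-Yorke type, stated for
  moduli of continuity: the variation at distance \<open>d\<close> is at most the old variation \<open>e\<close> at distance
  \<open>d / 2\<close>, plus an error governed by the oscillation \<open>t\<close>. Primitivity says that a nonzero nonnegative
  function eventually becomes strictly positive.
\<close>

locale primitive_markov = symbolic_system A I \<nu>
  for A :: "'a::metric_space \<times> 'a \<Rightarrow> real" and I :: "real set" and \<nu> :: "'a measure" +
  fixes R :: "((nat \<Rightarrow> 'a) \<Rightarrow> real) \<Rightarrow> (nat \<Rightarrow> 'a) \<Rightarrow> real" and \<alpha> C :: real
  assumes \<alpha>: "\<alpha> > 0" and C: "C \<ge> 0"
    and R_continuous: "\<And>h. continuous_on B h \<Longrightarrow> continuous_on B (R h)"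
    and R_affine: "\<And>h a b x. continuous_on B h \<Longrightarrow> x \<in> B \<Longrightarrow> R (\<lambda>y. a + b * h y) x = a + b * R h x"
    and R_add: "\<And>g h x. continuous_on B g \<Longrightarrow> continuous_on B h \<Longrightarrow> x \<in> B \<Longrightarrow>
      R (\<lambda>y. g y + h y) x = R g x + R h x"
    and R_mono: "\<And>g h x. continuous_on B g \<Longrightarrow> continuous_on B h \<Longrightarrow> x \<in> B \<Longrightarrow>
      (\<And>y. y \<in> B \<Longrightarrow> g y \<le> h y) \<Longrightarrow> R g x \<le> R h x"
    and R_smoothing: "\<And>h t e x y. continuous_on B h \<Longrightarrow> (\<And>u v. u \<in> B \<Longrightarrow> v \<in> B \<Longrightarrow> \<bar>h u - h v\<bar> \<le> t) \<Longrightarrow>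
      x \<in> B \<Longrightarrow> y \<in> B \<Longrightarrow> seq_dist x y < \<delta> \<Longrightarrow>
      (\<And>u v. u \<in> B \<Longrightarrow> v \<in> B \<Longrightarrow> seq_dist u v \<le> seq_dist x y / 2 \<Longrightarrow> \<bar>h u - h v\<bar> \<le> e) \<Longrightarrow>
      \<bar>R h x - R h y\<bar> \<le> e + C * seq_dist x y powr \<alpha> * t"
    and R_primitive: "\<And>g z. continuous_on B g \<Longrightarrow> (\<And>y. y \<in> B \<Longrightarrow> 0 \<le> g y) \<Longrightarrow> z \<in> B \<Longrightarrow> 0 < g z \<Longrightarrow>
      \<exists>n. \<forall>x\<in>B. 0 < (R ^^ n) g x"
begin

definition osc_le :: "((nat \<Rightarrow> 'a) \<Rightarrow> real) \<Rightarrow> real \<Rightarrow> bool" where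
  "osc_le h t \<longleftrightarrow> (\<forall>u\<in>B. \<forall>v\<in>B. \<bar>h u - h v\<bar> \<le> t)"

lemma osc_leD: "osc_le h t \<Longrightarrow> u \<in> B \<Longrightarrow> v \<in> B \<Longrightarrow> \<bar>h u - h v\<bar> \<le> t"
  by (simp add: osc_le_def)

lemma osc_le_nonneg: "osc_le h t \<Longrightarrow> 0 \<le> t"
  using nonempty osc_leD by (metis abs_ge_zero all_not_in_conv order_trans)

lemma osc_le_between:
  assumes "\<And>x. x \<in> B \<Longrightarrow> a \<le> h x \<and> h x \<le> b"
  shows "osc_le h (b - a)"
  unfolding osc_le_def
proof (intro ballI)
  fix u v assume "u \<in> B" "v \<in> B"
  with assms[of u] assms[of v] show "\<bar>h u - h v\<bar> \<le> b - a" by auto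
qed

lemma osc_le_minimum:
  assumes "continuous_on B h" "osc_le h t"
  obtains z where "z \<in> B" "\<And>x. x \<in> B \<Longrightarrow> h z \<le> h x \<and> h x \<le> h z + t"
proof -
  obtain z where z: "z \<in> B" "\<And>x. x \<in> B \<Longrightarrow> h z \<le> h x"
    using continuous_attains_inf[OF compact_B nonempty assms(1)] by blast
  have "h z \<le> h x \<and> h x \<le> h z + t" if "x \<in> B" for x
    using z(2)[OF that] osc_leD[OF assms(2) that z(1)] by auto
  with z(1) that show ?thesis by blast
qed

lemma R_const: "x \<in> B \<Longrightarrow> R (\<lambda>_. c) x = c"
  using R_affine[of "\<lambda>_. 0" x c 0] by simp

lemma R_between:
  assumes "continuous_on B h" "\<And>y. y \<in> B \<Longrightarrow> a \<le> h y \<and> h y \<le> b" "x \<in> B"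
  shows "a \<le> R h x \<and> R h x \<le> b"
  using R_mono[of "\<lambda>_. a" h x] R_mono[of h "\<lambda>_. b" x] assms R_const[OF assms(3)] by auto

lemma iterate_continuous: "continuous_on B h \<Longrightarrow> continuous_on B ((R ^^ n) h)"
  by (induction n) (simp_all add: R_continuous)

lemma iterate_between:
  assumes "continuous_on B h" "\<And>y. y \<in> B \<Longrightarrow> a \<le> h y \<and> h y \<le> b" "x \<in> B"
  shows "a \<le> (R ^^ n) h x \<and> (R ^^ n) h x \<le> b"
  using assms(3)
proof (induction n arbitrary: x)
  case (Suc n)
  show ?case
    using R_between[OF iterate_continuous[OF assms(1)] Suc.IH Suc.prems] by simp
qed (use assms(2) in auto)

lemma R_cong:
  assumes "continuous_on B g" "\<And>y. y \<in> B \<Longrightarrow> g y = h y" "x \<in> B"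
  shows "R g x = R h x"
proof (rule antisym)
  have h: "continuous_on B h" using assms(1,2) continuous_on_cong by blast
  show "R g x \<le> R h x" by (rule R_mono[OF assms(1) h assms(3)]) (simp add: assms(2))
  show "R h x \<le> R g x" by (rule R_mono[OF h assms(1) assms(3)]) (simp add: assms(2))
qed

lemma iterate_affine:
  assumes "continuous_on B h" "x \<in> B"
  shows "(R ^^ n) (\<lambda>y. a + b * h y) x = a + b * (R ^^ n) h x"
  using assms(2)
proof (induction n arbitrary: x)
  case (Suc n)
  have "continuous_on B (\<lambda>y. a + b * h y)" by (intro continuous_intros assms)
  then have "R ((R ^^ n) (\<lambda>y. a + b * h y)) x = R (\<lambda>y. a + b * (R ^^ n) h y) x"
    by (intro R_cong iterate_continuous Suc)
  then show ?case using R_affine[OF iterate_continuous[OF assms(1)] Suc.prems] by simp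
qed simp

lemma iterate_add:
  assumes "continuous_on B g" "continuous_on B h" "x \<in> B"
  shows "(R ^^ n) (\<lambda>y. g y + h y) x = (R ^^ n) g x + (R ^^ n) h x"
  using assms(3)
proof (induction n arbitrary: x)
  case (Suc n)
  have "continuous_on B (\<lambda>y. g y + h y)" by (intro continuous_intros assms)
  then have "R ((R ^^ n) (\<lambda>y. g y + h y)) x = R (\<lambda>y. (R ^^ n) g y + (R ^^ n) h y) x"
    by (intro R_cong iterate_continuous Suc)
  then show ?case using R_add[OF iterate_continuous[OF assms(1)] iterate_continuous[OF assms(2)] Suc.prems] by simp
qed simp

lemma iterate_mono:
  assumes "continuous_on B g" "continuous_on B h" "\<And>y. y \<in> B \<Longrightarrow> g y \<le> h y" "x \<in> B"
  shows "(R ^^ n) g x \<le> (R ^^ n) h x"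
  using assms(4)
proof (induction n arbitrary: x)
  case (Suc n)
  show ?case using R_mono[OF iterate_continuous[OF assms(1)] iterate_continuous[OF assms(2)] Suc.prems Suc.IH] by simp
qed (use assms(3) in auto)

lemma iterate_osc:
  assumes "continuous_on B h" "osc_le h t"
  shows "osc_le ((R ^^ n) h) t"
proof -
  obtain z where z: "z \<in> B" "\<And>x. x \<in> B \<Longrightarrow> h z \<le> h x \<and> h x \<le> h z + t"
    using osc_le_minimum[OF assms] by blast
  have "osc_le ((R ^^ n) h) (h z + t - h z)"
    by (rule osc_le_between) (rule iterate_between[OF assms(1) z(2)])
  then show ?thesis by simp
qed

lemma iterate_split: "n \<le> m \<Longrightarrow> (R ^^ m) h = (R ^^ (m - n)) ((R ^^ n) h)"
  by (metis funpow_add le_add_diff_inverse2 o_apply)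

lemma later_osc:
  assumes "continuous_on B h" "osc_le ((R ^^ n) h) t" "n \<le> m"
  shows "osc_le ((R ^^ m) h) t"
  using iterate_osc[OF iterate_continuous[OF assms(1)] assms(2)] by (simp add: iterate_split[OF assms(3)])

text \<open>
  By primitivity a bump around \<open>c\<close> is eventually bounded below, and a Markov operator keeps lower
  bounds.
\<close>

lemma bump_lower_bound:
  assumes "c \<in> B" "r > 0"
  obtains n \<epsilon> where "\<epsilon> > 0"
    "\<forall>m\<ge>n. \<forall>x\<in>B. \<epsilon> \<le> (R ^^ m) (\<lambda>x. max 0 (1 - seq_dist c x / r)) x"
proof -
  let ?g = "\<lambda>x. max 0 (1 - seq_dist c x / r)"
  have g: "continuous_on B ?g"
    by (intro continuous_intros continuous_on_subset[OF continuous_on_seq_dist[OF compact_alphabet]])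
       (use assms(2) in auto)
  obtain n where n: "\<forall>x\<in>B. 0 < (R ^^ n) ?g x"
    using R_primitive[OF g _ assms(1)] by auto
  obtain z where z: "z \<in> B" "\<And>x. x \<in> B \<Longrightarrow> (R ^^ n) ?g z \<le> (R ^^ n) ?g x"
    using continuous_attains_inf[OF compact_B nonempty iterate_continuous[OF g]] by blast
  have gb: "0 \<le> ?g x \<and> ?g x \<le> 1" for x using assms(2) d_nonneg[of c x] by auto
  show ?thesis
  proof (rule that)
    show "0 < (R ^^ n) ?g z" using n z(1) by blast
    show "\<forall>m\<ge>n. \<forall>x\<in>B. (R ^^ n) ?g z \<le> (R ^^ m) ?g x"
    proof (intro allI impI ballI)
      fix m x assume "m \<ge> n" and x: "x \<in> B"
      have eq: "(R ^^ m) ?g = (R ^^ (m - n)) ((R ^^ n) ?g)" by (rule iterate_split[OF \<open>m \<ge> n\<close>])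
      have "(R ^^ n) ?g z \<le> (R ^^ n) ?g y \<and> (R ^^ n) ?g y \<le> 1" if "y \<in> B" for y
        using z(2)[OF that] iterate_between[OF g gb that] by auto
      then show "(R ^^ n) ?g z \<le> (R ^^ m) ?g x"
        unfolding eq using iterate_between[OF iterate_continuous[OF g] _ x] by blast
    qed
  qed
qed

text \<open>
  Let \<open>t\<close> bound the oscillation. A function that varies by at most \<open>t / 2\<close> at distances below \<open>r\<close> stays
  within \<open>t / 2\<close> of its minimum on a ball around a minimum point \<open>z\<close>. By primitivity all points see this
  ball with weight at least \<open>\<epsilon>\<close>, uniformly over the finitely many balls of a net, so the upper bound
  \<open>h z + t\<close> drops by \<open>\<epsilon> * t / 2\<close>.
\<close>

lemma ball_contraction:
  assumes r: "r > 0"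
  obtains n \<kappa> where "0 < \<kappa>" "\<kappa> < 1"
    "\<forall>h t m. continuous_on B h \<longrightarrow> osc_le h t \<longrightarrow>
      (\<forall>u\<in>B. \<forall>v\<in>B. seq_dist u v < r \<longrightarrow> \<bar>h u - h v\<bar> \<le> t / 2) \<longrightarrow> m \<ge> n \<longrightarrow>
      osc_le ((R ^^ m) h) (\<kappa> * t)"
proof -
  obtain T where T: "finite T" "T \<subseteq> B" "\<And>x. x \<in> B \<Longrightarrow> \<exists>c\<in>T. seq_dist c x < r / 2"
    using seq_finite_net[OF compact_alphabet compact_B half_gt_zero[OF r]] by blast
  define g where "g c x = max 0 (1 - seq_dist c x / (r / 2))" for c x :: "nat \<Rightarrow> 'a"
  have "\<exists>n \<epsilon>. \<epsilon> > 0 \<and> (\<forall>m\<ge>n. \<forall>x\<in>B. \<epsilon> \<le> (R ^^ m) (g c) x)" if "c \<in> T" for c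
  proof -
    have "c \<in> B" using that T(2) by blast
    then obtain n \<epsilon> where "\<epsilon> > 0" "\<forall>m\<ge>n. \<forall>x\<in>B. \<epsilon> \<le> (R ^^ m) (g c) x"
      unfolding g_def by (rule bump_lower_bound[OF _ half_gt_zero[OF r]])
    then show ?thesis by blast
  qed
  then obtain N E where NE: "\<And>c. c \<in> T \<Longrightarrow> E c > 0"
      "\<And>c m x. c \<in> T \<Longrightarrow> m \<ge> N c \<Longrightarrow> x \<in> B \<Longrightarrow> E c \<le> (R ^^ m) (g c) x"
    by metis
  define n where "n = Max (insert 0 (N ` T))"
  define \<epsilon> where "\<epsilon> = Min (insert 1 (E ` T))"
  have \<epsilon>: "\<epsilon> > 0" "\<epsilon> \<le> 1" unfolding \<epsilon>_def using T(1) NE(1) by auto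
  have low: "\<epsilon> \<le> (R ^^ m) (g c) x" if "c \<in> T" "m \<ge> n" "x \<in> B" for c m x
  proof -
    have "\<epsilon> \<le> E c" unfolding \<epsilon>_def using T(1) that by (intro Min_le) auto
    moreover have "N c \<le> n" unfolding n_def using T(1) that by (intro Max_ge) auto
    ultimately show ?thesis using NE(2)[OF that(1) _ that(3), of m] that(2) by linarith
  qed
  show ?thesis
  proof (rule that[of "1 - \<epsilon> / 2" n])
    show "0 < 1 - \<epsilon> / 2" "1 - \<epsilon> / 2 < 1" using \<epsilon> by auto
    show "\<forall>h t m. continuous_on B h \<longrightarrow> osc_le h t \<longrightarrow>
      (\<forall>u\<in>B. \<forall>v\<in>B. seq_dist u v < r \<longrightarrow> \<bar>h u - h v\<bar> \<le> t / 2) \<longrightarrow> m \<ge> n \<longrightarrow>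
      osc_le ((R ^^ m) h) ((1 - \<epsilon> / 2) * t)"
    proof (intro allI impI)
      fix h t m
      assume h: "continuous_on B h" and t: "osc_le h t" and m: "m \<ge> n"
        and near: "\<forall>u\<in>B. \<forall>v\<in>B. seq_dist u v < r \<longrightarrow> \<bar>h u - h v\<bar> \<le> t / 2"
      have t0: "t \<ge> 0" by (rule osc_le_nonneg[OF t])
      obtain z where z: "z \<in> B" "\<And>x. x \<in> B \<Longrightarrow> h z \<le> h x \<and> h x \<le> h z + t"
        using osc_le_minimum[OF h t] by blast
      \<comment> \<open>The minimum \<open>z\<close> of \<open>h\<close> lies in the ball of a net point \<open>c\<close>, and near \<open>c\<close> the values of \<open>h\<close> exceed
        the minimum by at most \<open>t / 2\<close>; elsewhere they exceed it by at most \<open>t\<close>.\<close>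
      obtain c where c: "c \<in> T" "seq_dist c z < r / 2" using T(3)[OF z(1)] by blast
      have gc: "continuous_on B (g c)" unfolding g_def
        by (intro continuous_intros continuous_on_subset[OF continuous_on_seq_dist[OF compact_alphabet]]) (use r in auto)
      have up: "h x \<le> (h z + t) + (- t / 2) * g c x" if x: "x \<in> B" for x
      proof (cases "seq_dist c x < r / 2")
        case True
        have "seq_dist z x < r" using d_triangle[of z x c] c(2) True by (simp add: seq_dist_commute)
        then have "h x \<le> h z + t / 2" using near[rule_format, OF x z(1)] seq_dist_commute[of x z] by linarith
        moreover have "g c x \<le> 1" unfolding g_def using r d_nonneg[of c x] by simp
        then have "t / 2 * g c x \<le> t / 2 * 1" using t0 by (intro mult_left_mono) auto
        ultimately show ?thesis by simp
      next
        case False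
        then have "g c x = 0" unfolding g_def using r by simp
        then show ?thesis using z(2)[OF x] by simp
      qed
      have "osc_le ((R ^^ m) h) ((h z + (1 - \<epsilon> / 2) * t) - h z)"
      proof (rule osc_le_between)
        fix x assume x: "x \<in> B"
        have "h z \<le> (R ^^ m) h x" using iterate_between[OF h z(2) x] by blast
        moreover have "(R ^^ m) h x \<le> (R ^^ m) (\<lambda>x. (h z + t) + (- t / 2) * g c x) x"
          by (rule iterate_mono[OF h _ up x]) (intro continuous_intros gc)
        moreover have "\<dots> = (h z + t) + (- t / 2) * (R ^^ m) (g c) x" by (rule iterate_affine[OF gc x])
        moreover have "t / 2 * \<epsilon> \<le> t / 2 * (R ^^ m) (g c) x"
          using low[OF c(1) m x] t0 by (intro mult_left_mono) auto
        ultimately show "h z \<le> (R ^^ m) h x \<and> (R ^^ m) h x \<le> h z + (1 - \<epsilon> / 2) * t"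
          by (simp add: algebra_simps)
      qed
      then show "osc_le ((R ^^ m) h) ((1 - \<epsilon> / 2) * t)" by simp
    qed
  qed
qed

definition q :: real where "q = (1/2) powr \<alpha>"

lemma q: "0 < q" "q < 1" "\<And>t. t \<ge> 0 \<Longrightarrow> (t / 2) powr \<alpha> = q * t powr \<alpha>"
  using powr_half_less[OF \<alpha>] by (auto simp: q_def powr_mult[symmetric])

text \<open>
  The errors of all the smoothing steps add up to a geometric series with value \<open>D\<close>.
\<close>

definition D :: real where "D = C / (1 - q)"

lemma D: "0 \<le> D" "D * q + C = D"
  using q C by (auto simp: D_def field_simps)

lemma iterate_smoothing:
  assumes h: "continuous_on B h" and t: "osc_le h t"
    and xy: "x \<in> B" "y \<in> B" "seq_dist x y < \<delta>"
    and e: "\<And>u v. u \<in> B \<Longrightarrow> v \<in> B \<Longrightarrow> seq_dist u v \<le> seq_dist x y / 2 ^ j \<Longrightarrow> \<bar>h u - h v\<bar> \<le> e"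
  shows "\<bar>(R ^^ j) h x - (R ^^ j) h y\<bar> \<le> e + D * seq_dist x y powr \<alpha> * t"
  using xy e
proof (induction j arbitrary: x y)
  case 0
  have "0 \<le> D * seq_dist x y powr \<alpha> * t" using D(1) osc_le_nonneg[OF t] by simp
  then show ?case using 0(4)[OF 0(1,2)] by simp
next
  case (Suc j)
  let ?d = "seq_dist x y"
  have "\<bar>R ((R ^^ j) h) x - R ((R ^^ j) h) y\<bar> \<le> (e + D * (?d / 2) powr \<alpha> * t) + C * ?d powr \<alpha> * t"
  proof (rule R_smoothing[OF iterate_continuous[OF h] _ Suc.prems(1-3)])
    show "\<And>u v. u \<in> B \<Longrightarrow> v \<in> B \<Longrightarrow> \<bar>(R ^^ j) h u - (R ^^ j) h v\<bar> \<le> t"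
      by (rule osc_leD[OF iterate_osc[OF h t]])
    fix u v assume uv: "u \<in> B" "v \<in> B" "seq_dist u v \<le> ?d / 2"
    have "\<bar>(R ^^ j) h u - (R ^^ j) h v\<bar> \<le> e + D * seq_dist u v powr \<alpha> * t"
    proof (rule Suc.IH[OF uv(1,2)])
      show "seq_dist u v < \<delta>" using uv(3) Suc.prems(3) d_nonneg[of x y] by simp
      fix u' v' assume "u' \<in> B" "v' \<in> B" "seq_dist u' v' \<le> seq_dist u v / 2 ^ j"
      moreover from this have "seq_dist u' v' \<le> ?d / 2 ^ Suc j"
        using divide_right_mono[OF uv(3), of "2 ^ j"] by simp
      ultimately show "\<bar>h u' - h v'\<bar> \<le> e" using Suc.prems(4) by blast
    qed
    also have "\<dots> \<le> e + D * (?d / 2) powr \<alpha> * t"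
      using uv(3) d_nonneg \<alpha> D(1) osc_le_nonneg[OF t]
      by (intro add_left_mono mult_right_mono mult_left_mono powr_mono2) auto
    finally show "\<bar>(R ^^ j) h u - (R ^^ j) h v\<bar> \<le> e + D * (?d / 2) powr \<alpha> * t" .
  qed
  also have "\<dots> = e + (D * q + C) * ?d powr \<alpha> * t"
    unfolding q(3)[OF d_nonneg] by (simp add: algebra_simps)
  finally show ?case unfolding D(2) by simp
qed

text \<open>
  For continuous functions the number of steps depends on the modulus of continuity, but the
  contraction factor does not.
\<close>

lemma eventual_contraction:
  obtains \<kappa> where "0 < \<kappa>" "\<kappa> < 1"
    "\<forall>h t. continuous_on B h \<longrightarrow> osc_le h t \<longrightarrow> (\<exists>n. osc_le ((R ^^ n) h) (\<kappa> * t))"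
proof -
  \<comment> \<open>At distances below \<open>r\<close> the accumulated error \<open>D * d powr \<alpha> * t\<close> is at most \<open>t / 4\<close>; the other
    \<open>t / 4\<close> comes from the uniform continuity of \<open>h\<close> at scale \<open>\<delta> / 2 ^ j\<close>.\<close>
  define r where "r = min \<delta> ((1 / (4 * (D + 1))) powr (1 / \<alpha>))"
  have r: "r > 0" "r \<le> \<delta>" using \<delta>(1) D(1) by (auto simp: r_def)
  have rD: "D * s powr \<alpha> \<le> 1 / 4" if "0 \<le> s" "s < r" for s
  proof -
    have "s powr \<alpha> \<le> ((1 / (4 * (D + 1))) powr (1 / \<alpha>)) powr \<alpha>"
      using that \<alpha> by (intro powr_mono2) (auto simp: r_def)
    also have "\<dots> = 1 / (4 * (D + 1))" using \<alpha> D(1) by (simp add: powr_powr)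
    finally have "D * s powr \<alpha> \<le> D * (1 / (4 * (D + 1)))" using D(1) by (rule mult_left_mono)
    also have "\<dots> \<le> 1 / 4" using D(1) by (simp add: field_simps)
    finally show ?thesis .
  qed
  obtain N \<kappa> where \<kappa>: "0 < \<kappa>" "\<kappa> < 1" "\<forall>h t m. continuous_on B h \<longrightarrow> osc_le h t \<longrightarrow>
      (\<forall>u\<in>B. \<forall>v\<in>B. seq_dist u v < r \<longrightarrow> \<bar>h u - h v\<bar> \<le> t / 2) \<longrightarrow> m \<ge> N \<longrightarrow>
      osc_le ((R ^^ m) h) (\<kappa> * t)"
    by (rule ball_contraction[OF r(1)])
  have "\<exists>n. osc_le ((R ^^ n) h) (\<kappa> * t)" if h: "continuous_on B h" and t: "osc_le h t" for h t
  proof (cases "t = 0")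
    case True
    then show ?thesis using t by (intro exI[of _ 0]) simp
  next
    case False
    then have t0: "t > 0" using osc_le_nonneg[OF t] by simp
    have "t / 4 > 0" using t0 by simp
    from uniformly_continuous_B[OF h this] obtain \<eta> where \<eta>: "\<eta> > 0"
      "\<And>x y. x \<in> B \<Longrightarrow> y \<in> B \<Longrightarrow> seq_dist x y < \<eta> \<Longrightarrow> dist (h x) (h y) < t / 4" by blast
    have "\<exists>j. (1/2) ^ j < \<eta> / \<delta>" using \<eta>(1) \<delta>(1) by (intro real_arch_pow_inv) auto
    then obtain j where j: "(1/2) ^ j < \<eta> / \<delta>" by blast
    have "\<bar>(R ^^ j) h u - (R ^^ j) h v\<bar> \<le> t / 2" if uv: "u \<in> B" "v \<in> B" "seq_dist u v < r" for u v
    proof -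
      have "\<bar>(R ^^ j) h u - (R ^^ j) h v\<bar> \<le> t / 4 + D * seq_dist u v powr \<alpha> * t"
      proof (rule iterate_smoothing[OF h t uv(1,2)])
        show "seq_dist u v < \<delta>" using uv r by simp
        fix u' v' assume uv': "u' \<in> B" "v' \<in> B" "seq_dist u' v' \<le> seq_dist u v / 2 ^ j"
        have "seq_dist u v * (1/2) ^ j \<le> \<delta> * (1/2) ^ j"
          using uv r by (intro mult_right_mono) auto
        also have "\<dots> < \<delta> * (\<eta> / \<delta>)" using j \<delta>(1) by (rule mult_strict_left_mono)
        also have "\<dots> = \<eta>" using \<delta>(1) by simp
        finally have "seq_dist u v / 2 ^ j < \<eta>" by (simp add: power_one_over)
        then have "seq_dist u' v' < \<eta>" using uv'(3) by linarith
        then show "\<bar>h u' - h v'\<bar> \<le> t / 4" using \<eta>(2)[OF uv'(1,2)] by (simp add: dist_real_def)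
      qed
      also have "\<dots> \<le> t / 4 + 1 / 4 * t"
        using rD[OF d_nonneg uv(3)] t0 by (intro add_left_mono mult_right_mono) auto
      finally show ?thesis by simp
    qed
    then have "osc_le ((R ^^ N) ((R ^^ j) h)) (\<kappa> * t)"
      using \<kappa>(3) iterate_continuous[OF h] iterate_osc[OF h t] by blast
    then show ?thesis by (metis funpow_add o_apply)
  qed
  then show ?thesis by (intro that[OF \<kappa>(1,2)]) blast
qed

text \<open>
  The contraction factor is uniform, so the contraction can be repeated with ever new numbers of steps.
\<close>

lemma osc_tends_to_zero:
  assumes h: "continuous_on B h" and e: "e > 0"
  obtains n where "osc_le ((R ^^ n) h) e"
proof -
  obtain \<kappa> where \<kappa>: "0 < \<kappa>" "\<kappa> < 1"
    "\<forall>h t. continuous_on B h \<longrightarrow> osc_le h t \<longrightarrow> (\<exists>n. osc_le ((R ^^ n) h) (\<kappa> * t))"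
    by (rule eventual_contraction)
  obtain b where b: "b > 0" "\<And>x. x \<in> B \<Longrightarrow> norm (h x) \<le> b" using bounded_B[OF h] by blast
  have t: "osc_le h (b - (- b))"
  proof (rule osc_le_between)
    fix x assume "x \<in> B"
    from b(2)[OF this] show "- b \<le> h x \<and> h x \<le> b" by (simp add: abs_le_iff)
  qed
  have "\<exists>n. osc_le ((R ^^ n) h) (\<kappa> ^ k * (2 * b))" for k
  proof (induction k)
    case 0
    then show ?case using t by (intro exI[of _ 0]) simp
  next
    case (Suc k)
    then obtain n where "osc_le ((R ^^ n) h) (\<kappa> ^ k * (2 * b))" by blast
    from \<kappa>(3)[rule_format, OF iterate_continuous[OF h] this]
    obtain m where "osc_le ((R ^^ m) ((R ^^ n) h)) (\<kappa> * (\<kappa> ^ k * (2 * b)))" by blast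
    then have "osc_le ((R ^^ (m + n)) h) (\<kappa> ^ Suc k * (2 * b))" by (simp add: funpow_add mult.assoc)
    then show ?case by blast
  qed
  moreover obtain k where "\<kappa> ^ k < e / (2 * b)"
    using real_arch_pow_inv[of "e / (2 * b)" \<kappa>] \<kappa> e b(1) by auto
  then have "\<kappa> ^ k * (2 * b) \<le> e" using b(1) by (simp add: field_simps)
  ultimately obtain n where n: "osc_le ((R ^^ n) h) (\<kappa> ^ k * (2 * b))" by blast
  have "osc_le ((R ^^ n) h) e"
    using n \<open>\<kappa> ^ k * (2 * b) \<le> e\<close> unfolding osc_le_def by (meson order_trans)
  then show ?thesis by (rule that)
qed

lemma later_close:
  assumes h: "continuous_on B h" and t: "osc_le ((R ^^ n) h) t" and "n \<le> m" "x \<in> B" "y \<in> B"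
  shows "\<bar>(R ^^ m) h x - (R ^^ n) h y\<bar> \<le> t"
proof -
  have eq: "(R ^^ m) h = (R ^^ (m - n)) ((R ^^ n) h)"
    by (rule iterate_split[OF assms(3)])
  have "(R ^^ n) h y - t \<le> (R ^^ n) h u \<and> (R ^^ n) h u \<le> (R ^^ n) h y + t" if "u \<in> B" for u
    using osc_leD[OF t that assms(5)] by (simp add: abs_le_iff)
  from iterate_between[OF iterate_continuous[OF h] this assms(4), of "m - n"]
  show ?thesis unfolding eq by (simp add: abs_le_iff)
qed

text \<open>
  The ranges of the iterates are nested and shrink to a point.
\<close>

theorem iterates_converge:
  assumes h: "continuous_on B h"
  obtains c where "\<forall>n t. \<forall>x\<in>B. osc_le ((R ^^ n) h) t \<longrightarrow> \<bar>(R ^^ n) h x - c\<bar> \<le> t"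
    "uniform_limit B (\<lambda>n. (R ^^ n) h) (\<lambda>_. c) sequentially"
proof -
  obtain z where z: "z \<in> B" using nonempty by blast
  have "Cauchy (\<lambda>n. (R ^^ n) h z)"
  proof (rule CauchyI)
    fix e :: real assume "e > 0"
    then have "e / 3 > 0" by simp
    from osc_tends_to_zero[OF h this] obtain N where N: "osc_le ((R ^^ N) h) (e / 3)" by blast
    have "norm ((R ^^ m) h z - (R ^^ n) h z) < e" if "m \<ge> N" "n \<ge> N" for m n
      using later_close[OF h N that(1) z z] later_close[OF h N that(2) z z] \<open>e > 0\<close>
      unfolding real_norm_def by linarith
    then show "\<exists>N. \<forall>m\<ge>N. \<forall>n\<ge>N. norm ((R ^^ m) h z - (R ^^ n) h z) < e" by blast
  qed
  then obtain c where c: "(\<lambda>n. (R ^^ n) h z) \<longlonglongrightarrow> c"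
    by (auto simp: Cauchy_convergent_iff convergent_def)
  have close: "\<bar>(R ^^ n) h x - c\<bar> \<le> t" if t: "osc_le ((R ^^ n) h) t" and x: "x \<in> B" for n t x
  proof -
    have "\<bar>(R ^^ m) h z - (R ^^ n) h x\<bar> \<le> t" if "m \<ge> n" for m
      by (rule later_close[OF h t that z x])
    moreover have "(\<lambda>m. \<bar>(R ^^ m) h z - (R ^^ n) h x\<bar>) \<longlonglongrightarrow> \<bar>c - (R ^^ n) h x\<bar>"
      by (intro tendsto_intros c)
    ultimately have "\<bar>c - (R ^^ n) h x\<bar> \<le> t" by (auto intro: LIMSEQ_le_const2)
    then show ?thesis by (simp add: abs_minus_commute)
  qed
  have "uniform_limit B (\<lambda>n. (R ^^ n) h) (\<lambda>_. c) sequentially"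
  proof (rule uniform_limitI)
    fix e :: real assume "e > 0"
    then have "e / 2 > 0" by simp
    from osc_tends_to_zero[OF h this] obtain N where N: "osc_le ((R ^^ N) h) (e / 2)" by blast
    have "dist ((R ^^ n) h x) c < e" if "n \<ge> N" "x \<in> B" for n x
      using close[OF later_osc[OF h N that(1)] that(2)] \<open>e > 0\<close> by (simp add: dist_real_def)
    then show "\<forall>\<^sub>F n in sequentially. \<forall>x\<in>B. dist ((R ^^ n) h x) c < e"
      unfolding eventually_sequentially by blast
  qed
  then show ?thesis by (rule that[rotated]) (use close in blast)
qed

definition K :: real where "K = 2 * D + 1"

text \<open>
  The parameter \<open>t\<close> bounds the oscillation and, with the factor \<open>K\<close>, the local Hoelder constant. The
  choice of \<open>K\<close> makes one step shrink the Hoelder part by the factor \<open>(1 + q) / 2\<close> while the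
  oscillation part may stay the same.
\<close>

definition regular :: "((nat \<Rightarrow> 'a) \<Rightarrow> real) \<Rightarrow> real \<Rightarrow> bool" where
  "regular h t \<longleftrightarrow> osc_le h t \<and>
     (\<forall>x\<in>B. \<forall>y\<in>B. seq_dist x y < \<delta> \<longrightarrow> \<bar>h x - h y\<bar> \<le> K * t * seq_dist x y powr \<alpha>)"

lemma K: "K > 0" "K * q + C \<le> (1 + q) / 2 * K"
proof -
  show "K > 0" using D(1) by (simp add: K_def)
  have "2 * (K * q + C) = 2 * (D * q + C) + 2 * D * q + 2 * q"
    by (simp add: K_def algebra_simps)
  also have "\<dots> = 2 * D + 2 * D * q + 2 * q" unfolding D(2) ..
  also have "\<dots> \<le> (1 + q) * K" using q(2) by (simp add: K_def algebra_simps)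
  finally show "K * q + C \<le> (1 + q) / 2 * K" by simp
qed

lemma regular_continuous: "regular h t \<Longrightarrow> continuous_on B h"
  by (rule holder_continuous_on[OF compact_alphabet \<alpha> \<delta>(1)]) (auto simp: regular_def)

lemma regular_step:
  assumes h: "regular h t" and xy: "x \<in> B" "y \<in> B" "seq_dist x y < \<delta>"
  shows "\<bar>R h x - R h y\<bar> \<le> (1 + q) / 2 * K * t * seq_dist x y powr \<alpha>"
proof -
  have t: "osc_le h t" using h by (simp add: regular_def)
  have t0: "t \<ge> 0" by (rule osc_le_nonneg[OF t])
  let ?d = "seq_dist x y"
  have "\<bar>R h x - R h y\<bar> \<le> K * t * (q * ?d powr \<alpha>) + C * ?d powr \<alpha> * t"
  proof (rule R_smoothing[OF regular_continuous[OF h] osc_leD[OF t] xy])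
    fix u v assume uv: "u \<in> B" "v \<in> B" "seq_dist u v \<le> ?d / 2"
    have "seq_dist u v < \<delta>" using uv(3) xy(3) d_nonneg[of x y] by simp
    then have "\<bar>h u - h v\<bar> \<le> K * t * seq_dist u v powr \<alpha>" using h uv by (simp add: regular_def)
    also have "\<dots> \<le> K * t * (?d / 2) powr \<alpha>"
      using uv(3) d_nonneg \<alpha> K(1) t0 by (intro mult_left_mono powr_mono2) auto
    finally show "\<bar>h u - h v\<bar> \<le> K * t * (q * ?d powr \<alpha>)" unfolding q(3)[OF d_nonneg] .
  qed
  also have "\<dots> = (K * q + C) * (t * ?d powr \<alpha>)" by (simp add: algebra_simps)
  also have "\<dots> \<le> ((1 + q) / 2 * K) * (t * ?d powr \<alpha>)"
    using K(2) t0 by (intro mult_right_mono) auto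
  finally show ?thesis by (simp add: mult.assoc)
qed

lemma regular_R:
  assumes h: "regular h t" shows "regular (R h) t"
  unfolding regular_def
proof (intro conjI ballI impI)
  have t: "osc_le h t" using h by (simp add: regular_def)
  show "osc_le (R h) t" using iterate_osc[OF regular_continuous[OF h] t, of 1] by simp
  fix x y assume "x \<in> B" "y \<in> B" "seq_dist x y < \<delta>"
  from regular_step[OF h this]
  have "\<bar>R h x - R h y\<bar> \<le> (1 + q) / 2 * (K * t * seq_dist x y powr \<alpha>)" by (simp add: mult.assoc)
  also have "\<dots> \<le> 1 * (K * t * seq_dist x y powr \<alpha>)"
    using q(2) K(1) osc_le_nonneg[OF t] by (intro mult_right_mono) auto
  finally show "\<bar>R h x - R h y\<bar> \<le> K * t * seq_dist x y powr \<alpha>" by simp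
qed

lemma regular_iterate: "regular h t \<Longrightarrow> regular ((R ^^ n) h) t"
  by (induction n) (simp_all add: regular_R)

text \<open>
  For regular functions the radius in the ball argument is the same, so a fixed number of steps
  contracts the oscillation, and the last step contracts the Hoelder part.
\<close>

lemma regular_contraction:
  obtains N \<kappa> where "0 < \<kappa>" "\<kappa> < 1" "N > 0" "\<forall>h t. regular h t \<longrightarrow> regular ((R ^^ N) h) (\<kappa> * t)"
proof -
  \<comment> \<open>Regular functions vary by at most \<open>t / 2\<close> at distances below \<open>r\<close>.\<close>
  define r where "r = min \<delta> ((1 / (2 * K)) powr (1 / \<alpha>))"
  have r: "r > 0" "r \<le> \<delta>" using \<delta>(1) K(1) by (auto simp: r_def)
  have rK: "K * s powr \<alpha> \<le> 1 / 2" if "0 \<le> s" "s < r" for s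
  proof -
    have "s powr \<alpha> \<le> ((1 / (2 * K)) powr (1 / \<alpha>)) powr \<alpha>"
      using that \<alpha> by (intro powr_mono2) (auto simp: r_def)
    also have "\<dots> = 1 / (2 * K)" using \<alpha> K(1) by (simp add: powr_powr)
    finally show ?thesis using K(1) by (simp add: field_simps)
  qed
  obtain N \<kappa> where \<kappa>: "0 < \<kappa>" "\<kappa> < 1" "\<forall>h t m. continuous_on B h \<longrightarrow> osc_le h t \<longrightarrow>
      (\<forall>u\<in>B. \<forall>v\<in>B. seq_dist u v < r \<longrightarrow> \<bar>h u - h v\<bar> \<le> t / 2) \<longrightarrow> m \<ge> N \<longrightarrow>
      osc_le ((R ^^ m) h) (\<kappa> * t)"
    by (rule ball_contraction[OF r(1)])
  define \<kappa>' where "\<kappa>' = max \<kappa> ((1 + q) / 2)"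
  show ?thesis
  proof (rule that[of \<kappa>' "Suc N"])
    show "0 < \<kappa>'" "\<kappa>' < 1" "Suc N > 0" using \<kappa>(1,2) q by (auto simp: \<kappa>'_def)
    show "\<forall>h t. regular h t \<longrightarrow> regular ((R ^^ Suc N) h) (\<kappa>' * t)"
    proof (intro allI impI)
      fix h t assume h: "regular h t"
      have t: "osc_le h t" using h by (simp add: regular_def)
      have t0: "t \<ge> 0" by (rule osc_le_nonneg[OF t])
      show "regular ((R ^^ Suc N) h) (\<kappa>' * t)"
        unfolding regular_def
      proof (intro conjI ballI impI)
        have "osc_le ((R ^^ Suc N) h) (\<kappa> * t)"
        proof (rule \<kappa>(3)[rule_format, OF regular_continuous[OF h] t])
          fix u v assume uv: "u \<in> B" "v \<in> B" "seq_dist u v < r"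
          then have "\<bar>h u - h v\<bar> \<le> (K * seq_dist u v powr \<alpha>) * t"
            using h r(2) by (simp add: regular_def mult_ac)
          also have "\<dots> \<le> 1 / 2 * t" using rK[OF d_nonneg uv(3)] t0 by (rule mult_right_mono)
          finally show "\<bar>h u - h v\<bar> \<le> t / 2" by simp
        qed simp
        moreover have "\<kappa> * t \<le> \<kappa>' * t" using t0 by (intro mult_right_mono) (auto simp: \<kappa>'_def)
        ultimately show "osc_le ((R ^^ Suc N) h) (\<kappa>' * t)" unfolding osc_le_def by (meson order_trans)
        fix x y assume "x \<in> B" "y \<in> B" "seq_dist x y < \<delta>"
        from regular_step[OF regular_iterate[OF h] this, of N]
        have "\<bar>(R ^^ Suc N) h x - (R ^^ Suc N) h y\<bar> \<le> (1 + q) / 2 * (K * t * seq_dist x y powr \<alpha>)"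
          by (simp add: mult.assoc)
        also have "\<dots> \<le> \<kappa>' * (K * t * seq_dist x y powr \<alpha>)"
          using K(1) t0 by (intro mult_right_mono) (auto simp: \<kappa>'_def)
        finally show "\<bar>(R ^^ Suc N) h x - (R ^^ Suc N) h y\<bar> \<le> K * (\<kappa>' * t) * seq_dist x y powr \<alpha>"
          by (simp add: mult_ac)
      qed
    qed
  qed
qed

lemma regular_exponential:
  obtains M \<theta> where "M > 0" "0 < \<theta>" "\<theta> < 1" "\<forall>h t n. regular h t \<longrightarrow> regular ((R ^^ n) h) (M * \<theta> ^ n * t)"
proof -
  obtain N \<kappa> where \<kappa>: "0 < \<kappa>" "\<kappa> < 1" "N > 0" "\<forall>h t. regular h t \<longrightarrow> regular ((R ^^ N) h) (\<kappa> * t)"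
    by (rule regular_contraction)
  \<comment> \<open>Contraction by \<open>\<kappa>\<close> in every \<open>N\<close> steps is contraction by its \<open>N\<close>-th root per step, up to a factor \<open>1 / \<kappa>\<close>.\<close>
  define \<theta> where "\<theta> = root N \<kappa>"
  have \<theta>: "0 < \<theta>" "\<theta> < 1" "\<theta> ^ N = \<kappa>" using \<kappa>(1,2,3) by (auto simp: \<theta>_def)
  have block: "regular ((R ^^ (N * k)) h) (\<kappa> ^ k * t)" if "regular h t" for h t k
  proof (induction k)
    case (Suc k)
    from \<kappa>(4)[rule_format, OF this] show ?case by (simp add: funpow_add mult.assoc)
  qed (use that in simp)
  show ?thesis
  proof (rule that[of "1 / \<kappa>" \<theta>])
    show "0 < 1 / \<kappa>" "0 < \<theta>" "\<theta> < 1" using \<kappa>(1) \<theta> by auto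
    show "\<forall>h t n. regular h t \<longrightarrow> regular ((R ^^ n) h) (1 / \<kappa> * \<theta> ^ n * t)"
    proof (intro allI impI)
      fix h t n assume h: "regular h t"
      have t0: "t \<ge> 0" using h osc_le_nonneg by (auto simp: regular_def)
      have "regular ((R ^^ (n mod N)) ((R ^^ (N * (n div N))) h)) (\<kappa> ^ (n div N) * t)"
        by (rule regular_iterate[OF block[OF h]])
      then have 1: "regular ((R ^^ n) h) (\<kappa> ^ (n div N) * t)"
        by (simp only: funpow_add[symmetric, THEN fun_cong, unfolded o_apply] mod_mult_div_eq)
      have "\<kappa> * \<kappa> ^ (n div N) = \<theta> ^ (N * Suc (n div N))"
        unfolding power_mult \<theta>(3) by simp
      also have "\<dots> \<le> \<theta> ^ n"
      proof (rule power_decreasing)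
        show "n \<le> N * Suc (n div N)" using \<kappa>(3) dividend_less_times_div[of N n] by simp
      qed (use \<theta> in auto)
      finally have "\<kappa> ^ (n div N) \<le> 1 / \<kappa> * \<theta> ^ n" using \<kappa>(1) by (simp add: field_simps)
      then have le: "\<kappa> ^ (n div N) * t \<le> 1 / \<kappa> * \<theta> ^ n * t" using t0 by (rule mult_right_mono)
      show "regular ((R ^^ n) h) (1 / \<kappa> * \<theta> ^ n * t)"
        unfolding regular_def
      proof (intro conjI ballI impI)
        show "osc_le ((R ^^ n) h) (1 / \<kappa> * \<theta> ^ n * t)"
          using 1 le unfolding regular_def osc_le_def by (meson order_trans)
        fix x y assume "x \<in> B" "y \<in> B" "seq_dist x y < \<delta>"
        then have "\<bar>(R ^^ n) h x - (R ^^ n) h y\<bar> \<le> K * (\<kappa> ^ (n div N) * t) * seq_dist x y powr \<alpha>"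
          using 1 by (simp add: regular_def)
        also have "\<dots> \<le> K * (1 / \<kappa> * \<theta> ^ n * t) * seq_dist x y powr \<alpha>"
          using mult_left_mono[OF le, of K] K(1) by (intro mult_right_mono) auto
        finally show "\<bar>(R ^^ n) h x - (R ^^ n) h y\<bar> \<le> K * (1 / \<kappa> * \<theta> ^ n * t) * seq_dist x y powr \<alpha>" .
      qed
    qed
  qed
qed

theorem exponential_convergence:
  obtains M \<theta> where "M > 0" "0 < \<theta>" "\<theta> < 1"
    "\<And>h b c n x. (\<And>x. x \<in> B \<Longrightarrow> \<bar>h x\<bar> \<le> b) \<Longrightarrow>
      (\<And>x y. x \<in> B \<Longrightarrow> y \<in> B \<Longrightarrow> \<bar>h x - h y\<bar> \<le> b * seq_dist x y powr \<alpha>) \<Longrightarrow>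
      uniform_limit B (\<lambda>n. (R ^^ n) h) (\<lambda>_. c) sequentially \<Longrightarrow> x \<in> B \<Longrightarrow>
      \<bar>(R ^^ n) h x - c\<bar> \<le> M * \<theta> ^ n * b"
    "\<And>h b n x y. (\<And>x. x \<in> B \<Longrightarrow> \<bar>h x\<bar> \<le> b) \<Longrightarrow>
      (\<And>x y. x \<in> B \<Longrightarrow> y \<in> B \<Longrightarrow> \<bar>h x - h y\<bar> \<le> b * seq_dist x y powr \<alpha>) \<Longrightarrow> x \<in> B \<Longrightarrow> y \<in> B \<Longrightarrow>
      \<bar>(R ^^ n) h x - (R ^^ n) h y\<bar> \<le> M * \<theta> ^ n * b * seq_dist x y powr \<alpha>"
proof -
  obtain M \<theta> where M: "M > 0" "0 < \<theta>" "\<theta> < 1" "\<forall>h t n. regular h t \<longrightarrow> regular ((R ^^ n) h) (M * \<theta> ^ n * t)"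
    by (rule regular_exponential)
  \<comment> \<open>Converts a bound \<open>b\<close> on values and Hoelder constant into a parameter \<open>t = s * b\<close> for regularity:
    the oscillation is at most \<open>2 * b\<close>, and \<open>b \<le> K * t\<close>.\<close>
  define s where "s = 2 + 1 / K"
  have s: "s \<ge> 2" "K * s \<ge> 1" using K(1) by (auto simp: s_def field_simps)
  \<comment> \<open>Converts back; the last entry covers pairs at distance at least \<open>\<delta>\<close>.\<close>
  define W where "W = max 1 (max K (1 / \<delta> powr \<alpha>))"
  have W: "W \<ge> 1" "W \<ge> K" "W \<ge> 1 / \<delta> powr \<alpha>" by (auto simp: W_def)
  have reg: "regular h (s * b)"
    if h: "\<And>x. x \<in> B \<Longrightarrow> \<bar>h x\<bar> \<le> b" "\<And>x y. x \<in> B \<Longrightarrow> y \<in> B \<Longrightarrow> \<bar>h x - h y\<bar> \<le> b * seq_dist x y powr \<alpha>" for h b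
  proof -
    obtain z where "z \<in> B" using nonempty by blast
    then have b: "b \<ge> 0" using h(1) abs_ge_zero order_trans by blast
    have "osc_le h (b - (- b))"
    proof (rule osc_le_between)
      fix x assume "x \<in> B"
      from h(1)[OF this] show "- b \<le> h x \<and> h x \<le> b" by (simp add: abs_le_iff)
    qed
    moreover have "b - (- b) \<le> s * b" using mult_right_mono[OF s(1) b] by simp
    ultimately have "osc_le h (s * b)" unfolding osc_le_def by (meson order_trans)
    moreover have "\<bar>h x - h y\<bar> \<le> K * (s * b) * seq_dist x y powr \<alpha>" if "x \<in> B" "y \<in> B" for x y
    proof -
      have "1 * b \<le> K * s * b" using s(2) b by (rule mult_right_mono)
      then have "b * seq_dist x y powr \<alpha> \<le> K * s * b * seq_dist x y powr \<alpha>"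
        by (intro mult_right_mono) auto
      then show ?thesis using h(2)[OF that] by (simp add: mult.assoc)
    qed
    ultimately show ?thesis by (simp add: regular_def)
  qed
  show ?thesis
  proof (rule that[of "M * s * W" \<theta>])
    show "M * s * W > 0" "0 < \<theta>" "\<theta> < 1" using M(1,2,3) s W by auto
    fix h :: "(nat \<Rightarrow> 'a) \<Rightarrow> real" and b :: real and n :: nat and x :: "nat \<Rightarrow> 'a"
    assume h: "\<And>x. x \<in> B \<Longrightarrow> \<bar>h x\<bar> \<le> b" "\<And>x y. x \<in> B \<Longrightarrow> y \<in> B \<Longrightarrow> \<bar>h x - h y\<bar> \<le> b * seq_dist x y powr \<alpha>"
      and x: "x \<in> B"
    have b: "b \<ge> 0" using h(1)[OF x] by linarith
    define t where "t = M * \<theta> ^ n * (s * b)"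
    have t0: "t \<ge> 0" using M(1,2) s b by (simp add: t_def)
    have r: "regular ((R ^^ n) h) t" unfolding t_def by (rule M(4)[rule_format, OF reg[OF h]])
    then have o: "osc_le ((R ^^ n) h) t" by (simp add: regular_def)
    have tW: "M * s * W * \<theta> ^ n * b = W * t" by (simp add: t_def mult_ac)
    have tle: "t \<le> W * t" using mult_right_mono[OF W(1) t0] by simp
    note hc = regular_continuous[OF reg[OF h]]
    {
      fix c assume c: "uniform_limit B (\<lambda>n. (R ^^ n) h) (\<lambda>_. c) sequentially"
      obtain c' where c': "\<forall>n t. \<forall>x\<in>B. osc_le ((R ^^ n) h) t \<longrightarrow> \<bar>(R ^^ n) h x - c'\<bar> \<le> t"
          "uniform_limit B (\<lambda>n. (R ^^ n) h) (\<lambda>_. c') sequentially"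
        by (rule iterates_converge[OF hc])
      have "c = c'"
        using tendsto_uniform_limitI[OF c x] tendsto_uniform_limitI[OF c'(2) x] by (rule LIMSEQ_unique)
      then show "\<bar>(R ^^ n) h x - c\<bar> \<le> M * s * W * \<theta> ^ n * b"
        unfolding tW using c'(1)[rule_format, OF x o] tle by simp
    }
    fix y assume y: "y \<in> B"
    have "norm ((R ^^ n) h x - (R ^^ n) h y) \<le> max (K * t) (t / \<delta> powr \<alpha>) * seq_dist x y powr \<alpha>"
      by (rule holder_global[OF \<alpha> \<delta>(1) _ _ x y]) (use r osc_leD[OF o] in \<open>auto simp: regular_def\<close>)
    also have "\<dots> \<le> (W * t) * seq_dist x y powr \<alpha>"
    proof (rule mult_right_mono)
      have "K * t \<le> W * t" "1 / \<delta> powr \<alpha> * t \<le> W * t" by (intro mult_right_mono W t0)+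
      then show "max (K * t) (t / \<delta> powr \<alpha>) \<le> W * t" by simp
    qed simp
    finally show "\<bar>(R ^^ n) h x - (R ^^ n) h y\<bar> \<le> M * s * W * \<theta> ^ n * b * seq_dist x y powr \<alpha>"
      unfolding tW by simp
  qed
qed

end

section \<open>Normalized potentials\<close>

lemma (in holder_potential) exp_holder:
  obtains E where "E \<ge> 0" "\<And>u v. u \<in> B \<Longrightarrow> v \<in> B \<Longrightarrow> \<bar>exp (\<phi> u) - exp (\<phi> v)\<bar> \<le> E * seq_dist u v powr \<alpha>"
proof -
  obtain c where c: "c > 0" "\<And>x. x \<in> B \<Longrightarrow> norm (\<phi> x) \<le> c" using bounded_B[OF \<phi>] by blast
  have *: "exp (\<phi> u) - exp (\<phi> v) \<le> exp c * hol * seq_dist u v powr \<alpha>" if "u \<in> B" "v \<in> B" for u v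
  proof -
    have "exp (\<phi> u) - exp (\<phi> v) = exp (\<phi> v) * (exp (\<phi> u - \<phi> v) - 1)"
      by (simp add: exp_diff algebra_simps)
    also have "\<dots> \<le> exp (\<phi> v) * ((\<phi> u - \<phi> v) * exp (\<phi> u - \<phi> v))"
      by (intro mult_left_mono exp_minus_one_le) simp
    also have "\<dots> = (\<phi> u - \<phi> v) * exp (\<phi> u)" by (simp add: exp_diff)
    also have "\<dots> \<le> (hol * seq_dist u v powr \<alpha>) * exp c"
    proof (rule mult_mono)
      show "\<phi> u - \<phi> v \<le> hol * seq_dist u v powr \<alpha>" using hol(2)[OF that] by simp
      show "exp (\<phi> u) \<le> exp c" using c(2)[OF that(1)] by simp
    qed (use hol(1) in auto)
    finally show ?thesis by (simp add: mult_ac)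
  qed
  show ?thesis
  proof (rule that)
    show "0 \<le> exp c * hol" using hol(1) by simp
    fix u v assume uv: "u \<in> B" "v \<in> B"
    show "\<bar>exp (\<phi> u) - exp (\<phi> v)\<bar> \<le> exp c * hol * seq_dist u v powr \<alpha>"
      using *[OF uv] *[OF uv(2,1)] by (simp add: seq_dist_commute abs_le_iff)
  qed
qed

locale normalized_holder_potential = holder_potential A I \<nu> \<alpha> \<phi>
  for A :: "'a::metric_space \<times> 'a \<Rightarrow> real" and I :: "real set" and \<nu> :: "'a measure" and \<alpha> \<phi> +
  assumes normalized: "\<And>x. x \<in> B \<Longrightarrow> L \<phi> (\<lambda>_. 1 :: real) x = 1"
begin

lemma L_const: "x \<in> B \<Longrightarrow> L \<phi> (\<lambda>_. c) x = (c :: real)"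
  using L_mult[of \<phi> c "\<lambda>_. 1" x] normalized by simp

lemma L_affine:
  fixes h :: "(nat \<Rightarrow> 'a) \<Rightarrow> real"
  assumes "continuous_on B h" "x \<in> B"
  shows "L \<phi> (\<lambda>y. a + b * h y) x = a + b * L \<phi> h x"
proof -
  have c: "continuous_on B (\<lambda>y. b * h y)" by (intro continuous_intros assms)
  show ?thesis
    using L_add[OF \<phi> continuous_on_const c assms(2), of a] by (simp add: L_const assms(2) L_mult)
qed

definition E :: real where
  "E = (SOME E. E \<ge> 0 \<and> (\<forall>u\<in>B. \<forall>v\<in>B. \<bar>exp (\<phi> u) - exp (\<phi> v)\<bar> \<le> E * seq_dist u v powr \<alpha>))"

lemma E: "E \<ge> 0" "\<And>u v. u \<in> B \<Longrightarrow> v \<in> B \<Longrightarrow> \<bar>exp (\<phi> u) - exp (\<phi> v)\<bar> \<le> E * seq_dist u v powr \<alpha>"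
proof -
  obtain E' where "E' \<ge> 0" "\<And>u v. u \<in> B \<Longrightarrow> v \<in> B \<Longrightarrow> \<bar>exp (\<phi> u) - exp (\<phi> v)\<bar> \<le> E' * seq_dist u v powr \<alpha>"
    using exp_holder by blast
  then have "\<exists>E. E \<ge> 0 \<and> (\<forall>u\<in>B. \<forall>v\<in>B. \<bar>exp (\<phi> u) - exp (\<phi> v)\<bar> \<le> E * seq_dist u v powr \<alpha>)" by blast
  from someI_ex[OF this]
  show "E \<ge> 0" "\<And>u v. u \<in> B \<Longrightarrow> v \<in> B \<Longrightarrow> \<bar>exp (\<phi> u) - exp (\<phi> v)\<bar> \<le> E * seq_dist u v powr \<alpha>"
    unfolding E_def[symmetric] by blast+
qed

text \<open>
  The difference of the two integrals is split at a mixed term with the weight of \<open>x\<close> and the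
  function values of \<open>y\<close>. The first part is an average of differences of \<open>h\<close> with total weight 1; in
  the second part only the weights differ.
\<close>

lemma L_smoothing:
  fixes h :: "(nat \<Rightarrow> 'a) \<Rightarrow> real"
  assumes h: "continuous_on B h" and t: "\<And>u v. u \<in> B \<Longrightarrow> v \<in> B \<Longrightarrow> \<bar>h u - h v\<bar> \<le> t"
    and xy: "x \<in> B" "y \<in> B" "seq_dist x y < \<delta>"
    and e: "\<And>u v. u \<in> B \<Longrightarrow> v \<in> B \<Longrightarrow> seq_dist u v \<le> seq_dist x y / 2 \<Longrightarrow> \<bar>h u - h v\<bar> \<le> e"
  shows "\<bar>L \<phi> h x - L \<phi> h y\<bar> \<le> e + E * seq_dist x y powr \<alpha> * t"
proof -
  let ?u = "\<lambda>a. case_nat a x" and ?v = "\<lambda>a. case_nat a y"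
  let ?d = "seq_dist x y powr \<alpha>"
  have t0: "t \<ge> 0" using t[OF xy(1,1)] by simp
  have e0: "e \<ge> 0" using e[OF xy(1,1)] d_nonneg[of x y] by simp
  have p: "preds y = preds x" using \<delta>(2)[OF xy] by simp
  \<comment> \<open>Subtracting a constant costs nothing since \<open>L 1 = 1\<close>, and makes the values at most \<open>t\<close>.\<close>
  define k where "k z = h z - h x" for z
  have k: "continuous_on B k" unfolding k_def by (intro continuous_intros h)
  have Lk: "L \<phi> h z = h x + L \<phi> k z" if "z \<in> B" for z
    using L_affine[OF k that, of "h x" 1] by (simp add: k_def)
  have in_B: "?u a \<in> B" "?v a \<in> B" if "a \<in> preds x" for a using cons_in xy that p by auto
  have d: "seq_dist (?u a) (?v a) = seq_dist x y / 2" for a by (rule d_cons)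
  let ?P = "\<lambda>a. exp (\<phi> (?u a)) *\<^sub>R k (?u a)" and ?Q = "\<lambda>a. exp (\<phi> (?v a)) *\<^sub>R k (?v a)"
  \<comment> \<open>The mixed term: weight at \<open>x\<close>, function at \<open>y\<close>.\<close>
  let ?G = "\<lambda>a. exp (\<phi> (?u a)) * k (?v a)"
  have iP: "set_integrable \<nu> (preds x) ?P" and iQ: "set_integrable \<nu> (preds x) ?Q"
    using L_integrable[OF \<phi> k xy(1)] L_integrable[OF \<phi> k xy(2)] p by simp_all
  have cons_cont: "continuous_on (preds x) (\<lambda>a. g (case_nat a z))"
    if "continuous_on B g" "z \<in> B" "preds z = preds x" for g :: "(nat \<Rightarrow> 'a) \<Rightarrow> real" and z
    by (rule continuous_on_compose2[OF that(1) continuous_on_subset[OF continuous_cons]])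
       (use cons_in that in auto)
  have iG: "set_integrable \<nu> (preds x) ?G"
  proof -
    have "continuous_on (preds x) ?G"
      by (intro continuous_intros cons_cont \<phi> k xy p refl)
    then have "(\<lambda>a. indicator (preds x) a *\<^sub>R ?G a) \<in> borel_measurable borel"
      using closed_preds by (intro borel_measurable_continuous_on_indicator) auto
    then have m: "(\<lambda>a. indicator (preds x) a *\<^sub>R ?G a) \<in> borel_measurable \<nu>"
      using measurable_cong_sets[OF sets_nu refl] by blast
    have "set_integrable \<nu> (preds x) (\<lambda>a. t * exp (\<phi> (?u a)))"
      using L_integrable[OF \<phi> continuous_on_const xy(1), of t] by (simp add: mult.commute)
    then show ?thesis
      unfolding set_integrable_def
    proof (rule Bochner_Integration.integrable_bound[OF _ m])
      have "norm (indicator (preds x) a *\<^sub>R ?G a) \<le> norm (indicator (preds x) a *\<^sub>R (t * exp (\<phi> (?u a))))" for a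
        using t[OF in_B(2) xy(1), of a] t0 by (cases "a \<in> preds x") (auto simp: abs_mult k_def)
      then show "AE a in \<nu>. norm (indicator (preds x) a *\<^sub>R ?G a) \<le> norm (indicator (preds x) a *\<^sub>R (t * exp (\<phi> (?u a))))"
        by simp
    qed
  qed
  have "L \<phi> k x - L \<phi> k y = (LINT a:preds x|\<nu>. ?P a) - (LINT a:preds x|\<nu>. ?Q a)"
    by (simp add: L_eq xy p)
  also have "\<dots> = (LINT a:preds x|\<nu>. ?P a - ?G a) + (LINT a:preds x|\<nu>. ?G a - ?Q a)"
    using set_integral_diff(2)[OF iP iG] set_integral_diff(2)[OF iG iQ] by simp
  finally have split: "L \<phi> h x - L \<phi> h y = (LINT a:preds x|\<nu>. ?P a - ?G a) + (LINT a:preds x|\<nu>. ?G a - ?Q a)"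
    by (simp add: Lk xy)
  have 1: "\<bar>LINT a:preds x|\<nu>. ?P a - ?G a\<bar> \<le> e"
  proof -
    have "norm (LINT a:preds x|\<nu>. ?P a - ?G a) \<le> (LINT a:preds x|\<nu>. norm (?P a - ?G a))"
      by (rule set_integral_norm_bound[OF set_integral_diff(1)[OF iP iG]])
    also have "\<dots> \<le> (LINT a:preds x|\<nu>. exp (\<phi> (?u a)) *\<^sub>R e)"
    proof (rule set_integral_mono[OF set_integrable_norm[OF set_integral_diff(1)[OF iP iG]]
          L_integrable[OF \<phi> continuous_on_const xy(1)]])
      fix a assume a: "a \<in> preds x"
      have "\<bar>h (?u a) - h (?v a)\<bar> \<le> e" by (rule e[OF in_B[OF a]]) (simp add: d)
      then have "exp (\<phi> (?u a)) * \<bar>h (?u a) - h (?v a)\<bar> \<le> exp (\<phi> (?u a)) * e" by (intro mult_left_mono) auto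
      moreover have "?P a - ?G a = exp (\<phi> (?u a)) * (h (?u a) - h (?v a))"
        by (simp add: k_def algebra_simps)
      ultimately show "norm (?P a - ?G a) \<le> exp (\<phi> (?u a)) *\<^sub>R e" by (simp add: abs_mult)
    qed
    also have "\<dots> = L \<phi> (\<lambda>_. e) x" by (simp add: L_eq[OF xy(1)])
    also have "\<dots> = e" by (rule L_const[OF xy(1)])
    finally show ?thesis by simp
  qed
  have 2: "\<bar>LINT a:preds x|\<nu>. ?G a - ?Q a\<bar> \<le> E * ?d * t"
  proof -
    have "norm (LINT a:preds x|\<nu>. ?G a - ?Q a) \<le> E * ?d * t"
    proof (rule branch_integral_norm_le[OF xy(1) _ set_integral_diff(1)[OF iG iQ]])
      show "0 \<le> E * ?d * t" using E(1) t0 by simp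
      fix a assume a: "a \<in> preds x"
      have "\<bar>exp (\<phi> (?u a)) - exp (\<phi> (?v a))\<bar> \<le> E * seq_dist (?u a) (?v a) powr \<alpha>" by (rule E(2)[OF in_B[OF a]])
      also have "\<dots> \<le> E * ?d"
        unfolding d using E(1) \<alpha> d_nonneg[of x y] by (intro mult_left_mono powr_mono2) auto
      finally have "\<bar>exp (\<phi> (?u a)) - exp (\<phi> (?v a))\<bar> * \<bar>k (?v a)\<bar> \<le> E * ?d * t"
        using t[OF in_B(2)[OF a] xy(1)] E(1) by (intro mult_mono) (auto simp: k_def)
      moreover have "?G a - ?Q a = (exp (\<phi> (?u a)) - exp (\<phi> (?v a))) * k (?v a)" by (simp add: algebra_simps)
      ultimately show "norm (?G a - ?Q a) \<le> E * ?d * t" by (simp add: abs_mult)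
    qed
    then show ?thesis by simp
  qed
  show ?thesis unfolding split using 1 2 by linarith
qed

lemma L_primitive_markov:
  assumes "top_mixing shift B"
  shows "primitive_markov A I \<nu> (L \<phi>) \<alpha> E"
proof unfold_locales
  fix g z assume "continuous_on B g" "\<And>y. y \<in> B \<Longrightarrow> 0 \<le> g y" "z \<in> B" "0 < (g z :: real)"
  then obtain n where "\<And>x. x \<in> B \<Longrightarrow> 0 < (L \<phi> ^^ n) g x"
    using mixing_primitive[OF assms \<phi>, of g z] by metis
  then show "\<exists>n. \<forall>x\<in>B. 0 < (L \<phi> ^^ n) g x" by blast
qed (use \<alpha> E(1) in \<open>auto intro!: L_continuous L_affine L_add L_mono L_smoothing \<phi>\<close>)

text \<open>
  \<open>L\<close> may permute pieces of the space periodically, and then its iterates need not converge. The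
  operator \<open>(L + L\<^sup>2) / 2\<close> has every fixed function and every fixed measure of \<open>L\<close>; it is \<open>L\<close>
  composed with its lazy version, hence primitive, and it smooths like \<open>L\<close>, with twice the constant,
  because each of its terms contains at least one application of \<open>L\<close>.
\<close>

definition slow :: "((nat \<Rightarrow> 'a) \<Rightarrow> real) \<Rightarrow> (nat \<Rightarrow> 'a) \<Rightarrow> real" where
  "slow h = (\<lambda>x. 1/2 * (L \<phi> h x + L \<phi> (L \<phi> h) x))"

lemma slow_continuous: "continuous_on B h \<Longrightarrow> continuous_on B (slow h)"
  unfolding slow_def by (intro continuous_intros L_continuous \<phi>)

lemma slow_cong: "(\<And>y. y \<in> B \<Longrightarrow> f y = g y) \<Longrightarrow> slow f = slow g"
  unfolding slow_def using L_cong[of f g \<phi>] by simp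

lemma slow_L:
  assumes "continuous_on B h" "x \<in> B"
  shows "slow (L \<phi> h) x = L \<phi> (slow h) x"
proof -
  have "L \<phi> (slow h) x = 1/2 * L \<phi> (\<lambda>y. L \<phi> h y + L \<phi> (L \<phi> h) y) x"
    unfolding slow_def by (rule L_mult)
  also have "\<dots> = slow (L \<phi> h) x"
    unfolding slow_def
    by (simp only: L_add[OF \<phi> L_continuous[OF \<phi> assms(1)] L_continuous[OF \<phi> L_continuous[OF \<phi> assms(1)]] assms(2)])
  finally show ?thesis by simp
qed

lemma slow_eq_lazy:
  assumes h: "continuous_on B h" and x: "x \<in> B"
  shows "slow h x = L \<phi> (lazy \<phi> h) x"
proof -
  have "lazy \<phi> h = (\<lambda>y. 1/2 * (h y + L \<phi> h y))" by (simp add: lazy_def fun_eq_iff)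
  then have "L \<phi> (lazy \<phi> h) x = 1/2 * L \<phi> (\<lambda>y. h y + L \<phi> h y) x" by (simp only: L_mult)
  then show ?thesis
    unfolding slow_def using L_add[OF \<phi> h L_continuous[OF \<phi> h] x] by simp
qed

lemma lazy_L_iterate:
  assumes "continuous_on B h" "x \<in> B"
  shows "lazy \<phi> ((L \<phi> ^^ n) h) x = (L \<phi> ^^ n) (lazy \<phi> h) x"
  using assms(2)
proof (induction n arbitrary: x)
  case (Suc n)
  have c: "continuous_on B ((L \<phi> ^^ n) h)" by (rule L_iterate_continuous[OF \<phi> assms(1)])
  have "L \<phi> ((L \<phi> ^^ n) (lazy \<phi> h)) x = L \<phi> (lazy \<phi> ((L \<phi> ^^ n) h)) x"
    by (rule fun_cong[OF L_cong]) (simp add: Suc.IH)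
  also have "\<dots> = slow ((L \<phi> ^^ n) h) x" by (rule slow_eq_lazy[OF c Suc.prems, symmetric])
  also have "\<dots> = lazy \<phi> ((L \<phi> ^^ Suc n) h) x" by (simp add: slow_def lazy_def)
  finally show ?case by simp
qed simp

text \<open>
  Separates the lazy part, which creates positivity, from the powers of \<open>L\<close>, which preserve it.
\<close>

lemma slow_iterate:
  assumes "continuous_on B h" "x \<in> B"
  shows "(slow ^^ n) h x = (L \<phi> ^^ n) ((lazy \<phi> ^^ n) h) x"
  using assms(2)
proof (induction n arbitrary: x)
  case (Suc n)
  let ?g = "(lazy \<phi> ^^ n) h"
  have c: "continuous_on B ?g" by (rule lazy_iterate_continuous[OF \<phi> assms(1)])
  have "slow ((slow ^^ n) h) x = slow ((L \<phi> ^^ n) ?g) x"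
    by (rule fun_cong[OF slow_cong]) (rule Suc.IH)
  also have "\<dots> = L \<phi> (lazy \<phi> ((L \<phi> ^^ n) ?g)) x"
    by (rule slow_eq_lazy[OF L_iterate_continuous[OF \<phi> c] Suc.prems])
  also have "\<dots> = L \<phi> ((L \<phi> ^^ n) (lazy \<phi> ?g)) x"
    by (rule fun_cong[OF L_cong]) (rule lazy_L_iterate[OF c])
  finally show ?case by simp
qed simp

sublocale slow: primitive_markov A I \<nu> slow \<alpha> "2 * E"
proof unfold_locales
  show "\<alpha> > 0" by (rule \<alpha>)
  show "0 \<le> 2 * E" using E(1) by simp
  show "\<And>h. continuous_on B h \<Longrightarrow> continuous_on B (slow h)" by (rule slow_continuous)
  fix h :: "(nat \<Rightarrow> 'a) \<Rightarrow> real" and a b x assume h: "continuous_on B h" and x: "x \<in> B"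
  have "L \<phi> (L \<phi> (\<lambda>y. a + b * h y)) x = L \<phi> (\<lambda>y. a + b * L \<phi> h y) x"
    by (rule fun_cong[OF L_cong]) (rule L_affine[OF h])
  then show "slow (\<lambda>y. a + b * h y) x = a + b * slow h x"
    unfolding slow_def by (simp add: L_affine[OF h x] L_affine[OF L_continuous[OF \<phi> h] x] algebra_simps)
next
  fix g h :: "(nat \<Rightarrow> 'a) \<Rightarrow> real" and x
  assume gh: "continuous_on B g" "continuous_on B h" and x: "x \<in> B"
  note c = L_continuous[OF \<phi> gh(1)] L_continuous[OF \<phi> gh(2)]
  have "L \<phi> (L \<phi> (\<lambda>y. g y + h y)) x = L \<phi> (\<lambda>y. L \<phi> g y + L \<phi> h y) x"
    by (rule fun_cong[OF L_cong]) (rule L_add[OF \<phi> gh])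
  then show "slow (\<lambda>y. g y + h y) x = slow g x + slow h x"
    unfolding slow_def by (simp add: L_add[OF \<phi> gh x] L_add[OF \<phi> c x] algebra_simps)
  assume le: "\<And>y. y \<in> B \<Longrightarrow> g y \<le> h y"
  have "L \<phi> g y \<le> L \<phi> h y" if "y \<in> B" for y by (rule L_mono[OF \<phi> gh that le])
  moreover from this have "L \<phi> (L \<phi> g) x \<le> L \<phi> (L \<phi> h) x" by (rule L_mono[OF \<phi> c x])
  ultimately show "slow g x \<le> slow h x" unfolding slow_def using x by (intro mult_left_mono add_mono) auto
next
  fix h :: "(nat \<Rightarrow> 'a) \<Rightarrow> real" and t e x y
  assume h: "continuous_on B h" and t: "\<And>u v. u \<in> B \<Longrightarrow> v \<in> B \<Longrightarrow> \<bar>h u - h v\<bar> \<le> t"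
    and xy: "x \<in> B" "y \<in> B" "seq_dist x y < \<delta>"
    and e: "\<And>u v. u \<in> B \<Longrightarrow> v \<in> B \<Longrightarrow> seq_dist u v \<le> seq_dist x y / 2 \<Longrightarrow> \<bar>h u - h v\<bar> \<le> e"
  let ?d = "seq_dist x y"
  have t0: "t \<ge> 0" using t[OF xy(1,1)] by simp
  have 1: "\<bar>L \<phi> h x - L \<phi> h y\<bar> \<le> e + E * ?d powr \<alpha> * t" by (rule L_smoothing[OF h t xy e])
  have "\<bar>L \<phi> (L \<phi> h) x - L \<phi> (L \<phi> h) y\<bar> \<le> (e + E * ?d powr \<alpha> * t) + E * ?d powr \<alpha> * t"
  proof (rule L_smoothing[OF L_continuous[OF \<phi> h] _ xy])
    fix u v assume uv: "u \<in> B" "v \<in> B"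
    obtain z where z: "z \<in> B" "\<And>w. w \<in> B \<Longrightarrow> h z \<le> h w"
      using continuous_attains_inf[OF compact_B nonempty h] by blast
    have "h z \<le> L \<phi> h w \<and> L \<phi> h w \<le> h z + t" if w: "w \<in> B" for w
    proof
      show "h z \<le> L \<phi> h w" using L_mono[OF \<phi> continuous_on_const h w z(2)] L_const[OF w] by simp
      have "h v \<le> h z + t" if "v \<in> B" for v using t[OF that z(1)] by (simp add: abs_le_iff)
      then show "L \<phi> h w \<le> h z + t"
        using L_mono[OF \<phi> h continuous_on_const w] L_const[OF w] by metis
    qed
    from this[OF uv(1)] this[OF uv(2)] show "\<bar>L \<phi> h u - L \<phi> h v\<bar> \<le> t" by linarith
    assume d: "seq_dist u v \<le> ?d / 2"
    have "\<bar>L \<phi> h u - L \<phi> h v\<bar> \<le> e + E * seq_dist u v powr \<alpha> * t"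
    proof (rule L_smoothing[OF h t uv])
      show "seq_dist u v < \<delta>" using d xy(3) d_nonneg[of x y] by linarith
      fix u' v' assume "u' \<in> B" "v' \<in> B" "seq_dist u' v' \<le> seq_dist u v / 2"
      then show "\<bar>h u' - h v'\<bar> \<le> e" using d d_nonneg[of u v] by (intro e) auto
    qed
    also have "\<dots> \<le> e + E * ?d powr \<alpha> * t"
      using d d_nonneg[of u v] d_nonneg[of x y] \<alpha> E(1) t0
      by (intro add_left_mono mult_right_mono mult_left_mono powr_mono2) auto
    finally show "\<bar>L \<phi> h u - L \<phi> h v\<bar> \<le> e + E * ?d powr \<alpha> * t" .
  qed
  moreover have "0 \<le> E * ?d powr \<alpha> * t" using E(1) t0 by simp
  moreover have "\<bar>1/2 * (a + b) - 1/2 * (a' + b')\<bar> \<le> e + 2 * w"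
    if "\<bar>a - a'\<bar> \<le> e + w" "\<bar>b - b'\<bar> \<le> (e + w) + w" "0 \<le> w" for a b a' b' w :: real
    using that by (auto simp: abs_le_iff field_simps)
  ultimately have "\<bar>slow h x - slow h y\<bar> \<le> e + 2 * (E * ?d powr \<alpha> * t)"
    unfolding slow_def using 1 by blast
  then show "\<bar>slow h x - slow h y\<bar> \<le> e + 2 * E * ?d powr \<alpha> * t" by (simp add: mult.assoc)
next
  fix g :: "(nat \<Rightarrow> 'a) \<Rightarrow> real" and z
  assume g: "continuous_on B g" "\<And>y. y \<in> B \<Longrightarrow> 0 \<le> g y" and z: "z \<in> B" "0 < g z"
  obtain n where n: "\<And>x. x \<in> B \<Longrightarrow> 0 < (lazy \<phi> ^^ n) g x"
    using lazy_primitive[OF \<phi> g z] by blast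
  have "0 < (L \<phi> ^^ k) ((lazy \<phi> ^^ n) g) x" if "x \<in> B" for k x
    using that
  proof (induction k arbitrary: x)
    case (Suc k)
    note c = L_iterate_continuous[OF \<phi> lazy_iterate_continuous[OF \<phi> g(1)]]
    obtain y where y: "y \<in> B" "x = shift y" using Suc.prems shift_onto by blast
    have "0 < L \<phi> ((L \<phi> ^^ k) ((lazy \<phi> ^^ n) g)) (shift y)"
      by (rule L_pos[OF \<phi> c _ y(1)]) (use Suc.IH y in \<open>auto intro: less_imp_le\<close>)
    then show ?case using y by simp
  qed (use n in simp)
  then show "\<exists>n. \<forall>x\<in>B. 0 < (slow ^^ n) g x" using slow_iterate[OF g(1)] by auto
qed

text \<open>
  Fixed functions of \<open>L\<close> are fixed by \<open>slow\<close>, whose iterates converge to constants.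
\<close>

lemma fixed_function_constant:
  fixes h :: "(nat \<Rightarrow> 'a) \<Rightarrow> real"
  assumes h: "continuous_on B h" and fixed: "\<And>x. x \<in> B \<Longrightarrow> L \<phi> h x = h x" and xy: "x \<in> B" "y \<in> B"
  shows "h x = h y"
proof -
  have 1: "slow h z = h z" if "z \<in> B" for z
  proof -
    have "L \<phi> (L \<phi> h) z = L \<phi> h z" by (rule fun_cong[OF L_cong]) (rule fixed)
    then show ?thesis unfolding slow_def using fixed[OF that] by simp
  qed
  have n: "(slow ^^ n) h z = h z" if "z \<in> B" for n z
    using that
  proof (induction n arbitrary: z)
    case (Suc n)
    have "slow ((slow ^^ n) h) z = slow h z" by (rule fun_cong[OF slow_cong]) (rule Suc.IH)
    then show ?case using 1[OF Suc.prems] by simp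
  qed simp
  obtain c where "uniform_limit B (\<lambda>n. (slow ^^ n) h) (\<lambda>_. c) sequentially"
    by (rule slow.iterates_converge[OF h])
  then have lim: "(\<lambda>n. (slow ^^ n) h z) \<longlonglongrightarrow> c" if "z \<in> B" for z using that tendsto_uniform_limitI by metis
  have "(\<lambda>n. h z) \<longlonglongrightarrow> c" if "z \<in> B" for z using lim[OF that] unfolding n[OF that] .
  then have "h z = c" if "z \<in> B" for z using that unfolding LIMSEQ_const_iff by blast
  then show ?thesis using xy by simp
qed

definition limit :: "((nat \<Rightarrow> 'a) \<Rightarrow> real) \<Rightarrow> real" where
  "limit h = (SOME c. uniform_limit B (\<lambda>n. (slow ^^ n) h) (\<lambda>_. c) sequentially)"

lemma limit_uniform:
  assumes "continuous_on B h"
  shows "uniform_limit B (\<lambda>n. (slow ^^ n) h) (\<lambda>_. limit h) sequentially"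
proof -
  obtain c where "uniform_limit B (\<lambda>n. (slow ^^ n) h) (\<lambda>_. c) sequentially"
    by (rule slow.iterates_converge[OF assms])
  then show ?thesis unfolding limit_def by (rule someI)
qed

lemma limit_tendsto: "continuous_on B h \<Longrightarrow> x \<in> B \<Longrightarrow> (\<lambda>n. (slow ^^ n) h x) \<longlonglongrightarrow> limit h"
  using tendsto_uniform_limitI[OF limit_uniform] .

lemma limit_eqI: "continuous_on B h \<Longrightarrow> x \<in> B \<Longrightarrow> (\<lambda>n. (slow ^^ n) h x) \<longlonglongrightarrow> c \<Longrightarrow> limit h = c"
  using limit_tendsto LIMSEQ_unique by blast

lemma limit_functional: "positive_functional B limit"
proof
  obtain z where z: "z \<in> B" using nonempty by blast
  show "compact B" by (rule compact_B)
  fix f g :: "(nat \<Rightarrow> 'a) \<Rightarrow> real" and c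
  show "limit f = limit g" if eq: "\<And>x. x \<in> B \<Longrightarrow> f x = g x"
  proof -
    have "(slow ^^ n) f x = (slow ^^ n) g x" if "x \<in> B" for n x
    proof (cases n)
      case (Suc m)
      have "slow f = slow g" by (rule slow_cong) (rule eq)
      then show ?thesis by (simp add: Suc funpow_Suc_right del: funpow.simps)
    qed (use eq that in simp)
    then have "uniform_limit B (\<lambda>n. (slow ^^ n) f) (\<lambda>_. c) sequentially
        \<longleftrightarrow> uniform_limit B (\<lambda>n. (slow ^^ n) g) (\<lambda>_. c) sequentially" for c
      by (intro uniform_limit_cong) auto
    then show ?thesis by (simp add: limit_def)
  qed
  assume f: "continuous_on B f"
  show "limit (\<lambda>x. c * f x) = c * limit f"
    by (rule limit_eqI[OF _ z])
       (use slow.iterate_affine[OF f z, of _ 0 c] tendsto_mult_left[OF limit_tendsto[OF f z]]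
        in \<open>auto intro!: continuous_intros f\<close>)
  show "0 \<le> limit f" if "\<And>x. x \<in> B \<Longrightarrow> 0 \<le> f x"
  proof (rule LIMSEQ_le_const[OF limit_tendsto[OF f z]])
    have "(slow ^^ n) (\<lambda>_. 0) z \<le> (slow ^^ n) f z" for n
      by (rule slow.iterate_mono[OF continuous_on_const f that z])
    moreover have "(slow ^^ n) (\<lambda>_. 0) z = 0" for n
      using slow.iterate_affine[OF f z, of n 0 0] by simp
    ultimately show "\<exists>N. \<forall>n\<ge>N. 0 \<le> (slow ^^ n) f z" by simp
  qed
  assume g: "continuous_on B g"
  show "limit (\<lambda>x. f x + g x) = limit f + limit g"
    by (rule limit_eqI[OF _ z])
       (use slow.iterate_add[OF f g z] tendsto_add[OF limit_tendsto[OF f z] limit_tendsto[OF g z]]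
        in \<open>auto intro!: continuous_intros f g\<close>)
next
  obtain z where z: "z \<in> B" using nonempty by blast
  have "(slow ^^ n) (\<lambda>_. 1) z = 1" for n
    using slow.iterate_affine[OF continuous_on_const z, of n 1 0 0] by simp
  then show "limit (\<lambda>_. 1) = 1" by (intro limit_eqI[OF _ z]) auto
qed

lemma slow_iterate_L:
  assumes "continuous_on B h" "x \<in> B"
  shows "(slow ^^ n) (L \<phi> h) x = L \<phi> ((slow ^^ n) h) x"
  using assms(2)
proof (induction n arbitrary: x)
  case (Suc n)
  have "slow ((slow ^^ n) (L \<phi> h)) x = slow (L \<phi> ((slow ^^ n) h)) x"
    by (rule fun_cong[OF slow_cong]) (rule Suc.IH)
  also have "\<dots> = L \<phi> (slow ((slow ^^ n) h)) x"
    by (rule slow_L[OF slow.iterate_continuous[OF assms(1)] Suc.prems])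
  finally show ?case by simp
qed simp

lemma limit_L:
  assumes h: "continuous_on B h"
  shows "limit (L \<phi> h) = limit h"
proof -
  obtain z where z: "z \<in> B" using nonempty by blast
  obtain b where b: "b > 0" "\<And>x. x \<in> B \<Longrightarrow> norm (h x) \<le> b" using bounded_B[OF h] by blast
  have "(\<lambda>n. L \<phi> ((slow ^^ n) h) z) \<longlonglongrightarrow> L \<phi> (\<lambda>_. limit h) z"
  proof (rule L_tendsto[OF \<phi> slow.iterate_continuous[OF h] continuous_on_const limit_tendsto[OF h] _ z])
    fix n y assume y: "y \<in> B"
    have "- b \<le> h x \<and> h x \<le> b" if "x \<in> B" for x using b(2)[OF that] by (simp add: abs_le_iff)
    from slow.iterate_between[OF h this y, of n]
    show "norm ((slow ^^ n) h y) \<le> b" by (simp add: abs_le_iff)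
  qed
  then show ?thesis
    using slow_iterate_L[OF h z] by (intro limit_eqI[OF L_continuous[OF \<phi> h] z]) (simp add: L_const z)
qed

text \<open>
  A fixed measure integrates all iterates of \<open>slow\<close> alike, and these converge to a constant. This
  gives uniqueness: the integrals of a fixed probability measure are determined.
\<close>

lemma fixed_measure_integral:
  fixes h :: "(nat \<Rightarrow> 'a) \<Rightarrow> real"
  assumes \<mu>: "prob_on B \<mu>" and fixed: "\<And>h :: (nat \<Rightarrow> 'a) \<Rightarrow> real. continuous_on B h \<Longrightarrow> (\<integral>x. L \<phi> h x \<partial>\<mu>) = (\<integral>x. h x \<partial>\<mu>)"
    and h: "continuous_on B h"
  shows "(\<integral>x. h x \<partial>\<mu>) = limit h"
proof -
  interpret prob_space \<mu> using \<mu> by (simp add: prob_on_def)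
  note int = prob_on_integrable[OF \<mu> compact_B]
  have slow: "(\<integral>x. slow g x \<partial>\<mu>) = (\<integral>x. g x \<partial>\<mu>)" if g: "continuous_on B g" for g
  proof -
    note c = L_continuous[OF \<phi> g] L_continuous[OF \<phi> L_continuous[OF \<phi> g]]
    have "(\<integral>x. slow g x \<partial>\<mu>) = 1/2 * ((\<integral>x. L \<phi> g x \<partial>\<mu>) + (\<integral>x. L \<phi> (L \<phi> g) x \<partial>\<mu>))"
      unfolding slow_def using int[OF c(1)] int[OF c(2)] by simp
    then show ?thesis using fixed[OF g] fixed[OF c(1)] by simp
  qed
  have n: "(\<integral>x. (slow ^^ n) h x \<partial>\<mu>) = (\<integral>x. h x \<partial>\<mu>)" for n
    by (induction n) (simp_all add: slow slow.iterate_continuous[OF h])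
  obtain b where b: "b > 0" "\<And>x. x \<in> B \<Longrightarrow> norm (h x) \<le> b" using bounded_B[OF h] by blast
  have "(\<lambda>n. \<integral>x. (slow ^^ n) h x \<partial>\<mu>) \<longlonglongrightarrow> (\<integral>x. limit h \<partial>\<mu>)"
  proof (rule integral_dominated_convergence[of _ _ _ "\<lambda>_. b"])
    show "AE x in \<mu>. (\<lambda>n. (slow ^^ n) h x) \<longlonglongrightarrow> limit h"
      by (intro AE_I2 limit_tendsto[OF h]) (simp add: prob_on_space[OF \<mu>])
    fix n
    show "(slow ^^ n) h \<in> borel_measurable \<mu>"
      by (rule prob_on_measurable[OF \<mu> slow.iterate_continuous[OF h]])
    have "norm ((slow ^^ n) h y) \<le> b" if y: "y \<in> B" for y
    proof -
      have "- b \<le> h x \<and> h x \<le> b" if "x \<in> B" for x using b(2)[OF that] by (simp add: abs_le_iff)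
      from slow.iterate_between[OF h this y, of n] show ?thesis by (simp add: abs_le_iff)
    qed
    then show "AE x in \<mu>. norm ((slow ^^ n) h x) \<le> b" by (intro AE_I2) (simp add: prob_on_space[OF \<mu>])
  qed auto
  then show ?thesis unfolding n by (simp add: prob_space LIMSEQ_const_iff)
qed

theorem invariant_prob:
  obtains \<mu> where "prob_on B \<mu>" "\<And>h. continuous_on B h \<Longrightarrow> (\<integral>x. h x \<partial>\<mu>) = limit h"
  using positive_functional.representing_measure[OF limit_functional] by blast

end

section \<open>Conjugation by an eigenfunction\<close>

lemma scale_measure_eq_density: "scale_measure r M = density M (\<lambda>_. r)"
  by (rule measure_eqI) (simp_all add: emeasure_density nn_integral_cmult)

text \<open>
  The image measure has the same integrals of continuous functions.
\<close>

lemma (in symbolic_system) shift_invariance: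
  assumes \<mu>: "prob_on B \<mu>"
    and inv: "\<And>h :: (nat \<Rightarrow> 'a) \<Rightarrow> real. continuous_on B h \<Longrightarrow> (\<integral>x. h (shift x) \<partial>\<mu>) = (\<integral>x. h x \<partial>\<mu>)"
  shows "invariant_measure shift \<mu>"
proof -
  interpret prob_space \<mu> using \<mu> by (simp add: prob_on_def)
  have sp: "space \<mu> = B" by (rule prob_on_space[OF \<mu>])
  from continuous_shift have "shift \<in> borel_measurable \<mu>" by (rule prob_on_measurable[OF \<mu>])
  then have meas: "shift \<in> measurable \<mu> (borel_on B)"
    by (rule measurable_restrict_space2[rotated]) (auto simp: sp shift_in)
  then have meas': "shift \<in> measurable \<mu> \<mu>"
    using measurable_cong_sets[of \<mu> \<mu> \<mu> "borel_on B"] \<mu> by (simp add: prob_on_def)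
  have "distr \<mu> \<mu> shift = \<mu>"
  proof (rule prob_on_eqI[OF compact_B _ \<mu>])
    show "prob_on B (distr \<mu> \<mu> shift)"
      using \<mu> prob_space_distr[OF meas'] by (simp add: prob_on_def)
    fix h :: "(nat \<Rightarrow> 'a) \<Rightarrow> real" assume "h \<in> cont_space B"
    then have h: "continuous_on B h" by (simp add: cont_space_def)
    show "(\<integral>x. h x \<partial>distr \<mu> \<mu> shift) = (\<integral>x. h x \<partial>\<mu>)"
      using integral_distr[OF meas' prob_on_measurable[OF \<mu> h]] inv[OF h] by simp
  qed
  then show ?thesis
    unfolding invariant_measure_def using emeasure_distr[OF meas'] by metis
qed

locale eigenpair = holder_potential A I \<nu> \<alpha> \<phi>
  for A :: "'a::metric_space \<times> 'a \<Rightarrow> real" and I :: "real set" and \<nu> :: "'a measure" and \<alpha> \<phi> +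
  fixes l :: real and f :: "(nat \<Rightarrow> 'a) \<Rightarrow> real"
  assumes l: "l > 0" and f_holder: "f \<in> holder_space \<alpha> B"
    and f_pos: "\<And>x. x \<in> B \<Longrightarrow> 0 < f x" and eigen: "\<And>x. x \<in> B \<Longrightarrow> L \<phi> f x = l * f x"
begin

interpretation F: holder_potential A I \<nu> \<alpha> f
  by unfold_locales (rule \<alpha> f_holder)+

lemma f_hol: obtains H where "H \<ge> 0" "\<And>x y. x \<in> B \<Longrightarrow> y \<in> B \<Longrightarrow> \<bar>f x - f y\<bar> \<le> H * seq_dist x y powr \<alpha>"
  using F.hol by blast

lemma f: "continuous_on B f" by (rule F.\<phi>)

lemma f_outside: "x \<notin> B \<Longrightarrow> f x = 0"
  using f_holder by (simp add: holder_space_def)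

lemma f_lower: obtains m where "m > 0" "\<And>x. x \<in> B \<Longrightarrow> m \<le> f x"
proof -
  obtain z where "z \<in> B" "\<And>x. x \<in> B \<Longrightarrow> f z \<le> f x"
    using continuous_attains_inf[OF compact_B nonempty f] by blast
  then show ?thesis using that[of "f z"] f_pos by blast
qed

abbreviation np :: "(nat \<Rightarrow> 'a) \<Rightarrow> real" where "np \<equiv> normalized_potential B \<phi> l f"

lemma np_holder: "np \<in> holder_space \<alpha> B"
proof -
  obtain m where m: "m > 0" "\<And>x. x \<in> B \<Longrightarrow> m \<le> f x" by (rule f_lower) blast
  obtain H where H: "H \<ge> 0" "\<And>x y. x \<in> B \<Longrightarrow> y \<in> B \<Longrightarrow> \<bar>f x - f y\<bar> \<le> H * seq_dist x y powr \<alpha>"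
    by (rule f_hol) blast
  have ln1: "ln (f x) - ln (f y) \<le> H / m * seq_dist x y powr \<alpha>" if xy: "x \<in> B" "y \<in> B" for x y
  proof -
    have "ln (f x) - ln (f y) \<le> (f x - f y) / f y" by (rule ln_diff_le[OF f_pos[OF xy(1)] f_pos[OF xy(2)]])
    also have "\<dots> \<le> (H * seq_dist x y powr \<alpha>) / m"
      using H(2)[OF xy] H(1) m(1) m(2)[OF xy(2)] by (intro frac_le) auto
    finally show ?thesis by simp
  qed
  have ln: "\<bar>ln (f x) - ln (f y)\<bar> \<le> H / m * seq_dist x y powr \<alpha>" if "x \<in> B" "y \<in> B" for x y
    using ln1[OF that] ln1[OF that(2,1)] by (simp add: seq_dist_commute abs_le_iff)
  have "\<bar>np x - np y\<bar> \<le> (hol + H / m + H / m * 2 powr \<alpha>) * seq_dist x y powr \<alpha>"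
    if xy: "x \<in> B" "y \<in> B" for x y
  proof -
    have "seq_dist (shift x) (shift y) powr \<alpha> \<le> (2 * seq_dist x y) powr \<alpha>"
      using \<alpha> by (intro powr_mono2 seq_dist_shift_le[OF compact_alphabet] d_nonneg) auto
    also have "\<dots> = 2 powr \<alpha> * seq_dist x y powr \<alpha>" by (rule powr_mult)
    finally have "H / m * seq_dist (shift x) (shift y) powr \<alpha> \<le> H / m * (2 powr \<alpha> * seq_dist x y powr \<alpha>)"
      using H(1) m(1) by (intro mult_left_mono) auto
    then have "\<bar>ln (f (shift x)) - ln (f (shift y))\<bar> \<le> H / m * 2 powr \<alpha> * seq_dist x y powr \<alpha>"
      using ln[OF shift_in[OF xy(1)] shift_in[OF xy(2)]] by simp
    moreover have "np x - np y = (\<phi> x - \<phi> y) + (ln (f x) - ln (f y)) - (ln (f (shift x)) - ln (f (shift y)))"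
      using xy by (simp add: normalized_potential_def)
    ultimately show ?thesis
      using hol(2)[OF xy] ln[OF xy] by (simp add: distrib_right)
  qed
  then show ?thesis unfolding holder_space_def by (auto simp: normalized_potential_def)
qed

text \<open>
  At the point \<open>ax\<close> the normalizing factors of the weight are \<open>f (ax) / (l * f x)\<close>, since the shift takes
  \<open>ax\<close> back to \<open>x\<close>.
\<close>

lemma conjugate:
  fixes h :: "(nat \<Rightarrow> 'a) \<Rightarrow> 'b::{banach, second_countable_topology}"
  assumes x: "x \<in> B"
  shows "L np h x = (1 / (l * f x)) *\<^sub>R L \<phi> (\<lambda>y. f y *\<^sub>R h y) x"
proof -
  have "exp (np (case_nat a x)) *\<^sub>R h (case_nat a x) =
      (1 / (l * f x)) *\<^sub>R (exp (\<phi> (case_nat a x)) *\<^sub>R (f (case_nat a x) *\<^sub>R h (case_nat a x)))"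
    if a: "a \<in> preds x" for a
  proof -
    have u: "case_nat a x \<in> B" by (rule cons_in[OF x a])
    have "exp (np (case_nat a x)) = exp (\<phi> (case_nat a x)) * f (case_nat a x) / f x / l"
      using u f_pos[OF u] f_pos[OF x] l by (simp add: normalized_potential_def exp_add exp_diff)
    then show ?thesis by (simp add: mult.commute)
  qed
  then have "L np h x = (LINT a:preds x|\<nu>. (1 / (l * f x)) *\<^sub>R (exp (\<phi> (case_nat a x)) *\<^sub>R (f (case_nat a x) *\<^sub>R h (case_nat a x))))"
    unfolding L_eq[OF x] by (intro set_lebesgue_integral_cong preds_sets) auto
  also have "\<dots> = (1 / (l * f x)) *\<^sub>R L \<phi> (\<lambda>y. f y *\<^sub>R h y) x"
    unfolding L_eq[OF x] by (rule set_integral_scaleR_right)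
  finally show ?thesis .
qed

lemma conjugate_back:
  fixes h :: "(nat \<Rightarrow> 'a) \<Rightarrow> 'b::{banach, second_countable_topology}"
  assumes x: "x \<in> B"
  shows "L \<phi> h x = (l * f x) *\<^sub>R L np (\<lambda>y. (1 / f y) *\<^sub>R h y) x"
proof -
  have "L \<phi> (\<lambda>y. f y *\<^sub>R ((1 / f y) *\<^sub>R h y)) = L \<phi> h"
    by (rule L_cong) (use f_pos in force)
  then show ?thesis unfolding conjugate[OF x] using f_pos[OF x] l by simp
qed

sublocale N: normalized_holder_potential A I \<nu> \<alpha> np
proof unfold_locales
  show "\<alpha> > 0" by (rule \<alpha>)
  show "np \<in> holder_space \<alpha> B" by (rule np_holder)
  fix x assume x: "x \<in> B"
  show "L np (\<lambda>_. 1 :: real) x = 1"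
    unfolding conjugate[OF x] using eigen[OF x] f_pos[OF x] l by simp
qed

text \<open>
  The quotient of \<open>h\<close> by \<open>f\<close> is a fixed function of the normalized operator.
\<close>

lemma real_eigenfunction:
  fixes h :: "(nat \<Rightarrow> 'a) \<Rightarrow> real"
  assumes h: "continuous_on B h" and e: "\<And>x. x \<in> B \<Longrightarrow> L \<phi> h x = l * h x"
  obtains c where "\<And>x. x \<in> B \<Longrightarrow> h x = c * f x"
proof -
  obtain z where z: "z \<in> B" using nonempty by blast
  have c: "continuous_on B (\<lambda>y. 1 / f y * h y)"
    by (intro continuous_intros f h) (use f_pos in force)
  have "L np (\<lambda>y. 1 / f y * h y) x = 1 / f x * h x" if x: "x \<in> B" for x
  proof -
    have "l * f x * L np (\<lambda>y. 1 / f y * h y) x = l * h x"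
      using conjugate_back[OF x, of h] unfolding e[OF x] real_scaleR_def by (rule sym)
    then have "f x * L np (\<lambda>y. 1 / f y * h y) x = h x" using l by simp
    then show ?thesis using f_pos[OF x] by (simp add: nonzero_eq_divide_eq mult.commute)
  qed
  from N.fixed_function_constant[OF c this _ z]
  have *: "1 / f x * h x = 1 / f z * h z" if "x \<in> B" for x using that by blast
  have "h x = (1 / f z * h z) * f x" if x: "x \<in> B" for x
    using *[OF x] f_pos[OF x] by (metis less_irrefl mult.commute nonzero_mult_div_cancel_left times_divide_eq_left mult_1)
  then show ?thesis by (rule that)
qed

text \<open>
  Compare \<open>\<bar>h\<bar>\<close> with \<open>m * f\<close> at a point where the quotient \<open>\<bar>h\<bar> / f\<close> attains its maximum \<open>m\<close>.
\<close>

lemma eigenvalue_bound: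
  fixes h :: "(nat \<Rightarrow> 'a) \<Rightarrow> complex"
  assumes h: "continuous_on B h" and e: "\<And>x. x \<in> B \<Longrightarrow> L \<phi> h x = z * h x" and w: "w \<in> B" "h w \<noteq> 0"
  shows "cmod z \<le> l"
proof -
  have c: "continuous_on B (\<lambda>y. cmod (h y) / f y)"
    by (intro continuous_intros f h) (use f_pos in force)
  obtain x where x: "x \<in> B" "\<And>y. y \<in> B \<Longrightarrow> cmod (h y) / f y \<le> cmod (h x) / f x"
    using continuous_attains_sup[OF compact_B nonempty c] by blast
  let ?m = "cmod (h x) / f x"
  have "0 < cmod (h w) / f w" using w f_pos by simp
  then have m: "0 < ?m" using x(2)[OF w(1)] by linarith
  have hm: "cmod (h y) \<le> ?m * f y" if "y \<in> B" for y
    using x(2)[OF that] f_pos[OF that] by (simp add: pos_divide_le_eq)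
  have "cmod z * cmod (h x) = cmod (L \<phi> h x)" using e[OF x(1)] by (simp add: norm_mult)
  also have "\<dots> \<le> L \<phi> (\<lambda>y. cmod (h y)) x" by (rule L_norm_le[OF \<phi> h x(1)])
  also have "\<dots> \<le> L \<phi> (\<lambda>y. ?m * f y) x"
    by (rule L_mono[OF \<phi> _ _ x(1) hm]) (intro continuous_intros f h)+
  also have "\<dots> = ?m * (l * f x)" by (simp only: L_mult eigen[OF x(1)])
  also have "\<dots> = l * cmod (h x)" using f_pos[OF x(1)] by simp
  finally have "cmod z * cmod (h x) \<le> l * cmod (h x)" .
  moreover have "0 < cmod (h x)" using m f_pos[OF x(1)] by (simp add: zero_less_divide_iff)
  ultimately show ?thesis by simp
qed

lemma dual_fixed_integral:
  assumes \<mu>: "prob_on B \<mu>" and dual: "ruelle_dual \<nu> A I np \<mu> \<mu>" and h: "continuous_on B h"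
  shows "(\<integral>x. h x \<partial>\<mu>) = N.limit h"
proof (rule N.fixed_measure_integral[OF \<mu> _ h])
  fix h :: "(nat \<Rightarrow> 'a) \<Rightarrow> real" assume h: "continuous_on B h"
  define k where "k x = (if x \<in> B then h x else 0)" for x
  have "continuous_on B k" using h by (rule continuous_on_eq) (simp add: k_def)
  then have "k \<in> cont_space B" by (simp add: cont_space_def k_def)
  then have "(\<integral>x. k x \<partial>\<mu>) = (\<integral>x. L np k x \<partial>\<mu>)" using dual by (simp add: ruelle_dual_def)
  moreover have "(\<integral>x. k x \<partial>\<mu>) = (\<integral>x. h x \<partial>\<mu>)"
    by (rule Bochner_Integration.integral_cong) (auto simp: prob_on_space[OF \<mu>] k_def)
  moreover have "L np k = L np h" by (rule L_cong) (simp add: k_def)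
  ultimately show "(\<integral>x. L np h x \<partial>\<mu>) = (\<integral>x. h x \<partial>\<mu>)" by simp
qed

lemma invariant_prob_dual:
  assumes \<mu>: "prob_on B \<mu>" and lim: "\<And>h. continuous_on B h \<Longrightarrow> (\<integral>x. h x \<partial>\<mu>) = N.limit h"
  shows "ruelle_dual \<nu> A I np \<mu> \<mu>"
  unfolding ruelle_dual_def
proof (intro conjI ballI)
  show "finite_measure \<mu>" using \<mu> by (simp add: prob_on_def prob_space_def)
  show "sets \<mu> = sets (borel_on B)" using \<mu> by (simp add: prob_on_def)
  fix h :: "(nat \<Rightarrow> 'a) \<Rightarrow> real" assume "h \<in> cont_space B"
  then have h: "continuous_on B h" by (simp add: cont_space_def)
  show "(\<integral>x. h x \<partial>\<mu>) = (\<integral>x. L np h x \<partial>\<mu>)"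
    by (simp add: lim h L_continuous[OF N.\<phi>] N.limit_L)
qed

text \<open>
  The normalized operator averages over preimages, so it sends \<open>h \<circ> shift\<close> back to \<open>h\<close>.
\<close>

lemma invariant_prob_shift:
  assumes \<mu>: "prob_on B \<mu>" and lim: "\<And>h. continuous_on B h \<Longrightarrow> (\<integral>x. h x \<partial>\<mu>) = N.limit h"
  shows "invariant_measure shift \<mu>"
proof (rule shift_invariance[OF \<mu>])
  fix h :: "(nat \<Rightarrow> 'a) \<Rightarrow> real" assume h: "continuous_on B h"
  from continuous_shift have hs: "continuous_on B (\<lambda>x. h (shift x))"
    by (rule continuous_on_compose2[OF h]) (auto simp: shift_in)
  have "L np (\<lambda>x. h (shift x)) x = h x" if x: "x \<in> B" for x
  proof -
    have "L np (\<lambda>y. h (shift y)) x = L np (\<lambda>_. h x) x" by (simp add: L_eq[OF x])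
    then show ?thesis by (simp add: N.L_const[OF x])
  qed
  then have "(\<integral>x. L np (\<lambda>x. h (shift x)) x \<partial>\<mu>) = (\<integral>x. h x \<partial>\<mu>)"
    by (intro Bochner_Integration.integral_cong) (auto simp: prob_on_space[OF \<mu>])
  moreover have "(\<integral>x. L np (\<lambda>x. h (shift x)) x \<partial>\<mu>) = (\<integral>x. h (shift x) \<partial>\<mu>)"
    by (simp add: lim hs L_continuous[OF N.\<phi> hs] N.limit_L)
  ultimately show "(\<integral>x. h (shift x) \<partial>\<mu>) = (\<integral>x. h x \<partial>\<mu>)" by simp
qed

text \<open>
  Conjugation also acts on measures: dividing the fixed measure of the normalized operator by \<open>f\<close>
  gives an eigenmeasure of \<open>L\<close>. The condition on the mean makes it a probability measure.
\<close>

lemma eigenmeasure: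
  assumes \<mu>: "prob_on B \<mu>" and lim: "\<And>h. continuous_on B h \<Longrightarrow> (\<integral>x. h x \<partial>\<mu>) = N.limit h"
    and mean: "(\<integral>x. 1 / f x \<partial>\<mu>) = 1"
  defines "\<rho> \<equiv> density \<mu> (\<lambda>x. ennreal (1 / f x))"
  shows "prob_on B \<rho>" "ruelle_dual \<nu> A I \<phi> \<rho> (scale_measure (ennreal l) \<rho>)"
    "\<mu> = density \<rho> (\<lambda>x. ennreal (f x))"
proof -
  have sp: "space \<mu> = B" by (rule prob_on_space[OF \<mu>])
  have invc: "continuous_on B (\<lambda>x. 1 / f x)" by (intro continuous_intros f) (use f_pos in force)
  have [measurable]: "f \<in> borel_measurable \<mu>" "(\<lambda>x. 1 / f x) \<in> borel_measurable \<mu>"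
    by (rule prob_on_measurable[OF \<mu> f], rule prob_on_measurable[OF \<mu> invc])
  have pos: "AE x in \<mu>. 0 \<le> 1 / f x" using f_pos by (intro AE_I2) (simp add: sp less_imp_le)
  have sets: "sets \<rho> = sets (borel_on B)" using \<mu> by (simp add: \<rho>_def prob_on_def)
  have "emeasure \<rho> (space \<rho>) = (\<integral>\<^sup>+x. ennreal (1 / f x) \<partial>\<mu>)"
    unfolding \<rho>_def by (simp add: emeasure_density cong: nn_integral_cong)
  also have "\<dots> = ennreal (\<integral>x. 1 / f x \<partial>\<mu>)"
    by (rule nn_integral_eq_integral[OF prob_on_integrable[OF \<mu> compact_B invc] pos])
  finally have "prob_space \<rho>" by (intro prob_spaceI) (simp add: mean)
  with sets show prob: "prob_on B \<rho>" by (simp add: prob_on_def)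
  have int_\<rho>: "(\<integral>x. g x \<partial>\<rho>) = (\<integral>x. 1 / f x * g x \<partial>\<mu>)" if "continuous_on B g" for g :: "(nat \<Rightarrow> 'a) \<Rightarrow> real"
    unfolding \<rho>_def using integral_density[OF prob_on_measurable[OF \<mu> that] _ pos] by simp
  show "ruelle_dual \<nu> A I \<phi> \<rho> (scale_measure (ennreal l) \<rho>)"
    unfolding ruelle_dual_def
  proof (intro conjI ballI)
    show "finite_measure (scale_measure (ennreal l) \<rho>)"
      using prob_space.emeasure_space_1[OF \<open>prob_space \<rho>\<close>]
      by (intro finite_measureI) (simp add: space_scale_measure)
    show "sets (scale_measure (ennreal l) \<rho>) = sets (borel_on B)" by (simp add: sets)
    fix h :: "(nat \<Rightarrow> 'a) \<Rightarrow> real" assume "h \<in> cont_space B"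
    then have h: "continuous_on B h" by (simp add: cont_space_def)
    have hf: "continuous_on B (\<lambda>y. 1 / f y * h y)" by (intro continuous_on_mult invc h)
    have "(\<integral>x. h x \<partial>scale_measure (ennreal l) \<rho>) = l * (\<integral>x. h x \<partial>\<rho>)"
      unfolding scale_measure_eq_density
      using integral_density[OF prob_on_measurable[OF prob h], of "\<lambda>_. l"] l by simp
    also have "\<dots> = l * (\<integral>x. 1 / f x * h x \<partial>\<mu>)" by (simp add: int_\<rho>[OF h])
    also have "(\<integral>x. 1 / f x * h x \<partial>\<mu>) = (\<integral>x. L np (\<lambda>y. 1 / f y * h y) x \<partial>\<mu>)"
      by (simp only: lim[OF hf] lim[OF L_continuous[OF N.\<phi> hf]] N.limit_L[OF hf])
    also have "l * \<dots> = (\<integral>x. l * L np (\<lambda>y. 1 / f y * h y) x \<partial>\<mu>)" by simp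
    also have "\<dots> = (\<integral>x. 1 / f x * L \<phi> h x \<partial>\<mu>)"
    proof (rule Bochner_Integration.integral_cong[OF refl])
      fix x assume "x \<in> space \<mu>"
      then have x: "x \<in> B" by (simp add: sp)
      have "L \<phi> h x = (l * f x) * L np (\<lambda>y. 1 / f y * h y) x" using conjugate_back[OF x, of h] by simp
      then show "l * L np (\<lambda>y. 1 / f y * h y) x = 1 / f x * L \<phi> h x"
        using f_pos[OF x] by simp
    qed
    also have "\<dots> = (\<integral>x. L \<phi> h x \<partial>\<rho>)" by (simp add: int_\<rho>[OF L_continuous[OF \<phi> h]])
    finally show "(\<integral>x. h x \<partial>scale_measure (ennreal l) \<rho>) = (\<integral>x. L \<phi> h x \<partial>\<rho>)" .
  qed
  have "density \<rho> (\<lambda>x. ennreal (f x)) = density \<mu> (\<lambda>x. ennreal (1 / f x) * ennreal (f x))"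
    unfolding \<rho>_def by (rule density_density_eq) measurable
  also have "\<dots> = density \<mu> (\<lambda>_. 1)"
  proof (rule density_cong)
    show "AE x in \<mu>. ennreal (1 / f x) * ennreal (f x) = 1"
    proof (intro AE_I2)
      fix x assume "x \<in> space \<mu>"
      then have "0 < f x" by (simp add: sp f_pos)
      then show "ennreal (1 / f x) * ennreal (f x) = 1" by (simp add: ennreal_mult[symmetric])
    qed
  qed measurable
  finally show "\<mu> = density \<rho> (\<lambda>x. ennreal (f x))" by (simp add: density_1)
qed

end

section \<open>Complex Hoelder functions\<close>

lemma (in symbolic_system) L_Re_Im:
  fixes h :: "(nat \<Rightarrow> 'a) \<Rightarrow> complex"
  assumes "continuous_on B \<phi>" "continuous_on B h" "x \<in> B"
  shows "Re (L \<phi> h x) = L \<phi> (\<lambda>y. Re (h y)) x" "Im (L \<phi> h x) = L \<phi> (\<lambda>y. Im (h y)) x"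
proof -
  have i: "integrable \<nu> (\<lambda>a. indicat_real (preds x) a *\<^sub>R exp (\<phi> (case_nat a x)) *\<^sub>R h (case_nat a x))"
    using L_integrable[OF assms] by (simp add: set_integrable_def)
  show "Re (L \<phi> h x) = L \<phi> (\<lambda>y. Re (h y)) x"
    unfolding L_eq[OF assms(3)] set_lebesgue_integral_def
    using integral_bounded_linear[OF bounded_linear_Re i] by (simp add: mult.assoc)
  show "Im (L \<phi> h x) = L \<phi> (\<lambda>y. Im (h y)) x"
    unfolding L_eq[OF assms(3)] set_lebesgue_integral_def
    using integral_bounded_linear[OF bounded_linear_Im i] by (simp add: mult.assoc)
qed

context holder_potential
begin

text \<open>
  One number that bounds the values and the Hoelder constant. It is comparable to the Hoelder norm by
  \<open>holder_norm_le\<close> and \<open>hbound_holder_norm\<close>, and handier than a sum of two suprema.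
\<close>

definition hbound :: "((nat \<Rightarrow> 'a) \<Rightarrow> 'b::real_normed_vector) \<Rightarrow> real \<Rightarrow> bool" where
  "hbound h b \<longleftrightarrow> (\<forall>x\<in>B. norm (h x) \<le> b) \<and> (\<forall>x\<in>B. \<forall>y\<in>B. norm (h x - h y) \<le> b * seq_dist x y powr \<alpha>)"

lemma hboundD:
  assumes "hbound h b"
  shows "x \<in> B \<Longrightarrow> norm (h x) \<le> b" "x \<in> B \<Longrightarrow> y \<in> B \<Longrightarrow> norm (h x - h y) \<le> b * seq_dist x y powr \<alpha>"
  using assms by (auto simp: hbound_def)

lemma hbound_nonneg: "hbound h b \<Longrightarrow> 0 \<le> b"
  using nonempty hboundD(1) norm_ge_zero order_trans by blast

lemma hbound_continuous: "hbound h b \<Longrightarrow> continuous_on B h"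
  by (rule holder_continuous_on[OF compact_alphabet \<alpha> zero_less_one]) (rule hboundD(2))

lemma hbound_mono:
  assumes "hbound h b" "b \<le> c" shows "hbound h c"
proof -
  have "b * seq_dist x y powr \<alpha> \<le> c * seq_dist x y powr \<alpha>" for x y
    using assms(2) by (rule mult_right_mono) simp
  then show ?thesis using assms unfolding hbound_def by (meson order_trans)
qed

lemma hbound_add:
  assumes "hbound g a" "hbound h b" shows "hbound (\<lambda>x. g x + h x) (a + b)"
  unfolding hbound_def
proof (intro conjI ballI)
  fix x assume x: "x \<in> B"
  show "norm (g x + h x) \<le> a + b"
    using norm_triangle_mono[OF hboundD(1)[OF assms(1) x] hboundD(1)[OF assms(2) x]] .
  fix y assume y: "y \<in> B"
  have "norm ((g x + h x) - (g y + h y)) = norm ((g x - g y) + (h x - h y))" by (simp add: algebra_simps)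
  also have "\<dots> \<le> a * seq_dist x y powr \<alpha> + b * seq_dist x y powr \<alpha>"
    by (rule norm_triangle_mono[OF hboundD(2)[OF assms(1) x y] hboundD(2)[OF assms(2) x y]])
  finally show "norm ((g x + h x) - (g y + h y)) \<le> (a + b) * seq_dist x y powr \<alpha>"
    by (simp add: distrib_right)
qed

lemma hbound_scaleR:
  assumes "hbound c a" "hbound h b"
  shows "hbound (\<lambda>x. c x *\<^sub>R h x) (2 * a * b)"
  unfolding hbound_def
proof (intro conjI ballI)
  note nn = hbound_nonneg[OF assms(1)] hbound_nonneg[OF assms(2)]
  fix x assume x: "x \<in> B"
  have "norm (c x *\<^sub>R h x) \<le> a * b"
    using mult_mono[OF hboundD(1)[OF assms(1) x] hboundD(1)[OF assms(2) x]] nn by simp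
  also have "\<dots> \<le> 2 * a * b" using nn by simp
  finally show "norm (c x *\<^sub>R h x) \<le> 2 * a * b" .
  fix y assume y: "y \<in> B"
  let ?d = "seq_dist x y powr \<alpha>"
  have "c x *\<^sub>R h x - c y *\<^sub>R h y = c x *\<^sub>R (h x - h y) + (c x - c y) *\<^sub>R h y"
    by (simp add: algebra_simps)
  also have "norm \<dots> \<le> norm (c x) * norm (h x - h y) + norm (c x - c y) * norm (h y)"
    by (rule order_trans[OF norm_triangle_ineq]) simp
  also have "\<dots> \<le> a * (b * ?d) + (a * ?d) * b"
    using nn by (intro add_mono mult_mono hboundD[OF assms(1)] hboundD[OF assms(2)] x y) auto
  finally show "norm (c x *\<^sub>R h x - c y *\<^sub>R h y) \<le> 2 * a * b * ?d" by (simp add: mult_ac)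
qed

lemma hbound_const: "hbound (\<lambda>_. m) (norm m)"
  by (simp add: hbound_def)

lemma hbound_cmult:
  fixes h :: "(nat \<Rightarrow> 'a) \<Rightarrow> 'b::real_normed_field"
  assumes "hbound h b" shows "hbound (\<lambda>x. z * h x) (norm z * b)"
proof -
  have "norm (z * h x - z * h y) = norm z * norm (h x - h y)" for x y
    by (simp add: right_diff_distrib[symmetric] norm_mult)
  then show ?thesis
    using assms unfolding hbound_def by (simp add: norm_mult mult_left_mono mult.assoc)
qed

lemma hbound_cong: "(\<And>x. x \<in> B \<Longrightarrow> g x = h x) \<Longrightarrow> hbound g b \<Longrightarrow> hbound h b"
  by (simp add: hbound_def)

lemma hbound_sum:
  fixes N :: nat
  assumes "\<And>n. hbound (a n) (c n)"
  shows "hbound (\<lambda>x. \<Sum>n<N. a n x) (\<Sum>n<N. c n)"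
proof (induction N)
  case 0
  show ?case by (simp add: hbound_def)
next
  case (Suc N)
  from hbound_add[OF Suc assms[of N]] show ?case by simp
qed

lemma hbound_limit:
  assumes "\<And>n. hbound (h n) b" "\<And>x. x \<in> B \<Longrightarrow> (\<lambda>n. h n x) \<longlonglongrightarrow> g x"
  shows "hbound g b"
  unfolding hbound_def
proof (intro conjI ballI)
  fix x assume x: "x \<in> B"
  show "norm (g x) \<le> b"
    by (rule LIMSEQ_le_const2[OF tendsto_norm[OF assms(2)[OF x]]]) (use hboundD(1)[OF assms(1) x] in auto)
  fix y assume y: "y \<in> B"
  show "norm (g x - g y) \<le> b * seq_dist x y powr \<alpha>"
    by (rule LIMSEQ_le_const2[OF tendsto_norm[OF tendsto_diff[OF assms(2)[OF x] assms(2)[OF y]]]])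
       (use hboundD(2)[OF assms(1) x y] in auto)
qed

lemma holder_space_iff: "h \<in> holder_space \<alpha> B \<longleftrightarrow> (\<forall>x. x \<notin> B \<longrightarrow> h x = 0) \<and> (\<exists>b. hbound h b)"
proof
  assume h: "h \<in> holder_space \<alpha> B"
  then obtain H where H: "\<And>x y. x \<in> B \<Longrightarrow> y \<in> B \<Longrightarrow> norm (h x - h y) \<le> H * seq_dist x y powr \<alpha>"
    by (auto simp: holder_space_def)
  have "continuous_on B h"
    by (rule holder_continuous_on[OF compact_alphabet \<alpha> zero_less_one]) (rule H)
  then obtain b where b: "b > 0" "\<And>x. x \<in> B \<Longrightarrow> norm (h x) \<le> b" using bounded_B by blast
  have "hbound h (max b H)"
    unfolding hbound_def
  proof (intro conjI ballI)
    fix x assume x: "x \<in> B"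
    show "norm (h x) \<le> max b H" using b(2)[OF x] by simp
    fix y assume y: "y \<in> B"
    show "norm (h x - h y) \<le> max b H * seq_dist x y powr \<alpha>"
      by (rule order_trans[OF H[OF x y]], rule mult_right_mono) auto
  qed
  then show "(\<forall>x. x \<notin> B \<longrightarrow> h x = 0) \<and> (\<exists>b. hbound h b)" using h by (auto simp: holder_space_def)
next
  assume "(\<forall>x. x \<notin> B \<longrightarrow> h x = 0) \<and> (\<exists>b. hbound h b)"
  then show "h \<in> holder_space \<alpha> B" unfolding holder_space_def hbound_def by blast
qed

lemma holder_norm_le:
  assumes h: "hbound h b" shows "holder_norm \<alpha> B h \<le> 2 * b"
proof -
  have "(SUP x\<in>B. norm (h x)) \<le> b"
    by (rule cSUP_least[OF nonempty hboundD(1)[OF h]])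
  moreover have "(SUP (x, y)\<in>B \<times> B. norm (h x - h y) / seq_dist x y powr \<alpha>) \<le> b"
  proof (rule cSUP_least)
    show "B \<times> B \<noteq> {}" using nonempty by blast
    fix p assume "p \<in> B \<times> B"
    then obtain x y where p: "p = (x, y)" "x \<in> B" "y \<in> B" by auto
    have "norm (h x - h y) / seq_dist x y powr \<alpha> \<le> b"
    proof (cases "x = y")
      case True
      then show ?thesis using hbound_nonneg[OF h] by simp
    next
      case False
      then have "0 < seq_dist x y powr \<alpha>" using seq_dist_pos[OF compact_alphabet] by force
      then show ?thesis using hboundD(2)[OF h p(2,3)] by (simp add: pos_divide_le_eq)
    qed
    then show "(case p of (x, y) \<Rightarrow> norm (h x - h y) / seq_dist x y powr \<alpha>) \<le> b" by (simp add: p)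
  qed
  ultimately show ?thesis by (simp add: holder_norm_def)
qed

lemma hbound_holder_norm:
  assumes h: "h \<in> holder_space \<alpha> B" shows "hbound h (holder_norm \<alpha> B h)"
proof -
  obtain b where b: "hbound h b" using h holder_space_iff by blast
  let ?S = "SUP x\<in>B. norm (h x)"
  let ?H = "SUP (x, y)\<in>B \<times> B. norm (h x - h y) / seq_dist x y powr \<alpha>"
  have S: "norm (h x) \<le> ?S" if "x \<in> B" for x
    by (rule cSUP_upper[OF that]) (use hboundD(1)[OF b] in \<open>auto intro!: bdd_aboveI\<close>)
  have H: "norm (h x - h y) / seq_dist x y powr \<alpha> \<le> ?H" if "x \<in> B" "y \<in> B" for x y
  proof -
    have "bdd_above ((\<lambda>(x, y). norm (h x - h y) / seq_dist x y powr \<alpha>) ` (B \<times> B))"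
    proof (rule bdd_aboveI)
      fix r assume "r \<in> (\<lambda>(x, y). norm (h x - h y) / seq_dist x y powr \<alpha>) ` (B \<times> B)"
      then obtain u v where uv: "u \<in> B" "v \<in> B" "r = norm (h u - h v) / seq_dist u v powr \<alpha>" by auto
      show "r \<le> b"
      proof (cases "u = v")
        case True
        then show ?thesis using uv hbound_nonneg[OF b] by simp
      next
        case False
        then have "0 < seq_dist u v powr \<alpha>" using seq_dist_pos[OF compact_alphabet] by force
        then show ?thesis using hboundD(2)[OF b uv(1,2)] by (simp add: uv(3) pos_divide_le_eq)
      qed
    qed
    from cSUP_upper[OF _ this, of "(x, y)"] that show ?thesis by simp
  qed
  obtain z where z: "z \<in> B" using nonempty by blast
  have S0: "0 \<le> ?S" using S[OF z] norm_ge_zero order_trans by blast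
  have H0: "0 \<le> ?H" using H[OF z z] by simp
  show ?thesis
    unfolding hbound_def holder_norm_def
  proof (intro conjI ballI)
    fix x assume x: "x \<in> B"
    show "norm (h x) \<le> ?S + ?H" using S[OF x] H0 by simp
    fix y assume y: "y \<in> B"
    show "norm (h x - h y) \<le> (?S + ?H) * seq_dist x y powr \<alpha>"
    proof (cases "x = y")
      case False
      then have "0 < seq_dist x y powr \<alpha>" using seq_dist_pos[OF compact_alphabet] by force
      then have "norm (h x - h y) \<le> ?H * seq_dist x y powr \<alpha>" using H[OF x y] by (simp add: pos_divide_le_eq)
      also have "\<dots> \<le> (?S + ?H) * seq_dist x y powr \<alpha>" using S0 by (intro mult_right_mono) auto
      finally show ?thesis .
    qed simp
  qed
qed

end

section \<open>Simplicity and the spectral gap\<close>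

context eigenpair
begin

lemma hbound_f: obtains b where "b > 0" "hbound f b" "hbound (\<lambda>x. 1 / f x) b"
proof -
  obtain m where m: "m > 0" "\<And>x. x \<in> B \<Longrightarrow> m \<le> f x" by (rule f_lower) blast
  obtain b where b: "hbound f b" using f_holder holder_space_iff by blast
  have b0: "b \<ge> 0" by (rule hbound_nonneg[OF b])
  have "hbound (\<lambda>x. 1 / f x) (max (1 / m) (b / (m * m)))"
    unfolding hbound_def
  proof (intro conjI ballI)
    fix x assume x: "x \<in> B"
    have "1 / f x \<le> 1 / m" using m(1) m(2)[OF x] by (intro frac_le) auto
    then show "norm (1 / f x) \<le> max (1 / m) (b / (m * m))" using f_pos[OF x] by simp
    fix y assume y: "y \<in> B"
    have "\<bar>1 / f x - 1 / f y\<bar> = \<bar>f x - f y\<bar> / (f x * f y)"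
      using f_pos[OF x] f_pos[OF y] by (simp add: field_simps abs_mult abs_divide abs_minus_commute)
    also have "\<dots> \<le> (b * seq_dist x y powr \<alpha>) / (m * m)"
    proof (rule frac_le)
      show "\<bar>f x - f y\<bar> \<le> b * seq_dist x y powr \<alpha>" using hboundD(2)[OF b x y] by simp
      show "m * m \<le> f x * f y" using m(1) m(2)[OF x] m(2)[OF y] by (intro mult_mono) auto
    qed (use b0 m(1) in auto)
    also have "\<dots> = b / (m * m) * seq_dist x y powr \<alpha>" by simp
    also have "\<dots> \<le> max (1 / m) (b / (m * m)) * seq_dist x y powr \<alpha>" by (rule mult_right_mono) auto
    finally show "norm (1 / f x - 1 / f y) \<le> max (1 / m) (b / (m * m)) * seq_dist x y powr \<alpha>" by simp
  qed
  note b' = this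
  define c where "c = max 1 (max b (max (1 / m) (b / (m * m))))"
  have "hbound f c" by (rule hbound_mono[OF b]) (simp add: c_def)
  moreover have "hbound (\<lambda>x. 1 / f x) c" by (rule hbound_mono[OF b']) (simp only: c_def max.cobounded2 max.coboundedI2)
  ultimately
  show ?thesis by (intro that[of c]) (auto simp: c_def)
qed

lemma simple_eigenvalue:
  "simple_eigenvalue (L \<phi> :: ((nat \<Rightarrow> 'a) \<Rightarrow> complex) \<Rightarrow> _) (holder_space \<alpha> B) (of_real l)"
  unfolding simple_eigenvalue_def
proof (intro exI conjI)
  let ?g = "\<lambda>x. complex_of_real (f x)"
  obtain z where z: "z \<in> B" using nonempty by blast
  show "?g \<noteq> (\<lambda>_. 0)"
    using f_pos[OF z] by (metis less_irrefl of_real_eq_0_iff)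
  obtain b where b: "hbound f b" using f_holder holder_space_iff by blast
  have gb: "hbound ?g b"
    using b unfolding hbound_def by (simp flip: of_real_diff)
  have gH: "(\<lambda>x. c * ?g x) \<in> holder_space \<alpha> B" for c
    using hbound_cmult[OF gb] f_outside by (auto simp: holder_space_iff)
  have Lg: "L \<phi> ?g x = of_real l * ?g x" if x: "x \<in> B" for x
    using L_Re_Im[OF \<phi> hbound_continuous[OF gb] x] eigen[OF x] L_mult[of \<phi> 0 "\<lambda>_. 0 :: real" x]
    by (simp add: complex_eq_iff)
  show "eigenspace (L \<phi>) (holder_space \<alpha> B) (of_real l) = range (\<lambda>c x. c * ?g x)"
  proof (intro equalityI subsetI)
    fix h assume "h \<in> range (\<lambda>c x. c * ?g x)"
    then obtain c where c: "h = (\<lambda>x. c * ?g x)" by blast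
    have "L \<phi> h x = of_real l * h x" for x
    proof (cases "x \<in> B")
      case True
      then show ?thesis unfolding c L_mult Lg[OF True] by simp
    qed (simp add: L_outside c f_outside)
    then show "h \<in> eigenspace (L \<phi>) (holder_space \<alpha> B) (of_real l)"
      using gH by (auto simp: eigenspace_def c)
  next
    fix h assume h: "h \<in> eigenspace (L \<phi>) (holder_space \<alpha> B) (of_real l)"
    then have hH: "h \<in> holder_space \<alpha> B" and e: "\<And>x. L \<phi> h x = of_real l * h x"
      by (auto simp: eigenspace_def dest: fun_cong)
    obtain b where hc: "continuous_on B h" using hH holder_space_iff hbound_continuous by blast
    have "L \<phi> (\<lambda>y. Re (h y)) x = l * Re (h x)" "L \<phi> (\<lambda>y. Im (h y)) x = l * Im (h x)" if "x \<in> B" for x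
      using L_Re_Im[OF \<phi> hc that] e[of x] by simp_all
    moreover have "continuous_on B (\<lambda>y. Re (h y))" "continuous_on B (\<lambda>y. Im (h y))"
      by (intro continuous_intros hc)+
    ultimately obtain c1 c2 where c: "\<And>x. x \<in> B \<Longrightarrow> Re (h x) = c1 * f x" "\<And>x. x \<in> B \<Longrightarrow> Im (h x) = c2 * f x"
      using real_eigenfunction by metis
    have "h = (\<lambda>x. Complex c1 c2 * ?g x)"
    proof
      fix x show "h x = Complex c1 c2 * ?g x"
      proof (cases "x \<in> B")
        case True
        then show ?thesis by (simp add: complex_eq_iff c)
      next
        case False
        then show ?thesis using hH by (simp add: f_outside holder_space_def)
      qed
    qed
    then show "h \<in> range (\<lambda>c x. c * ?g x)" by blast
  qed
qed

text \<open>
  Under mixing the iterates of the normalized operator itself converge to a constant. It is the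
  value of the functional \<open>limit\<close>, which is monotone and does not change along the iterates.
\<close>

lemma mixing_limit:
  assumes mix: "top_mixing shift B" and h: "continuous_on B h"
  shows "uniform_limit B (\<lambda>n. (L np ^^ n) h) (\<lambda>_. N.limit h) sequentially"
proof -
  interpret M: primitive_markov A I \<nu> "L np" \<alpha> N.E by (rule N.L_primitive_markov[OF mix])
  interpret F: positive_functional B N.limit by (rule N.limit_functional)
  obtain c where c: "uniform_limit B (\<lambda>n. (L np ^^ n) h) (\<lambda>_. c) sequentially"
    by (rule M.iterates_converge[OF h])
  have lim: "N.limit ((L np ^^ n) h) = N.limit h" for n
    by (induction n) (simp_all add: N.limit_L M.iterate_continuous h)
  have "\<bar>N.limit h - c\<bar> \<le> e" if e: "e > 0" for e
  proof -
    obtain n where n: "\<And>x. x \<in> B \<Longrightarrow> dist ((L np ^^ n) h x) c < e"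
      using uniform_limitD[OF c e] by (auto simp: eventually_sequentially)
    have "(L np ^^ n) h x \<le> c + e" "c - e \<le> (L np ^^ n) h x" if "x \<in> B" for x
      using n[OF that] by (auto simp: dist_real_def abs_less_iff)
    then have "N.limit ((L np ^^ n) h) \<le> N.limit (\<lambda>_. c + e)" "N.limit (\<lambda>_. c - e) \<le> N.limit ((L np ^^ n) h)"
      by (auto intro!: F.mono M.iterate_continuous h)
    then show ?thesis unfolding lim F.const by (simp add: abs_le_iff)
  qed
  then have "N.limit h = c" using field_le_epsilon[of "\<bar>N.limit h - c\<bar>" 0] by simp
  then show ?thesis using c by simp
qed

lemma iterate_Re_Im:
  fixes h :: "(nat \<Rightarrow> 'a) \<Rightarrow> complex"
  assumes h: "continuous_on B h" and x: "x \<in> B"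
  shows "Re ((L np ^^ n) h x) = (L np ^^ n) (\<lambda>y. Re (h y)) x \<and>
    Im ((L np ^^ n) h x) = (L np ^^ n) (\<lambda>y. Im (h y)) x"
  using x
proof (induction n arbitrary: x)
  case (Suc n)
  have c: "continuous_on B ((L np ^^ n) h)" by (rule L_iterate_continuous[OF N.\<phi> h])
  have "L np (\<lambda>y. Re ((L np ^^ n) h y)) = L np ((L np ^^ n) (\<lambda>y. Re (h y)))"
    by (rule L_cong) (simp add: Suc.IH)
  moreover have "L np (\<lambda>y. Im ((L np ^^ n) h y)) = L np ((L np ^^ n) (\<lambda>y. Im (h y)))"
    by (rule L_cong) (simp add: Suc.IH)
  ultimately show ?case using L_Re_Im[OF N.\<phi> c Suc.prems] by simp
qed simp

text \<open>
  Real and imaginary parts decay separately.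
\<close>

lemma complex_decay:
  assumes mix: "top_mixing shift B"
  obtains M \<theta> where "M > 0" "0 < \<theta>" "\<theta> < 1"
    "\<forall>(h :: (nat \<Rightarrow> 'a) \<Rightarrow> complex) b. hbound h b \<longrightarrow> (\<exists>m. \<forall>n. hbound (\<lambda>x. (L np ^^ n) h x - m) (M * \<theta> ^ n * b))"
proof -
  interpret M: primitive_markov A I \<nu> "L np" \<alpha> N.E by (rule N.L_primitive_markov[OF mix])
  obtain M \<theta> where M: "M > 0" "0 < \<theta>" "\<theta> < 1"
    and R1: "\<And>h b c n x. (\<And>x. x \<in> B \<Longrightarrow> \<bar>h x\<bar> \<le> b) \<Longrightarrow>
      (\<And>x y. x \<in> B \<Longrightarrow> y \<in> B \<Longrightarrow> \<bar>h x - h y\<bar> \<le> b * seq_dist x y powr \<alpha>) \<Longrightarrow>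
      uniform_limit B (\<lambda>n. (L np ^^ n) h) (\<lambda>_. c) sequentially \<Longrightarrow> x \<in> B \<Longrightarrow>
      \<bar>(L np ^^ n) h x - c\<bar> \<le> M * \<theta> ^ n * b"
    and R2: "\<And>h b n x y. (\<And>x. x \<in> B \<Longrightarrow> \<bar>h x\<bar> \<le> b) \<Longrightarrow>
      (\<And>x y. x \<in> B \<Longrightarrow> y \<in> B \<Longrightarrow> \<bar>h x - h y\<bar> \<le> b * seq_dist x y powr \<alpha>) \<Longrightarrow> x \<in> B \<Longrightarrow> y \<in> B \<Longrightarrow>
      \<bar>(L np ^^ n) h x - (L np ^^ n) h y\<bar> \<le> M * \<theta> ^ n * b * seq_dist x y powr \<alpha>"
    using M.exponential_convergence by metis
  have decay: "hbound (\<lambda>x. (L np ^^ n) h x - Complex (N.limit (\<lambda>y. Re (h y))) (N.limit (\<lambda>y. Im (h y)))) (2 * M * \<theta> ^ n * b)"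
    if h: "hbound h b" for h :: "(nat \<Rightarrow> 'a) \<Rightarrow> complex" and b n
  proof -
    note hc = hbound_continuous[OF h]
    have re: "\<bar>Re (h x)\<bar> \<le> b" "\<bar>Im (h x)\<bar> \<le> b" if "x \<in> B" for x
      using hboundD(1)[OF h that] abs_Re_le_cmod[of "h x"] abs_Im_le_cmod[of "h x"] by linarith+
    have rh: "\<bar>Re (h x) - Re (h y)\<bar> \<le> b * seq_dist x y powr \<alpha>" "\<bar>Im (h x) - Im (h y)\<bar> \<le> b * seq_dist x y powr \<alpha>"
      if "x \<in> B" "y \<in> B" for x y
      using hboundD(2)[OF h that] abs_Re_le_cmod[of "h x - h y"] abs_Im_le_cmod[of "h x - h y"] by auto
    have uc: "continuous_on B (\<lambda>y. Re (h y))" "continuous_on B (\<lambda>y. Im (h y))"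
      by (intro continuous_intros hc)+
    show ?thesis
      unfolding hbound_def
    proof (intro conjI ballI)
      fix x assume x: "x \<in> B"
      let ?z = "(L np ^^ n) h x - Complex (N.limit (\<lambda>y. Re (h y))) (N.limit (\<lambda>y. Im (h y)))"
      have "\<bar>Re ?z\<bar> \<le> M * \<theta> ^ n * b" "\<bar>Im ?z\<bar> \<le> M * \<theta> ^ n * b"
        using R1[OF re(1) rh(1) mixing_limit[OF mix uc(1)] x, of n]
          R1[OF re(2) rh(2) mixing_limit[OF mix uc(2)] x, of n] iterate_Re_Im[OF hc x, of n] by auto
      then show "cmod ?z \<le> 2 * M * \<theta> ^ n * b" using cmod_le[of ?z] by linarith
      fix y assume y: "y \<in> B"
      let ?w = "(L np ^^ n) h x - (L np ^^ n) h y"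
      have "\<bar>Re ?w\<bar> \<le> M * \<theta> ^ n * b * seq_dist x y powr \<alpha>" "\<bar>Im ?w\<bar> \<le> M * \<theta> ^ n * b * seq_dist x y powr \<alpha>"
        using R2[OF re(1) rh(1) x y, of n] R2[OF re(2) rh(2) x y, of n]
          iterate_Re_Im[OF hc x, of n] iterate_Re_Im[OF hc y, of n] by auto
      then have "cmod ?w \<le> 2 * M * \<theta> ^ n * b * seq_dist x y powr \<alpha>" using cmod_le[of ?w] by linarith
      then show "cmod (?z - ((L np ^^ n) h y - Complex (N.limit (\<lambda>y. Re (h y))) (N.limit (\<lambda>y. Im (h y)))))
          \<le> 2 * M * \<theta> ^ n * b * seq_dist x y powr \<alpha>" by simp
    qed
  qed
  show ?thesis by (rule that[of "2 * M" \<theta>]) (use M decay in auto)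
qed

lemma np_complex_const: "x \<in> B \<Longrightarrow> L np (\<lambda>_. m) x = (m :: complex)"
proof -
  assume x: "x \<in> B"
  have "L np (\<lambda>_. 1 :: complex) x = 1"
    using L_Re_Im[OF N.\<phi> continuous_on_const x, of 1] N.L_const[OF x] by (simp add: complex_eq_iff)
  then show ?thesis using L_mult[of np m "\<lambda>_. 1" x] by simp
qed

text \<open>
  Split \<open>g\<close> into its limit \<open>m\<close> and a part that decays like \<open>\<theta> ^ n\<close>. Constants are eigenfunctions of
  eigenvalue 1, and on the decaying part the Neumann series of \<open>\<zeta>\<close> converges with its Hoelder bound
  because \<open>\<theta> < \<bar>\<zeta>\<bar>\<close>.
\<close>

lemma resolvent_equation:
  fixes \<zeta> :: complex
  assumes M: "M > 0" "0 < \<theta>" "\<theta> < 1"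
    and decay: "\<forall>(h :: (nat \<Rightarrow> 'a) \<Rightarrow> complex) b. hbound h b \<longrightarrow>
      (\<exists>m. \<forall>n. hbound (\<lambda>x. (L np ^^ n) h x - m) (M * \<theta> ^ n * b))"
    and \<zeta>: "\<theta> < cmod \<zeta>" "\<zeta> \<noteq> 1"
  obtains C where "C > 0"
    "\<forall>(g :: (nat \<Rightarrow> 'a) \<Rightarrow> complex) b. hbound g b \<longrightarrow> (\<exists>k. hbound k (C * b) \<and> (\<forall>x\<in>B. \<zeta> * k x - L np k x = g x))"
proof -
  define t where "t = \<theta> / cmod \<zeta>"
  have \<zeta>0: "cmod \<zeta> > 0" "\<zeta> \<noteq> 0" using M(2) \<zeta>(1) by auto
  have t: "0 < t" "t < 1" using M(2) \<zeta>(1) \<zeta>0(1) by (auto simp: t_def)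
  have geo: "(1 / cmod \<zeta>) ^ n * \<theta> ^ n = t ^ n" for n
    by (simp add: t_def power_divide)
  define S where "S = M / cmod \<zeta> / (1 - t)"
  define C where "C = (1 + M) / cmod (\<zeta> - 1) + S"
  have S: "S > 0" using M(1) \<zeta>0 t by (simp add: S_def)
  have d0: "cmod (\<zeta> - 1) > 0" using \<zeta>(2) by simp
  have C: "C > 0" using S M(1) d0 by (simp add: C_def add_pos_pos)
  have "\<exists>k. hbound k (C * b) \<and> (\<forall>x\<in>B. \<zeta> * k x - L np k x = g x)"
    if g: "hbound g b" for g :: "(nat \<Rightarrow> 'a) \<Rightarrow> complex" and b
  proof -
    have b: "b \<ge> 0" by (rule hbound_nonneg[OF g])
    obtain m where m: "\<And>n. hbound (\<lambda>x. (L np ^^ n) g x - m) (M * \<theta> ^ n * b)" using decay g by blast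
    \<comment> \<open>The constant part \<open>m\<close> is inverted by hand, the decaying part by the Neumann series.\<close>
    define u where "u n x = (L np ^^ n) g x - m" for n x
    have u: "hbound (u n) (M * \<theta> ^ n * b)" for n unfolding u_def by (rule m)
    define a where "a n x = (1 / \<zeta>) ^ Suc n * u n x" for n x
    have a: "hbound (a n) (M / cmod \<zeta> * b * t ^ n)" for n
    proof -
      have "cmod ((1 / \<zeta>) ^ Suc n) * (M * \<theta> ^ n * b) = M / cmod \<zeta> * b * ((1 / cmod \<zeta>) ^ n * \<theta> ^ n)"
        by (simp add: norm_power norm_divide norm_mult)
      also have "\<dots> = M / cmod \<zeta> * b * t ^ n" by (simp only: geo)
      finally show ?thesis using hbound_cmult[OF u, of "(1 / \<zeta>) ^ Suc n" n] by (simp add: a_def[abs_def])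
    qed
    define K where "K N x = m / (\<zeta> - 1) + (\<Sum>n<N. a n x)" for N x
    have m_le: "cmod m \<le> (1 + M) * b"
    proof -
      obtain z where z: "z \<in> B" using nonempty by blast
      have "cmod (g z - m) \<le> M * b" using hboundD(1)[OF u z, of 0] by (simp add: u_def)
      moreover have "cmod (g z) \<le> b" by (rule hboundD(1)[OF g z])
      moreover have "cmod m \<le> cmod (g z) + cmod (g z - m)" using norm_triangle_sub[of m "g z"] by (simp add: norm_minus_commute)
      ultimately show ?thesis by (simp add: distrib_right)
    qed
    have K: "hbound (K N) (C * b)" for N
    proof -
      have "hbound (K N) (cmod (m / (\<zeta> - 1)) + (\<Sum>n<N. M / cmod \<zeta> * b * t ^ n))"
        unfolding K_def by (rule hbound_add[OF hbound_const hbound_sum[OF a]])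
      moreover have "cmod (m / (\<zeta> - 1)) \<le> (1 + M) / cmod (\<zeta> - 1) * b"
        using m_le d0 by (simp add: norm_divide divide_right_mono)
      moreover have "(\<Sum>n<N. M / cmod \<zeta> * b * t ^ n) \<le> S * b"
      proof -
        have "(\<Sum>n<N. t ^ n) \<le> (\<Sum>n. t ^ n)" using t by (intro sum_le_suminf summable_geometric) auto
        also have "\<dots> = 1 / (1 - t)" using t by (intro suminf_geometric) auto
        finally have "M / cmod \<zeta> * b * (\<Sum>n<N. t ^ n) \<le> M / cmod \<zeta> * b * (1 / (1 - t))"
          using M(1) b by (intro mult_left_mono) auto
        then show ?thesis unfolding sum_distrib_left[symmetric] by (simp add: S_def mult_ac)
      qed
      ultimately show ?thesis by (elim hbound_mono) (simp add: C_def distrib_right)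
    qed
    define k where "k x = m / (\<zeta> - 1) + (\<Sum>n. a n x)" for x
    have lim: "(\<lambda>N. K N x) \<longlonglongrightarrow> k x" if x: "x \<in> B" for x
    proof -
      have "summable (\<lambda>n. a n x)"
      proof (rule summable_comparison_test')
        show "summable (\<lambda>n. M / cmod \<zeta> * b * t ^ n)" using t by (intro summable_mult summable_geometric) auto
        show "norm (a n x) \<le> M / cmod \<zeta> * b * t ^ n" for n by (rule hboundD(1)[OF a x])
      qed
      then show ?thesis unfolding K_def k_def by (intro tendsto_add tendsto_const summable_LIMSEQ)
    qed
    have k: "hbound k (C * b)" by (rule hbound_limit[OF K lim])
    have gc: "continuous_on B ((L np ^^ n) g)" for n
      by (rule L_iterate_continuous[OF N.\<phi> hbound_continuous[OF g]])
    have Tu: "L np (u n) x = u (Suc n) x" if x: "x \<in> B" for n x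
      unfolding u_def using L_diff[OF N.\<phi> gc continuous_on_const x] np_complex_const[OF x] by simp
    have step: "L np (K N) x = \<zeta> * K N x - g x + (1 / \<zeta>) ^ N * u N x" if x: "x \<in> B" for N x
    proof (induction N)
      case 0
      have K0: "K 0 = (\<lambda>_. m / (\<zeta> - 1))" by (simp add: K_def fun_eq_iff)
      have "L np (K 0) x = m / (\<zeta> - 1)" unfolding K0 by (rule np_complex_const[OF x])
      also have "\<dots> = \<zeta> * (m / (\<zeta> - 1)) - m" using \<zeta>(2) by (simp add: field_simps)
      also have "\<dots> = \<zeta> * K 0 x - g x + (1 / \<zeta>) ^ 0 * u 0 x" unfolding K0 by (simp add: u_def)
      finally show ?case .
    next
      case (Suc N)
      have eq: "K (Suc N) = (\<lambda>x. K N x + a N x)" by (simp add: K_def fun_eq_iff add.assoc)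
      have "L np (K (Suc N)) x = L np (K N) x + L np (a N) x"
        unfolding eq by (rule L_add[OF N.\<phi> hbound_continuous[OF K] hbound_continuous[OF a] x])
      also have "L np (a N) x = (1 / \<zeta>) ^ Suc N * u (Suc N) x"
        unfolding a_def L_mult Tu[OF x] ..
      also have "L np (K N) x = \<zeta> * K N x - g x + \<zeta> * a N x"
        unfolding Suc.IH using \<zeta>0(2) by (simp add: a_def)
      finally show ?case unfolding eq by (simp add: distrib_left)
    qed
    have "L np k x = \<zeta> * k x - g x" if x: "x \<in> B" for x
    proof (rule LIMSEQ_unique)
      show "(\<lambda>N. L np (K N) x) \<longlonglongrightarrow> L np k x"
        by (rule L_tendsto[OF N.\<phi> hbound_continuous[OF K] hbound_continuous[OF k] lim hboundD(1)[OF K] x])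
      have "(\<lambda>N. (1 / \<zeta>) ^ N * u N x) \<longlonglongrightarrow> 0"
      proof (rule Lim_null_comparison)
        show "\<forall>\<^sub>F N in sequentially. norm ((1 / \<zeta>) ^ N * u N x) \<le> M * b * t ^ N"
        proof (intro always_eventually allI)
          fix N
          have "norm ((1 / \<zeta>) ^ N * u N x) \<le> (1 / cmod \<zeta>) ^ N * (M * \<theta> ^ N * b)"
            using hboundD(1)[OF u x, of N] by (simp add: norm_mult norm_power norm_divide mult_left_mono divide_right_mono)
          also have "\<dots> = M * b * ((1 / cmod \<zeta>) ^ N * \<theta> ^ N)" by simp
          finally show "norm ((1 / \<zeta>) ^ N * u N x) \<le> M * b * t ^ N" by (simp only: geo)
        qed
        show "(\<lambda>N. M * b * t ^ N) \<longlonglongrightarrow> 0"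
          using t by (intro tendsto_mult_right_zero LIMSEQ_power_zero) auto
      qed
      then have "(\<lambda>N. \<zeta> * K N x - g x + (1 / \<zeta>) ^ N * u N x) \<longlonglongrightarrow> \<zeta> * k x - g x + 0"
        by (intro tendsto_intros lim x)
      then show "(\<lambda>N. L np (K N) x) \<longlonglongrightarrow> \<zeta> * k x - g x" by (simp add: step[OF x])
    qed
    then show ?thesis using k by (intro exI[of _ k]) auto
  qed
  then show ?thesis by (intro that[OF C]) blast
qed

text \<open>
  The iterates of an eigenfunction \<open>k\<close> are \<open>\<zeta> ^ n * k\<close>, and they approach a constant \<open>m\<close> at the rate
  \<open>\<theta> ^ n\<close>. As \<open>\<zeta> \<noteq> 1\<close>, this forces \<open>m = 0\<close>, and as \<open>\<theta> < \<bar>\<zeta>\<bar>\<close>, then also \<open>k = 0\<close>.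
\<close>

lemma resolvent_injective:
  fixes \<zeta> :: complex and k :: "(nat \<Rightarrow> 'a) \<Rightarrow> complex"
  assumes M: "M > 0" "0 < \<theta>" "\<theta> < 1"
    and decay: "\<forall>(h :: (nat \<Rightarrow> 'a) \<Rightarrow> complex) b. hbound h b \<longrightarrow>
      (\<exists>m. \<forall>n. hbound (\<lambda>x. (L np ^^ n) h x - m) (M * \<theta> ^ n * b))"
    and \<zeta>: "\<theta> < cmod \<zeta>" "\<zeta> \<noteq> 1"
    and k: "hbound k b" "\<And>x. x \<in> B \<Longrightarrow> L np k x = \<zeta> * k x" and x: "x \<in> B"
  shows "k x = 0"
proof -
  obtain m where m: "\<And>n. hbound (\<lambda>x. (L np ^^ n) k x - m) (M * \<theta> ^ n * b)" using decay k(1) by blast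
  have it: "(L np ^^ n) k x = \<zeta> ^ n * k x" if "x \<in> B" for n x
    using that
  proof (induction n arbitrary: x)
    case (Suc n)
    have "L np ((L np ^^ n) k) = L np (\<lambda>x. \<zeta> ^ n * k x)" by (rule L_cong) (rule Suc.IH)
    then show ?case using k(2)[OF Suc.prems] by (simp add: L_mult)
  qed simp
  have le: "cmod (\<zeta> ^ n * k x - m) \<le> M * \<theta> ^ n * b" for n
    using hboundD(1)[OF m x, of n] by (simp add: it[OF x])
  have "(\<lambda>n. M * \<theta> ^ n * b) \<longlonglongrightarrow> M * 0 * b"
    using M by (intro tendsto_intros LIMSEQ_power_zero) auto
  then have z: "(\<lambda>n. M * \<theta> ^ n * b) \<longlonglongrightarrow> 0" by simp
  have s: "(\<lambda>n. \<zeta> ^ n * k x - m) \<longlonglongrightarrow> 0"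
  proof (rule Lim_null_comparison[rotated])
    show "\<forall>\<^sub>F n in sequentially. norm (\<zeta> ^ n * k x - m) \<le> M * \<theta> ^ n * b" using le by simp
  qed (rule z)
  \<comment> \<open>Two consecutive instances of the decay eliminate \<open>k\<close> and leave a multiple of \<open>m\<close>.\<close>
  have "(\<lambda>n. \<zeta> * (\<zeta> ^ n * k x - m) - (\<zeta> ^ Suc n * k x - m)) \<longlonglongrightarrow> \<zeta> * 0 - 0"
    by (intro tendsto_intros s LIMSEQ_Suc[OF s])
  moreover have "\<zeta> * (\<zeta> ^ n * k x - m) - (\<zeta> ^ Suc n * k x - m) = (1 - \<zeta>) * m" for n
    by (simp add: algebra_simps)
  ultimately have "(1 - \<zeta>) * m = 0" by (simp add: LIMSEQ_const_iff)
  then have m0: "m = 0" using \<zeta>(2) by simp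
  have \<zeta>0: "cmod \<zeta> > 0" using M(2) \<zeta>(1) by linarith
  have "cmod (k x) \<le> M * b * (\<theta> / cmod \<zeta>) ^ n" for n
    using le[of n] \<zeta>0 by (simp add: m0 norm_mult norm_power power_divide field_simps)
  moreover have "norm (\<theta> / cmod \<zeta>) < 1" 
  proof -
    have "\<theta> / cmod \<zeta> < 1" using \<zeta>(1) pos_divide_less_eq[OF \<zeta>0, of \<theta> 1] by linarith
    moreover have "0 < \<theta> / cmod \<zeta>" using M(2) \<zeta>0 by (rule divide_pos_pos)
    ultimately show ?thesis by (simp only: real_norm_def abs_of_pos)
  qed
  then have "(\<lambda>n. M * b * (\<theta> / cmod \<zeta>) ^ n) \<longlonglongrightarrow> 0"
    by (intro tendsto_mult_right_zero LIMSEQ_power_zero)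
  ultimately have "cmod (k x) \<le> 0" by (intro LIMSEQ_le_const) auto
  then show ?thesis by simp
qed

lemma complex_conjugate:
  fixes h :: "(nat \<Rightarrow> 'a) \<Rightarrow> complex"
  assumes x: "x \<in> B"
  shows "z * h x - L \<phi> h x =
    (l * f x) *\<^sub>R (z / of_real l * ((1 / f x) *\<^sub>R h x) - L np (\<lambda>y. (1 / f y) *\<^sub>R h y) x)"
proof -
  have "(l * f x) *\<^sub>R (z / of_real l * ((1 / f x) *\<^sub>R h x)) = z * h x"
    using l f_pos[OF x] by (simp add: scaleR_conv_of_real)
  then show ?thesis unfolding scaleR_diff_right conjugate_back[OF x, of h] by (rule arg_cong2[of _ _ _ _ "(-)", OF sym refl])
qed

text \<open>
  Outside the disk of radius \<open>l * \<theta>\<close>, and away from \<open>l\<close>, the resolvent equation of \<open>L\<close> is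
  conjugate to that of the normalized operator, which is solvable with a Hoelder bound, uniquely.
\<close>

theorem spectral_gap:
  assumes mix: "top_mixing shift B"
  obtains r where "0 \<le> r" "r < l"
    "spectrum_on (L \<phi>) (holder_space \<alpha> B) (holder_norm \<alpha> B) - {of_real l} \<subseteq> cball 0 r"
proof -
  obtain M \<theta> where M: "M > 0" "0 < \<theta>" "\<theta> < 1"
    and decay: "\<forall>(h :: (nat \<Rightarrow> 'a) \<Rightarrow> complex) b. hbound h b \<longrightarrow>
      (\<exists>m. \<forall>n. hbound (\<lambda>x. (L np ^^ n) h x - m) (M * \<theta> ^ n * b))"
    by (rule complex_decay[OF mix])
  obtain bf where bf: "bf > 0" "hbound f bf" "hbound (\<lambda>x. 1 / f x) bf" by (rule hbound_f)
  let ?H = "holder_space \<alpha> B :: ((nat \<Rightarrow> 'a) \<Rightarrow> complex) set"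
  have resolvent: "z \<notin> spectrum_on (L \<phi>) ?H (holder_norm \<alpha> B)"
    if z: "cmod z > l * \<theta>" "z \<noteq> of_real l" for z
  proof -
    \<comment> \<open>Conjugation by \<open>f\<close> and division by \<open>l\<close> turn \<open>L\<close> into the normalized operator.\<close>
    define \<zeta> where "\<zeta> = z / of_real l"
    have \<zeta>: "\<theta> < cmod \<zeta>" "\<zeta> \<noteq> 1"
      using z l by (auto simp: \<zeta>_def norm_divide pos_less_divide_eq mult.commute)
    define \<Phi> where "\<Phi> h = (\<lambda>x. z * h x - L \<phi> h x)" for h :: "(nat \<Rightarrow> 'a) \<Rightarrow> complex"
    have \<Phi>: "\<Phi> h x = (l * f x) *\<^sub>R (\<zeta> * ((1 / f x) *\<^sub>R h x) - L np (\<lambda>y. (1 / f y) *\<^sub>R h y) x)"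
      if "x \<in> B" for h x
      unfolding \<Phi>_def \<zeta>_def by (rule complex_conjugate[OF that])
    have maps: "\<Phi> h \<in> ?H" if h: "h \<in> ?H" for h
    proof -
      obtain b where b: "hbound h b" using h holder_space_iff by blast
      have k: "hbound (\<lambda>y. (1 / f y) *\<^sub>R h y) (2 * bf * b)" by (rule hbound_scaleR[OF bf(3) b])
      obtain m where "\<And>n. hbound (\<lambda>x. (L np ^^ n) (\<lambda>y. (1 / f y) *\<^sub>R h y) x - m) (M * \<theta> ^ n * (2 * bf * b))"
        using decay k by blast
      from this[of 1] have "hbound (\<lambda>x. L np (\<lambda>y. (1 / f y) *\<^sub>R h y) x - m) (M * \<theta> * (2 * bf * b))" by simp
      from hbound_add[OF this hbound_const[of m]]
      have Tk: "hbound (\<lambda>x. L np (\<lambda>y. (1 / f y) *\<^sub>R h y) x) (M * \<theta> * (2 * bf * b) + cmod m)" by simp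
      from hbound_add[OF hbound_cmult[OF b, of z]
          hbound_cmult[OF hbound_scaleR[OF bf(2) Tk], of "- of_real l"]]
      have "hbound (\<lambda>x. z * h x + (- of_real l) * (f x *\<^sub>R L np (\<lambda>y. (1 / f y) *\<^sub>R h y) x))
          (cmod z * b + cmod (- of_real l) * (2 * bf * (M * \<theta> * (2 * bf * b) + cmod m)))" .
      then have "hbound (\<Phi> h) (cmod z * b + cmod (- of_real l) * (2 * bf * (M * \<theta> * (2 * bf * b) + cmod m)))"
        by (rule hbound_cong[rotated]) (simp add: \<Phi>_def conjugate_back[of _ h] scaleR_conv_of_real)
      moreover have "\<Phi> h x = 0" if "x \<notin> B" for x
        using h that by (simp add: \<Phi>_def L_outside holder_space_def)
      ultimately show ?thesis unfolding holder_space_iff by blast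
    qed
    obtain C where C: "C > 0" "\<forall>(g :: (nat \<Rightarrow> 'a) \<Rightarrow> complex) b. hbound g b \<longrightarrow>
        (\<exists>k. hbound k (C * b) \<and> (\<forall>x\<in>B. \<zeta> * k x - L np k x = g x))"
      by (rule resolvent_equation[OF M decay \<zeta>])
    define W where "W = 2 * bf * (C * (1 / l * (2 * bf)))"
    have solve: "\<exists>h\<in>?H. \<Phi> h = g \<and> hbound h (W * holder_norm \<alpha> B g)" if g: "g \<in> ?H" for g
    proof -
      let ?b = "holder_norm \<alpha> B g"
      have gb: "hbound g ?b" by (rule hbound_holder_norm[OF g])
      have "hbound (\<lambda>x. of_real (1 / l) * ((1 / f x) *\<^sub>R g x)) (cmod (of_real (1 / l)) * (2 * bf * ?b))"
        by (rule hbound_cmult[OF hbound_scaleR[OF bf(3) gb]])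
      from C(2)[rule_format, OF this] obtain k where
        k: "hbound k (C * (cmod (of_real (1 / l)) * (2 * bf * ?b)))"
          "\<And>x. x \<in> B \<Longrightarrow> \<zeta> * k x - L np k x = of_real (1 / l) * ((1 / f x) *\<^sub>R g x)" by blast
      define h where "h x = f x *\<^sub>R k x" for x
      have "hbound h (2 * bf * (C * (cmod (of_real (1 / l)) * (2 * bf * ?b))))"
        unfolding h_def by (rule hbound_scaleR[OF bf(2) k(1)])
      also have "2 * bf * (C * (cmod (of_real (1 / l)) * (2 * bf * ?b))) = W * ?b"
        using l by (simp add: W_def norm_divide)
      finally have hb: "hbound h (W * ?b)" .
      have hH: "h \<in> ?H" unfolding holder_space_iff using hb f_outside by (auto simp: h_def)
      have "\<Phi> h x = g x" for x
      proof (cases "x \<in> B")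
        case True
        have "L np (\<lambda>y. (1 / f y) *\<^sub>R h y) = L np k"
          by (rule L_cong) (use f_pos in \<open>force simp: h_def\<close>)
        moreover have "(1 / f x) *\<^sub>R h x = k x" using f_pos[OF True] by (simp add: h_def)
        ultimately have "\<Phi> h x = (l * f x) *\<^sub>R (of_real (1 / l) * ((1 / f x) *\<^sub>R g x))"
          unfolding \<Phi>[OF True] using k(2)[OF True] by simp
        then show ?thesis using l f_pos[OF True] by (simp add: scaleR_conv_of_real)
      next
        case False
        then show ?thesis using g by (simp add: \<Phi>_def L_outside h_def f_outside holder_space_def)
      qed
      then show ?thesis using hH hb by blast
    qed
    have inj: "inj_on \<Phi> ?H"
    proof (rule inj_onI)
      fix h1 h2 assume h: "h1 \<in> ?H" "h2 \<in> ?H" and eq: "\<Phi> h1 = \<Phi> h2"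
      obtain b1 b2 where b: "hbound h1 b1" "hbound h2 b2" using h holder_space_iff by blast
      define h where "h x = h1 x + (-1) * h2 x" for x
      have hb: "hbound h (b1 + cmod (-1) * b2)"
        unfolding h_def by (rule hbound_add[OF b(1) hbound_cmult[OF b(2)]])
      note c = hbound_continuous[OF b(1)] hbound_continuous[OF b(2)]
      have h': "h = (\<lambda>x. h1 x - h2 x)" by (simp add: h_def fun_eq_iff)
      have "\<Phi> h x = 0" if x: "x \<in> B" for x
        using fun_cong[OF eq, of x] unfolding \<Phi>_def h' L_diff[OF \<phi> c x]
        by (auto simp: algebra_simps)
      then have T: "L np (\<lambda>y. (1 / f y) *\<^sub>R h y) x = \<zeta> * ((1 / f x) *\<^sub>R h x)" if x: "x \<in> B" for x
        using \<Phi>[OF x, of h] l f_pos[OF x] that by simp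
      have "(1 / f x) *\<^sub>R h x = 0" if x: "x \<in> B" for x
        by (rule resolvent_injective[OF M decay \<zeta> hbound_scaleR[OF bf(3) hb] T x])
      then have 0: "h x = 0" if x: "x \<in> B" for x using f_pos[OF x] that by force
      show "h1 = h2"
      proof
        fix x show "h1 x = h2 x"
          using 0[of x] h by (cases "x \<in> B") (auto simp: h' holder_space_def)
      qed
    qed
    have "bij_betw \<Phi> ?H ?H"
      unfolding bij_betw_def using inj maps solve by (auto simp: image_iff)
    moreover have "holder_norm \<alpha> B h \<le> 2 * W * holder_norm \<alpha> B (\<Phi> h)" if h: "h \<in> ?H" for h
    proof -
      obtain h' where h': "h' \<in> ?H" "\<Phi> h' = \<Phi> h" "hbound h' (W * holder_norm \<alpha> B (\<Phi> h))"
        using solve[OF maps[OF h]] by blast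
      have "h' = h" using inj_onD[OF inj h'(2) h'(1) h] .
      then show ?thesis using holder_norm_le[OF h'(3)] by (simp add: mult.assoc)
    qed
    ultimately show ?thesis unfolding spectrum_on_def \<Phi>_def by blast
  qed
  show ?thesis
  proof (rule that[of "l * \<theta>"])
    show "0 \<le> l * \<theta>" "l * \<theta> < l" using l M by auto
    show "spectrum_on (L \<phi>) ?H (holder_norm \<alpha> B) - {of_real l} \<subseteq> cball 0 (l * \<theta>)"
    proof
      fix z assume "z \<in> spectrum_on (L \<phi>) ?H (holder_norm \<alpha> B) - {of_real l}"
      then have "\<not> cmod z > l * \<theta>" using resolvent by blast
      then show "z \<in> cball 0 (l * \<theta>)" by simp
    qed
  qed
qed

end

section \<open>The Ruelle-Perron-Frobenius theorem\<close>

lemma spectral_decomposition_onto: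
  assumes "spectral_decomposition T Y" shows "T ` Y = Y"
proof -
  obtain k :: nat and p C where p: "p permutes {1..k}" and Y: "Y = (\<Union>i\<in>{1..k}. C i)"
    and C: "\<And>i. i \<in> {1..k} \<Longrightarrow> T ` C i = C (p i)"
    using assms unfolding spectral_decomposition_def by blast
  have "T ` Y = (\<Union>i\<in>{1..k}. C (p i))" unfolding Y image_UN using C by simp
  also have "\<dots> = (\<Union>i\<in>p ` {1..k}. C i)" by simp
  also have "\<dots> = Y" unfolding permutes_image[OF p] Y ..
  finally show ?thesis .
qed

context holder_potential
begin

text \<open>
  Scales the eigenfunction so that dividing the fixed measure by it gives a probability measure.
\<close>

lemma exists_normalized_eigenpair:
  obtains l f \<mu> where "eigenpair A I \<nu> \<alpha> \<phi> l f" "prob_on B \<mu>"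
    "\<And>h. continuous_on B h \<Longrightarrow>
      (\<integral>x. h x \<partial>\<mu>) = normalized_holder_potential.limit A I \<nu> (normalized_potential B \<phi> l f) h"
    "(\<integral>x. 1 / f x \<partial>\<mu>) = 1"
proof -
  obtain l f0 where l: "l > 0" and cone: "cone f0" and pos: "\<And>x. x \<in> B \<Longrightarrow> 0 < f0 x"
    and eig: "\<And>x. x \<in> B \<Longrightarrow> L \<phi> f0 x = l * f0 x"
    using eigenfunction by blast
  have pair: "eigenpair A I \<nu> \<alpha> \<phi> l (\<lambda>x. if x \<in> B then c * f0 x else 0)" if c: "c > 0" for c
  proof unfold_locales
    let ?f = "\<lambda>x. if x \<in> B then c * f0 x else 0"
    obtain b where b: "b > 0" "\<And>x. x \<in> B \<Longrightarrow> norm (f0 x) \<le> b"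
      using bounded_B[OF cone_continuous[OF cone]] by blast
    have "norm (f0 x - f0 y) \<le> max (K * dil * (dil * mass f0)) (2 * b / \<delta> powr \<alpha>) * seq_dist x y powr \<alpha>"
      if "x \<in> B" "y \<in> B" for x y
    proof (rule holder_global[OF \<alpha> \<delta>(1) _ _ that])
      show "norm (f0 x - f0 y) \<le> K * dil * (dil * mass f0) * seq_dist x y powr \<alpha>"
        if "x \<in> B" "y \<in> B" "seq_dist x y < \<delta>" for x y
        using cone_holder[OF cone that] by simp
      show "norm (f0 x - f0 y) \<le> 2 * b" if "x \<in> B" "y \<in> B" for x y
        using norm_triangle_ineq4[of "f0 x" "f0 y"] b(2)[OF that(1)] b(2)[OF that(2)] by linarith
    qed
    then have "c * \<bar>f0 x - f0 y\<bar> \<le> c * (max (K * dil * (dil * mass f0)) (2 * b / \<delta> powr \<alpha>) * seq_dist x y powr \<alpha>)"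
      if "x \<in> B" "y \<in> B" for x y using that c by (intro mult_left_mono) auto
    then have "\<bar>?f x - ?f y\<bar> \<le> c * max (K * dil * (dil * mass f0)) (2 * b / \<delta> powr \<alpha>) * seq_dist x y powr \<alpha>"
      if "x \<in> B" "y \<in> B" for x y
      using that c by (simp add: right_diff_distrib[symmetric] abs_mult mult.assoc)
    then show "?f \<in> holder_space \<alpha> B"
      unfolding holder_space_def real_norm_def by (intro CollectI conjI) (simp, blast)
    show "0 < l" by (rule l)
    show "0 < ?f x" if "x \<in> B" for x using that pos c by simp
    show "L \<phi> ?f x = l * ?f x" if "x \<in> B" for x
    proof -
      have "L \<phi> ?f = L \<phi> (\<lambda>x. c * f0 x)" by (rule L_cong) simp
      then show ?thesis using that eig[OF that] by (simp add: L_mult)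
    qed
  qed
  have np: "normalized_potential B \<phi> l (\<lambda>x. if x \<in> B then c * f0 x else 0) =
      normalized_potential B \<phi> l (\<lambda>x. if x \<in> B then 1 * f0 x else 0)" if c: "c > 0" for c
  proof
    fix x
    show "normalized_potential B \<phi> l (\<lambda>x. if x \<in> B then c * f0 x else 0) x =
        normalized_potential B \<phi> l (\<lambda>x. if x \<in> B then 1 * f0 x else 0) x"
    proof (cases "x \<in> B")
      case True
      then have "0 < f0 x" "0 < f0 (shift x)" by (auto intro: pos shift_in)
      then show ?thesis using True c by (simp add: normalized_potential_def ln_mult shift_in)
    qed (simp add: normalized_potential_def)
  qed
  interpret E1: eigenpair A I \<nu> \<alpha> \<phi> l "\<lambda>x. if x \<in> B then 1 * f0 x else 0" by (rule pair) simp
  obtain \<mu> where \<mu>: "prob_on B \<mu>" "\<And>h. continuous_on B h \<Longrightarrow> (\<integral>x. h x \<partial>\<mu>) = E1.N.limit h"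
    using E1.N.invariant_prob by blast
  interpret P: prob_space \<mu> using \<mu>(1) by (simp add: prob_on_def)
  have invc: "continuous_on B (\<lambda>x. 1 / f0 x)"
    by (intro continuous_intros cone_continuous[OF cone]) (use pos in force)
  \<comment> \<open>Multiplying \<open>f0\<close> by this constant normalizes the mean of \<open>1 / f\<close> and leaves the normalized
    potential, hence \<open>\<mu>\<close>, unchanged.\<close>
  define c where "c = (\<integral>x. 1 / f0 x \<partial>\<mu>)"
  have c: "c > 0"
  proof -
    obtain z where z: "z \<in> B" "\<And>x. x \<in> B \<Longrightarrow> 1 / f0 z \<le> 1 / f0 x"
      using continuous_attains_inf[OF compact_B nonempty invc] by blast
    have "(\<integral>x. 1 / f0 z \<partial>\<mu>) \<le> c"
      unfolding c_def
      by (rule integral_mono[OF _ prob_on_integrable[OF \<mu>(1) compact_B invc]])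
         (use z(2) in \<open>auto simp: prob_on_space[OF \<mu>(1)]\<close>)
    moreover have "(\<integral>x. 1 / f0 z \<partial>\<mu>) = 1 / f0 z" by (simp add: P.prob_space)
    moreover have "0 < 1 / f0 z" using pos[OF z(1)] by simp
    ultimately show ?thesis by linarith
  qed
  show ?thesis
  proof (rule that[OF pair[OF c] \<mu>(1)])
    show "(\<integral>x. h x \<partial>\<mu>) = normalized_holder_potential.limit A I \<nu>
        (normalized_potential B \<phi> l (\<lambda>x. if x \<in> B then c * f0 x else 0)) h" if "continuous_on B h" for h
      unfolding np[OF c] by (rule \<mu>(2)[OF that])
    have "(\<integral>x. 1 / (if x \<in> B then c * f0 x else 0) \<partial>\<mu>) = (\<integral>x. 1 / c * (1 / f0 x) \<partial>\<mu>)"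
      by (rule Bochner_Integration.integral_cong) (auto simp: prob_on_space[OF \<mu>(1)])
    also have "\<dots> = 1 / c * (\<integral>x. 1 / f0 x \<partial>\<mu>)" by (rule integral_mult_right_zero)
    also have "\<dots> = 1" using c unfolding c_def[symmetric] by simp
    finally show "(\<integral>x. 1 / (if x \<in> B then c * f0 x else 0) \<partial>\<mu>) = 1" .
  qed
qed

end

theorem theorem1:
  fixes A :: "'a::metric_space \<times> 'a \<Rightarrow> real" and I :: "real set"
    and \<nu> :: "'a measure" and \<alpha> :: real and \<phi> :: "(nat \<Rightarrow> 'a) \<Rightarrow> real"
  defines "B \<equiv> admissible A I"
  defines "H \<equiv> (holder_space \<alpha> B :: ((nat \<Rightarrow> 'a) \<Rightarrow> real) set)"
  defines "HC \<equiv> (holder_space \<alpha> B :: ((nat \<Rightarrow> 'a) \<Rightarrow> complex) set)"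
  defines "LC \<equiv> (ruelle \<nu> A I \<phi> :: ((nat \<Rightarrow> 'a) \<Rightarrow> complex) \<Rightarrow> (nat \<Rightarrow> 'a) \<Rightarrow> complex)"
  assumes "compact (UNIV :: 'a set)"
    and "continuous_on UNIV A" and "compact I"
    and "B \<noteq> {}"
    and "locally_constant (pred_set A I)"
    and "top_transitive shift B"
    and "spectral_decomposition shift B"
    and "prob_space \<nu>" and "sets \<nu> = sets borel"
    and "full_support_on \<nu> UNIV"
    and "\<forall>x\<in>B. full_support_on \<nu> (pred_set A I (x 0))"
    and "\<alpha> > 0" and "\<phi> \<in> H"
  shows "\<exists>l>0. \<exists>f\<in>H. \<exists>\<rho> \<mu>.
      (\<forall>x\<in>B. f x > 0) \<and> ruelle \<nu> A I \<phi> f = (\<lambda>x. l * f x) \<and>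
      simple_eigenvalue LC HC (of_real l) \<and>
      (\<forall>z. eigenvalue LC HC z \<longrightarrow> cmod z \<le> l) \<and>
      prob_on B \<rho> \<and> ruelle_dual \<nu> A I \<phi> \<rho> (scale_measure (ennreal l) \<rho>) \<and>
      (let \<phi>' = normalized_potential B \<phi> l f in
         prob_on B \<mu> \<and> ruelle_dual \<nu> A I \<phi>' \<mu> \<mu> \<and>
         (\<forall>\<mu>'. prob_on B \<mu>' \<and> ruelle_dual \<nu> A I \<phi>' \<mu>' \<mu>' \<longrightarrow> \<mu>' = \<mu>) \<and>
         invariant_measure shift \<mu> \<and>
         \<mu> = density \<rho> (\<lambda>x. ennreal (f x)) \<and>
         (top_mixing shift B \<longrightarrow>
            (\<forall>\<psi>\<in>H. uniform_limit B (\<lambda>n. (ruelle \<nu> A I \<phi>' ^^ n) \<psi>)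
               (\<lambda>_. \<integral>x. \<psi> x \<partial>\<mu>) sequentially) \<and>
            (\<exists>r. 0 \<le> r \<and> r < l \<and>
               spectrum_on LC HC (holder_norm \<alpha> B) - {of_real l} \<subseteq> cball 0 r)))"
proof -
  \<comment> \<open>The shift permutes the pieces of the spectral decomposition and is therefore onto.\<close>
  interpret symbolic_system A I \<nu>
    by (rule symbolic_system.intro)
       (use assms(5-) spectral_decomposition_onto[OF assms(11)] in \<open>simp_all add: B_def\<close>)
  interpret holder_potential A I \<nu> \<alpha> \<phi>
    by unfold_locales (use assms(16,17) in \<open>simp_all add: B_def H_def\<close>)
  obtain l f \<mu> where pair: "eigenpair A I \<nu> \<alpha> \<phi> l f" and \<mu>: "prob_on B \<mu>"
    and lim: "\<And>h. continuous_on B h \<Longrightarrow>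
      (\<integral>x. h x \<partial>\<mu>) = normalized_holder_potential.limit A I \<nu> (normalized_potential B \<phi> l f) h"
    and mean: "(\<integral>x. 1 / f x \<partial>\<mu>) = 1"
    unfolding B_def using exists_normalized_eigenpair by metis
  interpret eigenpair A I \<nu> \<alpha> \<phi> l f by (rule pair)
  note lim' = lim[unfolded B_def] and \<mu>' = \<mu>[unfolded B_def]
  let ?\<rho> = "density \<mu> (\<lambda>x. ennreal (1 / f x))"
  note rho = eigenmeasure[OF \<mu>' lim' mean]
  have eig: "ruelle \<nu> A I \<phi> f = (\<lambda>x. l * f x)"
  proof
    fix x show "ruelle \<nu> A I \<phi> f x = l * f x"
      using eigen[of x] by (cases "x \<in> admissible A I") (simp_all add: L_outside f_outside)
  qed
  have max: "cmod z \<le> l" if z: "eigenvalue LC HC z" for z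
  proof -
    obtain h where h: "h \<in> HC" "LC h = (\<lambda>x. z * h x)" "h \<noteq> (\<lambda>_. 0)"
      using z by (auto simp: eigenvalue_def eigenspace_def)
    have hH: "h \<in> holder_space \<alpha> (admissible A I)" using h(1) by (simp add: HC_def B_def)
    then have hc: "continuous_on (admissible A I) h" using holder_space_iff hbound_continuous by blast
    obtain w where w: "h w \<noteq> 0" using h(3) by auto
    then have "w \<in> admissible A I" using hH by (auto simp: holder_space_def)
    then show ?thesis
      using eigenvalue_bound[OF hc _ _ w] fun_cong[OF h(2)] by (simp add: LC_def)
  qed
  have unique: "\<mu>2 = \<mu>" if "prob_on B \<mu>2" "ruelle_dual \<nu> A I (normalized_potential B \<phi> l f) \<mu>2 \<mu>2" for \<mu>2
  proof (rule prob_on_eqI[OF compact_B _ \<mu>'])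
    show "prob_on (admissible A I) \<mu>2" using that(1) by (simp add: B_def)
    fix h :: "(nat \<Rightarrow> 'a) \<Rightarrow> real" assume "h \<in> cont_space (admissible A I)"
    then have "continuous_on (admissible A I) h" by (simp add: cont_space_def)
    then show "(\<integral>x. h x \<partial>\<mu>2) = (\<integral>x. h x \<partial>\<mu>)"
      using dual_fixed_integral[of \<mu>2 h] that lim' by (simp add: B_def)
  qed
  have conv: "uniform_limit B (\<lambda>n. (ruelle \<nu> A I (normalized_potential B \<phi> l f) ^^ n) \<psi>) (\<lambda>_. \<integral>x. \<psi> x \<partial>\<mu>) sequentially"
    if mix: "top_mixing shift B" and \<psi>: "\<psi> \<in> H" for \<psi>
  proof -
    have "continuous_on (admissible A I) \<psi>"
      using \<psi> holder_space_iff hbound_continuous unfolding H_def B_def by blast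
    then show ?thesis using mixing_limit[of \<psi>] mix lim' by (simp add: B_def)
  qed
  have gap: "\<exists>r. 0 \<le> r \<and> r < l \<and> spectrum_on LC HC (holder_norm \<alpha> B) - {of_real l} \<subseteq> cball 0 r"
    if mix: "top_mixing shift B"
    using spectral_gap mix unfolding LC_def HC_def B_def by metis
  show ?thesis
    unfolding Let_def
  proof (rule exI[of _ l], rule conjI[OF l], rule bexI[of _ f], rule exI[of _ ?\<rho>], rule exI[of _ \<mu>],
      intro conjI allI impI ballI)
    show "f \<in> H" unfolding H_def B_def by (rule f_holder)
    show "0 < f x" if "x \<in> B" for x using f_pos that by (simp add: B_def)
    show "ruelle \<nu> A I \<phi> f = (\<lambda>x. l * f x)" by (rule eig)
    show "simple_eigenvalue LC HC (of_real l)" unfolding LC_def HC_def B_def by (rule simple_eigenvalue)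
    show "cmod z \<le> l" if "eigenvalue LC HC z" for z by (rule max[OF that])
    show "prob_on B ?\<rho>" unfolding B_def by (rule rho(1))
    show "ruelle_dual \<nu> A I \<phi> ?\<rho> (scale_measure (ennreal l) ?\<rho>)" by (rule rho(2))
    show "prob_on B \<mu>" by (rule \<mu>)
    show "ruelle_dual \<nu> A I (normalized_potential B \<phi> l f) \<mu> \<mu>"
      unfolding B_def by (rule invariant_prob_dual[OF \<mu>' lim'])
    show "\<mu>2 = \<mu>" if "prob_on B \<mu>2 \<and> ruelle_dual \<nu> A I (normalized_potential B \<phi> l f) \<mu>2 \<mu>2" for \<mu>2
      using that unique by blast
    show "invariant_measure shift \<mu>" by (rule invariant_prob_shift[OF \<mu>' lim'])
    show "\<mu> = density ?\<rho> (\<lambda>x. ennreal (f x))" by (rule rho(3))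
    show "uniform_limit B (\<lambda>n. (ruelle \<nu> A I (normalized_potential B \<phi> l f) ^^ n) \<psi>) (\<lambda>_. \<integral>x. \<psi> x \<partial>\<mu>) sequentially"
      if "top_mixing shift B" "\<psi> \<in> H" for \<psi> by (rule conv[OF that])
    show "\<exists>r. 0 \<le> r \<and> r < l \<and> spectrum_on LC HC (holder_norm \<alpha> B) - {of_real l} \<subseteq> cball 0 r"
      if "top_mixing shift B" by (rule gap[OF that])
  qed
qed

end
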